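(* Let $\mathfrak{g}$ be the complex simple Lie algebra of type $\mathrm{G}_2$, let $\phi:\mathfrak{g}\to\mathfrak{gl}(V)$ be the irreducible representation with highest weight $\lambda$, let $\mu_1,\dots,\mu_s$ be the distinct dominant weights of $V$, and let $k_i=|O_{\mu_i}|$ be the size of the orbit of $\mu_i$ under the Weyl group $\mathscr{W}(\mathrm{G}_2)$ (the dihedral group of order $12$). Then $$f_\phi(z_0,L)=(f_{\mu_1})^{m_\lambda(\mu_1)}\cdots(f_{\mu_s})^{m_\lambda(\mu_s)},$$ where each $f_{\mu_i}$ is an irreducible polynomial of degree $k_i$.
   Context: $f_\phi(z_0,L)=\det(z_0I+\phi(L))$, viewed as a polynomial in $z_0$ and the coordinates of $L$ with respect to a Chevalley basis of $\mathfrak{g}$ (equivalently, a polynomial function on $\mathbb{C}\times\mathfrak{g}$). $m_\lambda(\mu)$ is the dimension of the $\mu$-weight space of $V$. Let $\mathfrak{h}$ be a Cartan subalgebra, $\mathscr{W}$ the Weyl group acting on $\mathfrak{h}^*$, $O_\mu=\mathscr{W}\mu$. Orbital factor: for semisimple $L\in\mathfrak{g}$ choose $h\in\mathfrak{h}$ conjugate to $L$ under the adjoint group (unique up to $\mathscr{W}$) and set $f_\mu(z_0,L)=\prod_{\nu\in O_\mu}(z_0+\nu(h))$; this extends uniquely to a polynomial function on $\mathbb{C}\times\mathfrak{g}$. Irreducibility is over $\mathbb{C}$ in the polynomial ring in $z_0$ and the coordinates of $L$. *)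

theory Defs
  imports "HOL-Analysis.Analysis" "HOL-Library.Poly_Mapping"
    "HOL-Computational_Algebra.Factorial_Ring"
begin

type_synonym 'v mpoly = "('v \<Rightarrow>\<^sub>0 nat) \<Rightarrow>\<^sub>0 complex"

definition mpoly_eval :: "'v mpoly \<Rightarrow> ('v \<Rightarrow> complex) \<Rightarrow> complex" where
  "mpoly_eval p a = (\<Sum>m\<in>Poly_Mapping.keys p. Poly_Mapping.lookup p m * (\<Prod>v\<in>Poly_Mapping.keys (m::'v \<Rightarrow>\<^sub>0 nat). a v ^ Poly_Mapping.lookup m v))"

definition mpoly_total_degree :: "'v mpoly \<Rightarrow> nat" where
  "mpoly_total_degree p = Max (insert 0 ((\<lambda>m::'v \<Rightarrow>\<^sub>0 nat. \<Sum>v\<in>Poly_Mapping.keys m. Poly_Mapping.lookup m v) ` Poly_Mapping.keys p))"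

section \<open>Lie algebras on coordinate space complex^'n (coordinates = a fixed basis)\<close>

definition lie_algebra :: "(complex^'n \<Rightarrow> complex^'n \<Rightarrow> complex^'n) \<Rightarrow> bool" where
  "lie_algebra br \<longleftrightarrow>
     (\<forall>x y z. br (x + y) z = br x z + br y z) \<and>
     (\<forall>c x y. br (c *s x) y = c *s br x y) \<and>
     (\<forall>x. br x x = 0) \<and>
     (\<forall>x y z. br x (br y z) + br y (br z x) + br z (br x y) = 0)"

definition lie_ideal :: "(complex^'n \<Rightarrow> complex^'n \<Rightarrow> complex^'n) \<Rightarrow> (complex^'n) set \<Rightarrow> bool" where
  "lie_ideal br I \<longleftrightarrow> vec.subspace I \<and> (\<forall>x y. y \<in> I \<longrightarrow> br x y \<in> I)"

definition simple_lie_algebra :: "(complex^'n \<Rightarrow> complex^'n \<Rightarrow> complex^'n) \<Rightarrow> bool" where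
  "simple_lie_algebra br \<longleftrightarrow> lie_algebra br \<and> (\<exists>x y. br x y \<noteq> 0) \<and>
     (\<forall>I. lie_ideal br I \<longrightarrow> I = {0} \<or> I = UNIV)"

definition lie_subalgebra :: "(complex^'n \<Rightarrow> complex^'n \<Rightarrow> complex^'n) \<Rightarrow> (complex^'n) set \<Rightarrow> bool" where
  "lie_subalgebra br H \<longleftrightarrow> vec.subspace H \<and> (\<forall>x\<in>H. \<forall>y\<in>H. br x y \<in> H)"

definition cartan_subalgebra :: "(complex^'n \<Rightarrow> complex^'n \<Rightarrow> complex^'n) \<Rightarrow> (complex^'n) set \<Rightarrow> bool" where
  "cartan_subalgebra br H \<longleftrightarrow> lie_subalgebra br H \<and>
     (\<exists>k. \<forall>xs y. set xs \<subseteq> H \<longrightarrow> length xs = k \<longrightarrow> y \<in> H \<longrightarrow> foldr br xs y = 0) \<and>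
     {x. \<forall>h\<in>H. br x h \<in> H} = H"

text \<open>Elements of H^* are represented as functions that vanish outside H (so that equality of
  such functions is equality of functionals on H).\<close>

definition hfun :: "(complex^'n) set \<Rightarrow> (complex^'n \<Rightarrow> complex) \<Rightarrow> bool" where
  "hfun H f \<longleftrightarrow> (\<forall>x. x \<notin> H \<longrightarrow> f x = 0)"

definition root_space :: "(complex^'n \<Rightarrow> complex^'n \<Rightarrow> complex^'n) \<Rightarrow> (complex^'n) set
    \<Rightarrow> (complex^'n \<Rightarrow> complex) \<Rightarrow> (complex^'n) set" where
  "root_space br H \<alpha> = {x. \<forall>h\<in>H. br h x = \<alpha> h *s x}"

definition roots :: "(complex^'n \<Rightarrow> complex^'n \<Rightarrow> complex^'n) \<Rightarrow> (complex^'n) set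
    \<Rightarrow> (complex^'n \<Rightarrow> complex) set" where
  "roots br H = {\<alpha>. hfun H \<alpha> \<and> (\<exists>h\<in>H. \<alpha> h \<noteq> 0) \<and> root_space br H \<alpha> \<noteq> {0}}"

definition coroot :: "(complex^'n \<Rightarrow> complex^'n \<Rightarrow> complex^'n) \<Rightarrow> (complex^'n) set
    \<Rightarrow> (complex^'n \<Rightarrow> complex) \<Rightarrow> complex^'n" where
  "coroot br H \<alpha> = (THE h. h \<in> H \<and>
     h \<in> vec.span {br x y |x y. x \<in> root_space br H \<alpha> \<and> y \<in> root_space br H (\<lambda>t. - \<alpha> t)} \<and>
     \<alpha> h = 2)"

definition reflection :: "(complex^'n \<Rightarrow> complex^'n \<Rightarrow> complex^'n) \<Rightarrow> (complex^'n) set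
    \<Rightarrow> (complex^'n \<Rightarrow> complex) \<Rightarrow> (complex^'n \<Rightarrow> complex) \<Rightarrow> (complex^'n \<Rightarrow> complex)" where
  "reflection br H \<alpha> \<nu> = (\<lambda>x. \<nu> x - \<nu> (coroot br H \<alpha>) * \<alpha> x)"

inductive_set weyl_orbit :: "(complex^'n \<Rightarrow> complex^'n \<Rightarrow> complex^'n) \<Rightarrow> (complex^'n) set
    \<Rightarrow> (complex^'n \<Rightarrow> complex) \<Rightarrow> (complex^'n \<Rightarrow> complex) set"
  for br H \<mu> where
  self: "\<mu> \<in> weyl_orbit br H \<mu>"
| refl: "\<nu> \<in> weyl_orbit br H \<mu> \<Longrightarrow> \<alpha> \<in> roots br H \<Longrightarrow> reflection br H \<alpha> \<nu> \<in> weyl_orbit br H \<mu>"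

definition g2_base :: "(complex^'n \<Rightarrow> complex^'n \<Rightarrow> complex^'n) \<Rightarrow> (complex^'n) set
    \<Rightarrow> (complex^'n \<Rightarrow> complex) \<Rightarrow> (complex^'n \<Rightarrow> complex) \<Rightarrow> bool" where
  "g2_base br H \<alpha>1 \<alpha>2 \<longleftrightarrow> \<alpha>1 \<in> roots br H \<and> \<alpha>2 \<in> roots br H \<and>
     (\<forall>a b. (\<forall>h\<in>H. a * \<alpha>1 h + b * \<alpha>2 h = 0) \<longrightarrow> a = 0 \<and> b = 0) \<and>
     (\<forall>\<beta>\<in>roots br H. \<exists>c1 c2::int. (\<forall>h\<in>H. \<beta> h = of_int c1 * \<alpha>1 h + of_int c2 * \<alpha>2 h) \<and>
         ((c1 \<ge> 0 \<and> c2 \<ge> 0) \<or> (c1 \<le> 0 \<and> c2 \<le> 0))) \<and>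
     \<alpha>1 (coroot br H \<alpha>2) = -1 \<and> \<alpha>2 (coroot br H \<alpha>1) = -3"

definition dominant :: "(complex^'n \<Rightarrow> complex^'n \<Rightarrow> complex^'n) \<Rightarrow> (complex^'n) set
    \<Rightarrow> (complex^'n \<Rightarrow> complex) \<Rightarrow> (complex^'n \<Rightarrow> complex) \<Rightarrow> (complex^'n \<Rightarrow> complex) \<Rightarrow> bool" where
  "dominant br H \<alpha>1 \<alpha>2 \<nu> \<longleftrightarrow> \<nu> (coroot br H \<alpha>1) \<in> \<nat> \<and> \<nu> (coroot br H \<alpha>2) \<in> \<nat>"

definition ad_nilpotent :: "(complex^'n \<Rightarrow> complex^'n \<Rightarrow> complex^'n) \<Rightarrow> complex^'n \<Rightarrow> bool" where
  "ad_nilpotent br x \<longleftrightarrow> (\<exists>k. \<forall>y. (br x ^^ k) y = 0)"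

definition exp_ad :: "(complex^'n \<Rightarrow> complex^'n \<Rightarrow> complex^'n) \<Rightarrow> complex^'n \<Rightarrow> complex^'n \<Rightarrow> complex^'n" where
  "exp_ad br x y = (\<Sum>k\<le>CARD('n). (inverse (fact k)) *s ((br x ^^ k) y))"

inductive_set adjoint_group :: "(complex^'n \<Rightarrow> complex^'n \<Rightarrow> complex^'n) \<Rightarrow> (complex^'n \<Rightarrow> complex^'n) set"
  for br where
  id: "id \<in> adjoint_group br"
| step: "\<sigma> \<in> adjoint_group br \<Longrightarrow> ad_nilpotent br x \<Longrightarrow> exp_ad br x \<circ> \<sigma> \<in> adjoint_group br"

definition lie_rep :: "(complex^'n \<Rightarrow> complex^'n \<Rightarrow> complex^'n) \<Rightarrow> (complex^'n \<Rightarrow> complex^'d^'d) \<Rightarrow> bool" where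
  "lie_rep br \<phi> \<longleftrightarrow> (\<forall>x y. \<phi> (x + y) = \<phi> x + \<phi> y) \<and> (\<forall>c x. \<phi> (c *s x) = mat c ** \<phi> x) \<and>
     (\<forall>x y. \<phi> (br x y) = \<phi> x ** \<phi> y - \<phi> y ** \<phi> x)"

definition irreducible_rep :: "(complex^'n \<Rightarrow> complex^'d^'d) \<Rightarrow> bool" where
  "irreducible_rep \<phi> \<longleftrightarrow> (\<forall>W. vec.subspace W \<longrightarrow> (\<forall>x. \<forall>v\<in>W. \<phi> x *v v \<in> W) \<longrightarrow>
      W = {0} \<or> W = UNIV)"

definition weight_space :: "(complex^'n) set \<Rightarrow> (complex^'n \<Rightarrow> complex^'d^'d)
    \<Rightarrow> (complex^'n \<Rightarrow> complex) \<Rightarrow> (complex^'d) set" where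
  "weight_space H \<phi> \<nu> = {v. \<forall>h\<in>H. \<phi> h *v v = \<nu> h *s v}"

definition weight_mult :: "(complex^'n) set \<Rightarrow> (complex^'n \<Rightarrow> complex^'d^'d)
    \<Rightarrow> (complex^'n \<Rightarrow> complex) \<Rightarrow> nat" where
  "weight_mult H \<phi> \<nu> = vec.dim (weight_space H \<phi> \<nu>)"

definition rep_weights :: "(complex^'n) set \<Rightarrow> (complex^'n \<Rightarrow> complex^'d^'d)
    \<Rightarrow> (complex^'n \<Rightarrow> complex) set" where
  "rep_weights H \<phi> = {\<nu>. hfun H \<nu> \<and> weight_space H \<phi> \<nu> \<noteq> {0}}"

definition pt :: "complex \<Rightarrow> complex^'n \<Rightarrow> 'n option \<Rightarrow> complex" where
  "pt z0 L v = (case v of None \<Rightarrow> z0 | Some i \<Rightarrow> L $ i)"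

definition f_phi :: "(complex^'n \<Rightarrow> complex^'d^'d) \<Rightarrow> 'n option mpoly" where
  "f_phi \<phi> = (THE P. \<forall>z0 L. mpoly_eval P (pt z0 L) = det (mat z0 + \<phi> L))"

definition orbital_factor :: "(complex^'n \<Rightarrow> complex^'n \<Rightarrow> complex^'n) \<Rightarrow> (complex^'n) set
    \<Rightarrow> (complex^'n \<Rightarrow> complex) \<Rightarrow> 'n option mpoly" where
  "orbital_factor br H \<mu> = (THE P. \<forall>z0 h \<sigma>. h \<in> H \<longrightarrow> \<sigma> \<in> adjoint_group br \<longrightarrow>
      mpoly_eval P (pt z0 (\<sigma> h)) = (\<Prod>\<nu>\<in>weyl_orbit br H \<mu>. z0 + \<nu> h))"

end

theory Submission
  imports Defs "HOL-Computational_Algebra.Fundamental_Theorem_Algebra"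
begin

text \<open>
  Both sides of the factorization are compared on the conjugates \<open>\<sigma> h\<close> of elements of the Cartan
  subalgebra, where \<open>det (z + \<phi> (\<sigma> h)) = det (z + \<phi> h)\<close> splits into the weights; polynomials that agree on
  these conjugates are equal, because \<open>L \<mapsto> exp (ad L\<^sub>\<beta>\<^sub>1) \<dots> exp (ad L\<^sub>\<beta>\<^sub>m) L\<^sub>0\<close> is open at a regular element.
  The orbital factors are polynomials since the orbit product over a Weyl orbit of \<open>G\<^sub>2\<close> is a polynomial
  in the two basic invariants, and these are obtained from the traces of \<open>(ad L)\<^sup>2\<close> and \<open>(ad L)\<^sup>6\<close>.

  For irreducibility let \<open>f = P Q\<close>. Over a regular \<open>h\<close> the roots \<open>z = - \<nu> h\<close> of \<open>f\<close> are simple, so each of them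
  is a root of exactly one of \<open>P\<close> and \<open>Q\<close>, and along a polynomial curve \<open>(- \<nu> h, exp (t ad x) h)\<close> the same
  factor vanishes throughout. As every reflection of the Weyl group is realized by such exponentials,
  one factor vanishes at all the roots. The other one vanishes nowhere on the regular conjugates,
  hence is constant.
\<close>

section \<open>Generalized eigenspaces of one endomorphism\<close>

text \<open>The notions of the statement are bare: a Cartan subalgebra is a nilpotent
  self-normalizing subalgebra, and roots and weights are joint eigenvalues. The structure theory
  (Killing form, one-dimensional root spaces, sl_2-triples, integrality and Weyl invariance of
  weights) is therefore derived here, mostly from the vanishing of traces of commutators on weight
  strings. Two obstacles shape the rest. \<open>orbital_factor\<close> is a definite description, so
  it has the intended meaning only once a polynomial with the prescribed values at all
  \<open>\<sigma> h\<close> is exhibited. Traces of powers of ad L are polynomial in L and constant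
  on conjugates, so an orbit product expressed through them meets both demands at once. And
  \<open>adjoint_group\<close> is generated by exp (ad x) for every ad-nilpotent x, while det (z +
  \<open>\<phi>\<close> L) is shown to be unchanged when \<open>\<phi>\<close> x is nilpotent as
  well, which is established for root vectors. Hence density is proved for any set that contains H
  and is closed under exponentials of root vectors.\<close>

abbreviation lin :: "(complex^'n \<Rightarrow> complex^'m) \<Rightarrow> bool" where
  "lin T \<equiv> Vector_Spaces.linear (*s) (*s) T"

lemma linI:
  assumes "\<And>x y. T (x + y) = T x + T y" "\<And>c x. T (c *s x) = c *s T x"
  shows "lin T"
  using assms by (simp add: Vector_Spaces.linear_iff vec.vector_space_axioms)

lemma lin_funpow: "lin T \<Longrightarrow> lin (T ^^ k)" for T :: "complex^'n \<Rightarrow> complex^'n"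
proof (induction k)
  case 0
  show ?case by (intro linI) auto
next
  case (Suc k)
  then show ?case by (intro linI) (auto simp: vec.linear_add vec.linear_scale)
qed

definition shift :: "(complex^'n \<Rightarrow> complex^'n) \<Rightarrow> complex \<Rightarrow> complex^'n \<Rightarrow> complex^'n" where
  "shift T a v = T v - a *s v"

lemma lin_shift: "lin T \<Longrightarrow> lin (shift T a)"
  by (intro linI) (auto simp: shift_def vec.linear_add vec.linear_scale vec.scale_right_distrib
      vec.scale_right_diff_distrib vec.scale_left_commute)

lemma shift_0 [simp]: "shift T 0 = T"
  by (auto simp: shift_def)

text \<open>Nilpotency at one vector, with an exponent that may depend on it;
  \<open>evnil (shift T a) v\<close> then says that v is a generalized eigenvector of T for a, the
  zero vector included.\<close>

definition evnil :: "(complex^'n \<Rightarrow> complex^'n) \<Rightarrow> complex^'n \<Rightarrow> bool" where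
  "evnil D v \<longleftrightarrow> (\<exists>k. (D ^^ k) v = 0)"

lemma funpow_zero_mono:
  fixes D :: "complex^'n \<Rightarrow> complex^'n"
  assumes "lin D" "(D ^^ k) v = 0" "k \<le> m"
  shows "(D ^^ m) v = 0"
proof -
  have "(D ^^ m) v = (D ^^ (m - k)) ((D ^^ k) v)"
    using assms(3) by (simp add: funpow_add[symmetric, THEN fun_cong, unfolded comp_def])
  then show ?thesis using assms lin_funpow[OF assms(1)] by (simp add: vec.linear_0)
qed

lemma subspace_evnil:
  fixes D :: "complex^'n \<Rightarrow> complex^'n"
  assumes "lin D" shows "vec.subspace {v. evnil D v}"
proof (rule vec.subspaceI)
  show "0 \<in> {v. evnil D v}" by (auto simp: evnil_def intro!: exI[of _ 0])
next
  fix x y assume "x \<in> {v. evnil D v}" "y \<in> {v. evnil D v}"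
  then obtain j k where jk: "(D ^^ j) x = 0" "(D ^^ k) y = 0" by (auto simp: evnil_def)
  have "(D ^^ (j + k)) (x + y) = 0"
    using funpow_zero_mono[OF assms jk(1), of "j+k"] funpow_zero_mono[OF assms jk(2), of "j+k"]
    by (simp add: vec.linear_add[OF lin_funpow[OF assms]])
  then show "x + y \<in> {v. evnil D v}" unfolding evnil_def by blast
next
  fix c x assume "x \<in> {v. evnil D v}"
  then show "c *s x \<in> {v. evnil D v}"
    by (auto simp: evnil_def vec.linear_scale[OF lin_funpow[OF assms]])
qed

lemma evnil_shift_eigen:
  assumes "T v = a *s v" shows "evnil (shift T a) v"
  using assms by (auto simp: evnil_def shift_def intro!: exI[of _ 1])

lemma stable_funpow: "\<lbrakk>D ` U \<subseteq> U; v \<in> U\<rbrakk> \<Longrightarrow> (D ^^ k) v \<in> U"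
  by (induction k) auto

lemma stable_shift:
  "\<lbrakk>vec.subspace U; T ` U \<subseteq> U\<rbrakk> \<Longrightarrow> shift T a ` U \<subseteq> U"
  by (auto simp: shift_def intro!: vec.subspace_diff vec.subspace_scale)

text \<open>T maps a basis of U to a spanning set of U with at most dim U elements, hence
  injectively to a basis.\<close>

lemma stable_surj_inj:
  assumes T: "lin T" and U: "vec.subspace U" and TU: "T ` U = U"
    and u: "u \<in> U" "T u = 0"
  shows "u = 0"
proof -
  obtain B where B: "B \<subseteq> U" "vec.independent B" "U \<subseteq> vec.span B" "card B = vec.dim U"
    using vec.basis_exists[of U] by blast
  have fin: "finite B" using B(2) by (rule vec.finiteI_independent)
  have sB: "vec.span B = U" using B U by (metis vec.span_minimal subset_antisym)
  have sTB: "vec.span (T ` B) = U" by (simp add: vec.linear_span_image[OF T] sB TU)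
  have c1: "vec.dim U \<le> card (T ` B)"
    using sTB fin by (metis finite_imageI vec.dim_le_card order_refl)
  have c2: "card (T ` B) \<le> card B" using fin by (rule card_image_le)
  have "card (T ` B) = card B" using c1 c2 B(4) by simp
  then have inj: "inj_on T B" using fin by (simp add: eq_card_imp_inj_on)
  have "vec.independent (T ` B)"
    using vec.card_le_dim_spanning[of "T ` B" U] TU B(1) sTB fin c2 B(4) by auto
  then have "inj_on T (vec.span B)"
    using inj vec.linear_inj_on_span_independent_image[OF T] by blast
  then show ?thesis
    using inj_onD[of T "vec.span B" u 0] sB u vec.linear_0[OF T] vec.subspace_0[OF U] by simp
qed

section \<open>Polynomials in one operator; eigenvectors and the Fitting decomposition\<close>

definition polyop :: "(complex^'n \<Rightarrow> complex^'n) \<Rightarrow> complex^'n \<Rightarrow> complex poly \<Rightarrow> complex^'n" where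
  "polyop T v p = fold_coeffs (\<lambda>a w. a *s v + T w) p 0"

context
  fixes T :: "complex^'n \<Rightarrow> complex^'n"
  assumes T: "lin T"
begin

lemma polyop_0 [simp]: "polyop T v 0 = 0"
  by (simp add: polyop_def)

lemma polyop_pCons [simp]: "polyop T v (pCons a p) = a *s v + T (polyop T v p)"
  by (cases "a = 0 \<and> p = 0") (auto simp: polyop_def vec.linear_0[OF T])

lemma polyop_add: "polyop T v (p + q) = polyop T v p + polyop T v q"
  by (induction p q rule: poly_induct2)
     (auto simp: vec.linear_add[OF T] vec.scale_left_distrib)

lemma polyop_smult: "polyop T v (smult c p) = c *s polyop T v p"
  by (induction p) (auto simp: vec.linear_scale[OF T] vec.scale_right_distrib)

lemma polyop_diff: "polyop T v (p - q) = polyop T v p - polyop T v q"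
  using polyop_add[of v p "smult (-1) q"] polyop_smult[of v "-1" q] by simp

lemma polyop_linear_factor: "polyop T v ([:-a, 1:] * q) = shift T a (polyop T v q)"
  by (simp add: polyop_add polyop_smult shift_def polyop_diff)

lemma polyop_monom: "polyop T v (monom 1 k) = (T ^^ k) v"
  by (induction k) (auto simp: monom_0 monom_Suc vec.linear_0[OF T])

lemma polyop_stable:
  assumes "vec.subspace U" "T ` U \<subseteq> U" "v \<in> U"
  shows "polyop T v p \<in> U"
  using assms by (induction p) (auto intro!: vec.subspace_0 vec.subspace_add vec.subspace_scale)

text \<open>The iterates T^k v cannot stay independent beyond the dimension, so some T^k v is a
  combination of earlier ones, and the difference is a monic polynomial that kills v.\<close>

lemma annihilating_poly: "\<exists>p. p \<noteq> 0 \<and> polyop T v p = 0"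
proof -
  let ?S = "\<lambda>k. (\<lambda>i. (T ^^ i) v) ` {..<k}"
  have "\<exists>k. (T ^^ k) v \<in> vec.span (?S k)"
  proof (rule ccontr)
    assume *: "\<not> ?thesis"
    have ind: "vec.independent (?S k) \<and> card (?S k) = k" for k
    proof (induction k)
      case 0
      show ?case by (simp add: vec.independent_empty)
    next
      case (Suc k)
      have ins: "?S (Suc k) = insert ((T ^^ k) v) (?S k)" by (auto simp: lessThan_Suc)
      have nin: "(T ^^ k) v \<notin> vec.span (?S k)" using * by blast
      then have "(T ^^ k) v \<notin> ?S k" using vec.span_base[of "(T ^^ k) v" "?S k"] by argo
      then have "card (?S (Suc k)) = Suc k" unfolding ins using Suc by (subst card_insert_disjoint) auto
      moreover have "vec.independent (?S (Suc k))"
        unfolding ins using Suc nin by (intro vec.independent_insertI) auto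
      ultimately show ?case by blast
    qed
    have "card (?S (Suc CARD('n))) \<le> vec.dim (UNIV :: (complex^'n) set)"
      using ind by (intro vec.independent_card_le_dim) auto
    then show False using ind[of "Suc CARD('n)"] by (simp only: vec_dim_card)
  qed
  then obtain k where k: "(T ^^ k) v \<in> vec.span (?S k)" by blast
  let ?Q = "{polyop T v p |p. \<forall>i\<ge>k. coeff p i = 0}"
  have "vec.subspace ?Q"
  proof (rule vec.subspaceI)
    show "0 \<in> ?Q" by (auto intro!: exI[of _ 0])
  next
    fix x y assume "x \<in> ?Q" "y \<in> ?Q"
    then obtain p q where "x = polyop T v p" "\<forall>i\<ge>k. coeff p i = 0" "y = polyop T v q" "\<forall>i\<ge>k. coeff q i = 0"
      by blast
    then show "x + y \<in> ?Q" by (auto intro!: exI[of _ "p + q"] simp: polyop_add)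
  next
    fix c x assume "x \<in> ?Q"
    then obtain p where "x = polyop T v p" "\<forall>i\<ge>k. coeff p i = 0" by blast
    then show "c *s x \<in> ?Q" by (auto intro!: exI[of _ "smult c p"] simp: polyop_smult)
  qed
  moreover have "?S k \<subseteq> ?Q"
  proof
    fix x assume "x \<in> ?S k"
    then obtain i where "i < k" "x = (T ^^ i) v" by blast
    then show "x \<in> ?Q" by (auto intro!: exI[of _ "monom 1 i"] simp: polyop_monom)
  qed
  ultimately have "vec.span (?S k) \<subseteq> ?Q" by (rule vec.span_minimal[rotated])
  with k obtain p where p: "(T ^^ k) v = polyop T v p" "\<forall>i\<ge>k. coeff p i = 0" by blast
  have "coeff (monom 1 k - p) k \<noteq> 0" using p(2) by simp
  then have "monom 1 k - p \<noteq> 0" by (metis coeff_0)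
  moreover have "polyop T v (monom 1 k - p) = 0" by (simp add: polyop_diff polyop_monom p(1))
  ultimately show ?thesis by blast
qed

text \<open>Split a linear factor z - a off a polynomial that annihilates v: either the cofactor
  still annihilates v and has smaller degree, or its value at v is an eigenvector for a.\<close>

lemma eigenvector_exists:
  assumes U: "vec.subspace U" "T ` U \<subseteq> U" and "U \<noteq> {0}"
  shows "\<exists>a. \<exists>u\<in>U. u \<noteq> 0 \<and> T u = a *s u"
proof -
  obtain v where v: "v \<in> U" "v \<noteq> 0" using assms vec.subspace_0[OF U(1)] by blast
  obtain p where "p \<noteq> 0" "polyop T v p = 0" using annihilating_poly by blast
  then show ?thesis
  proof (induction "degree p" arbitrary: p rule: less_induct)
    case less
    have "degree p \<noteq> 0"
    proof
      assume "degree p = 0"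
      then obtain c where "p = [:c:]" by (rule degree_eq_zeroE)
      then show False using less v by (auto simp: vec.linear_0[OF T])
    qed
    then obtain a where a: "poly p a = 0"
      using fundamental_theorem_of_algebra[of p] constant_degree[of p] by auto
    then obtain q where q: "p = [:-a, 1:] * q" by (meson poly_eq_0_iff_dvd dvdE)
    have q0: "q \<noteq> 0" using less.prems q by auto
    have sh: "shift T a (polyop T v q) = 0" using less.prems(2) unfolding q polyop_linear_factor .
    show ?case
    proof (cases "polyop T v q = 0")
      case True
      have "degree q < degree p" unfolding q using q0 by (subst degree_mult_eq) auto
      then show ?thesis using less.hyps q0 True by blast
    next
      case False
      then show ?thesis using sh polyop_stable[OF U v(1), of q] by (auto simp: shift_def)
    qed
  qed
qed

text \<open>Fitting's lemma for D = T - a with an eigenvalue a: the images of D^k become stationary,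
  and the stable image is proper because D has a kernel in U. Induction applies to that image, and
  every vector of U differs from one in it by a vector that D^k kills.\<close>

lemma generalized_eigenvectors_span:
  assumes "vec.subspace U" "T ` U \<subseteq> U"
  shows "U \<subseteq> vec.span (\<Union>a. {u \<in> U. evnil (shift T a) u})"
  using assms
proof (induction "vec.dim U" arbitrary: U rule: less_induct)
  case less
  note U = less.prems
  show ?case
  proof (cases "U = {0}")
    case True
    then show ?thesis using vec.span_zero by auto
  next
    case False
    obtain a u where u: "u \<in> U" "u \<noteq> 0" "T u = a *s u" using eigenvector_exists[OF U False] by blast
    let ?D = "shift T a"
    have D: "lin ?D" by (rule lin_shift[OF T])
    have DU: "?D ` U \<subseteq> U" by (rule stable_shift[OF U])
    let ?I = "\<lambda>k. (?D ^^ k) ` U"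
    have subI: "vec.subspace (?I k)" for k
      using U(1) by (rule vec.linear_subspace_image[OF lin_funpow[OF D]])
    have ISuc: "?I (Suc k) = ?D ` ?I k" for k by (simp add: image_comp)
    have IU: "?I k \<subseteq> U" for k by (rule image_subsetI) (rule stable_funpow[OF DU])
    have dec: "?I (Suc k) \<subseteq> ?I k" for k
    proof -
      have "?D ^^ Suc k = ?D ^^ k \<circ> ?D" by (rule funpow_Suc_right)
      then have "?I (Suc k) = (?D ^^ k) ` (?D ` U)" by (simp only: image_comp)
      then show ?thesis using DU by auto
    qed
    have "\<exists>k. ?I (Suc k) = ?I k"
    proof (rule ccontr)
      assume "\<not> ?thesis"
      then have "?I (Suc k) \<subset> ?I k" for k using dec by blast
      then have lt: "vec.dim (?I (Suc k)) < vec.dim (?I k)" for k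
        using vec.dim_psubset[of "?I (Suc k)" "?I k"] subI vec.span_eq_iff by metis
      have "vec.dim (?I k) + k \<le> vec.dim U" for k
      proof (induction k)
        case (Suc k)
        then show ?case using lt[of k] by linarith
      qed auto
      from this[of "Suc (vec.dim U)"] show False by simp
    qed
    then obtain k where k: "?I (Suc k) = ?I k" by blast
    have st: "?D ` ?I k = ?I k" using k ISuc by simp
    have "?I (k + m) = ?I k" for m
      by (induction m) (use st ISuc in auto)
    then have kk: "?I (k + k) = ?I k" .
    have nI: "?I k \<noteq> U"
    proof
      assume "?I k = U"
      then have "?D ` U = U" using st by simp
      then have "u = 0" using stable_surj_inj[OF D U(1) _ u(1)] u(3) by (auto simp: shift_def)
      then show False using u by simp
    qed
    have "?I k \<subset> U" using nI IU by blast
    then have dlt: "vec.dim (?I k) < vec.dim U"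
      using vec.dim_psubset[of "?I k" U] subI U(1) vec.span_eq_iff by metis
    have TI: "T ` ?I k \<subseteq> ?I k"
    proof
      fix x assume "x \<in> T ` ?I k"
      then obtain y where y: "y \<in> ?I k" "x = T y" by blast
      have "x = ?D y + a *s y" using y by (simp add: shift_def)
      moreover have "?D y \<in> ?I k" using st y by blast
      ultimately show "x \<in> ?I k" using subI y by (auto intro!: vec.subspace_add vec.subspace_scale)
    qed
    let ?S = "\<Union>a. {u \<in> U. evnil (shift T a) u}"
    have "?I k \<subseteq> vec.span (\<Union>a. {u \<in> ?I k. evnil (shift T a) u})"
      by (rule less.hyps[OF dlt subI TI])
    also have "\<dots> \<subseteq> vec.span ?S" using IU by (intro vec.span_mono) blast
    finally have I: "?I k \<subseteq> vec.span ?S" .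
    show ?thesis
    proof
      fix x assume x: "x \<in> U"
      \<comment> \<open>The images of D^k and D^(2k) agree, so D^k x has a preimage under D^k inside
        the stable image.\<close>
      then have "(?D ^^ k) x \<in> ?I (k + k)" using kk by auto
      then obtain w where w: "w \<in> U" "(?D ^^ k) x = (?D ^^ k) ((?D ^^ k) w)"
        by (auto simp: funpow_add)
      let ?w = "(?D ^^ k) w"
      have "(?D ^^ k) (x - ?w) = 0" using w by (simp add: vec.linear_diff[OF lin_funpow[OF D]])
      then have "evnil ?D (x - ?w)" by (auto simp: evnil_def)
      moreover have "x - ?w \<in> U" using x w(1) U(1) IU by (intro vec.subspace_diff) auto
      ultimately have "x - ?w \<in> vec.span ?S" by (intro vec.span_base) auto
      moreover have "?w \<in> vec.span ?S" using I w(1) by auto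
      ultimately have "(x - ?w) + ?w \<in> vec.span ?S" by (rule vec.span_add)
      then show "x \<in> vec.span ?S" by simp
    qed
  qed
qed

text \<open>The kernels of T^j grow strictly until they become stationary, which leaves at most
  \<open>CARD('n)\<close> steps. This uniform exponent is what makes the truncation in
  \<open>exp_ad\<close> harmless.\<close>

lemma funpow_bound:
  assumes "evnil T v" shows "(T ^^ CARD('n)) v = 0"
proof -
  let ?K = "\<lambda>j. {v. (T ^^ j) v = 0}"
  have sub: "vec.subspace (?K j)" for j
    by (rule vec.linear_subspace_kernel[OF lin_funpow[OF T]])
  have mono: "?K j \<subseteq> ?K (Suc j)" for j using funpow_zero_mono[OF T, of j _ "Suc j"] by auto
  have "\<exists>j\<le>CARD('n). ?K (Suc j) = ?K j"
  proof (rule ccontr)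
    assume *: "\<not> ?thesis"
    have "j \<le> Suc CARD('n) \<Longrightarrow> j \<le> vec.dim (?K j)" for j
    proof (induction j)
      case (Suc j)
      then have "?K j \<subset> ?K (Suc j)" using * mono[of j] by auto
      then have "vec.dim (?K j) < vec.dim (?K (Suc j))"
        using vec.dim_psubset[of "?K j" "?K (Suc j)"] sub vec.span_eq_iff by metis
      then show ?case using Suc by simp
    qed auto
    then have "Suc CARD('n) \<le> vec.dim (?K (Suc CARD('n)))" by blast
    also have "\<dots> \<le> CARD('n)" using dim_subset_UNIV_cart_gen by blast
    finally show False by simp
  qed
  then obtain j where j: "j \<le> CARD('n)" "?K (Suc j) = ?K j" by blast
  have "?K (j + m) = ?K j" for m
  proof (induction m)
    case (Suc m)
    have "v \<in> ?K (j + Suc m) \<longleftrightarrow> (T ^^ m) v \<in> ?K (Suc j)" for v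
      by (simp add: funpow_add[symmetric, THEN fun_cong, unfolded comp_def] del: funpow.simps)
    moreover have "v \<in> ?K (j + m) \<longleftrightarrow> (T ^^ m) v \<in> ?K j" for v
      by (simp add: funpow_add[symmetric, THEN fun_cong, unfolded comp_def] del: funpow.simps)
    ultimately show ?case using Suc j(2) by blast
  qed auto
  then have K: "?K (j + m) = ?K j" for m .
  obtain k where "(T ^^ k) v = 0" using assms by (auto simp: evnil_def)
  then have "(T ^^ (j + k)) v = 0" using funpow_zero_mono[OF T] le_add2 by blast
  then have "(T ^^ j) v = 0" using K[of k] by blast
  then show ?thesis using funpow_zero_mono[OF T] j(1) by blast
qed

end

section \<open>Exponentials of derivations\<close>

text \<open>The pairing B has two uses: the bracket, with ad h shifted by a, b and a + b, and the
  action map (L, v) to L v, with ad x on L and \<open>\<phi>\<close> x on vectors.\<close>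

locale leibniz =
  fixes B :: "complex^'p \<Rightarrow> complex^'q \<Rightarrow> complex^'r"
    and D1 :: "complex^'p \<Rightarrow> complex^'p" and D2 :: "complex^'q \<Rightarrow> complex^'q"
    and D3 :: "complex^'r \<Rightarrow> complex^'r"
  assumes B1: "\<And>z. lin (\<lambda>y. B y z)" and B2: "\<And>y. lin (B y)"
    and L: "lin D1" "lin D2" "lin D3"
    and D: "\<And>y z. D3 (B y z) = B (D1 y) z + B y (D2 z)"
begin

lemma nil: "\<lbrakk>(D1 ^^ i) y = 0; (D2 ^^ j) z = 0\<rbrakk> \<Longrightarrow> (D3 ^^ (i + j)) (B y z) = 0"
proof (induction "i + j" arbitrary: i j y z)
  case 0
  then show ?case by (simp add: vec.linear_0[OF B1])
next
  case (Suc n)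
  show ?case
  proof (cases "i = 0 \<or> j = 0")
    case True
    then have "B y z = 0" using Suc.prems by (auto simp: vec.linear_0[OF B1] vec.linear_0[OF B2])
    then show ?thesis by (simp add: vec.linear_0[OF lin_funpow[OF L(3)]])
  next
    case False
    then obtain i' j' where ij: "i = Suc i'" "j = Suc j'" by (metis not0_implies_Suc)
    have 1: "(D3 ^^ (i' + j)) (B (D1 y) z) = 0"
      using Suc.hyps(2) Suc.prems ij by (intro Suc.hyps(1)) (auto simp: funpow_swap1)
    have 2: "(D3 ^^ (i + j')) (B y (D2 z)) = 0"
      using Suc.hyps(2) Suc.prems ij by (intro Suc.hyps(1)) (auto simp: funpow_swap1)
    have "(D3 ^^ (i + j)) (B y z) = (D3 ^^ n) (D3 (B y z))"
      unfolding Suc.hyps(2)[symmetric] by (simp add: funpow_swap1)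
    also have "\<dots> = (D3 ^^ n) (B (D1 y) z) + (D3 ^^ n) (B y (D2 z))"
      by (simp add: D vec.linear_add[OF lin_funpow[OF L(3)]])
    also have "\<dots> = 0" using 1 2 Suc.hyps(2) ij by simp
    finally show ?thesis .
  qed
qed

lemma evnil: "\<lbrakk>evnil D1 y; evnil D2 z\<rbrakk> \<Longrightarrow> evnil D3 (B y z)"
  unfolding evnil_def using nil by blast

lemma binomial:
  "(D3 ^^ k) (B y z) = (\<Sum>i\<le>k. of_nat (k choose i) *s B ((D1 ^^ i) y) ((D2 ^^ (k - i)) z))"
proof (induction k)
  case 0
  show ?case by simp
next
  case (Suc k)
  let ?g = "\<lambda>i j. B ((D1 ^^ i) y) ((D2 ^^ j) z)"
  have "(D3 ^^ Suc k) (B y z) = D3 (\<Sum>i\<le>k. of_nat (k choose i) *s ?g i (k - i))"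
    using Suc by simp
  also have "\<dots> = (\<Sum>i\<le>k. of_nat (k choose i) *s (?g (Suc i) (k - i) + ?g i (Suc (k - i))))"
    by (simp add: vec.linear_sum[OF L(3)] vec.linear_scale[OF L(3)] D)
  also have "\<dots> = (\<Sum>i\<le>k. of_nat (k choose i) *s ?g (Suc i) (k - i))
      + (\<Sum>i\<le>k. of_nat (k choose i) *s ?g i (Suc k - i))"
    by (simp add: sum.distrib vec.scale_right_distrib Suc_diff_le)
  also have "(\<Sum>i\<le>k. of_nat (k choose i) *s ?g i (Suc k - i))
     = (\<Sum>i\<le>Suc k. of_nat (k choose i) *s ?g i (Suc k - i))" by simp
  also have "\<dots> = ?g 0 (Suc k) + (\<Sum>i\<le>k. of_nat (k choose Suc i) *s ?g (Suc i) (k - i))"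
    by (subst sum.atMost_Suc_shift) simp
  finally have "(D3 ^^ Suc k) (B y z) = ?g 0 (Suc k) +
     (\<Sum>i\<le>k. of_nat (Suc k choose Suc i) *s ?g (Suc i) (k - i))"
    by (simp add: sum.distrib vec.scale_left_distrib ac_simps)
  also have "\<dots> = (\<Sum>i\<le>Suc k. of_nat (Suc k choose i) *s ?g i (Suc k - i))"
    by (subst sum.atMost_Suc_shift[of _ k]) simp
  finally show ?case .
qed

end

text \<open>N stays a parameter so that ad x and \<open>\<phi>\<close> x, which live on spaces of
  different dimension, can be exponentiated with a common bound.\<close>

definition truncexp :: "nat \<Rightarrow> (complex^'n \<Rightarrow> complex^'n) \<Rightarrow> complex^'n \<Rightarrow> complex^'n" where
  "truncexp N D y = (\<Sum>k\<le>N. inverse (fact k) *s (D ^^ k) y)"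

lemma truncexp_extend:
  assumes "lin D" "(D ^^ N) y = 0" "N \<le> M"
  shows "truncexp M D y = truncexp N D y"
  unfolding truncexp_def
  by (rule sum.mono_neutral_right)
     (use assms funpow_zero_mono[OF assms(1,2)] in \<open>auto simp: not_le\<close>)

lemma lin_truncexp: "lin D \<Longrightarrow> lin (truncexp N D)"
  by (intro linI) (auto simp: truncexp_def vec.linear_add[OF lin_funpow] vec.linear_scale[OF lin_funpow]
      vec.scale_right_distrib sum.distrib vec.scale_sum_right vec.scale_left_commute mult.commute)

text \<open>For nonzero v apply D^j with j the largest exponent that does not kill v: only the
  constant term of the exponential survives, and it leaves D^j v.\<close>

lemma truncexp_inj:
  fixes D :: "complex^'n \<Rightarrow> complex^'n"
  assumes D: "lin D" and n: "evnil D v" and e: "truncexp N D v = 0"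
  shows "v = 0"
proof (rule ccontr)
  assume v: "v \<noteq> 0"
  define k where "k = (LEAST k. (D ^^ k) v = 0)"
  have k: "(D ^^ k) v = 0" using n unfolding k_def evnil_def by (rule LeastI_ex)
  then have "k \<noteq> 0" using v by (metis funpow_0)
  then obtain j where j: "k = Suc j" by (metis not0_implies_Suc)
  have nz: "(D ^^ j) v \<noteq> 0" using not_less_Least[of j "\<lambda>k. (D ^^ k) v = 0"] j k_def by auto
  have "(D ^^ j) (truncexp N D v) = (\<Sum>i\<le>N. inverse (fact i) *s (D ^^ (j + i)) v)"
    by (simp add: truncexp_def vec.linear_sum[OF lin_funpow[OF D]] vec.linear_scale[OF lin_funpow[OF D]]
        funpow_add)
  also have "\<dots> = (\<Sum>i\<le>N. if i = 0 then (D ^^ j) v else 0)"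
  proof (rule sum.cong[OF HOL.refl])
    fix i show "inverse (fact i) *s (D ^^ (j + i)) v = (if i = 0 then (D ^^ j) v else 0)"
      using funpow_zero_mono[OF D k, of "j + i"] j by auto
  qed
  also have "\<dots> = (D ^^ j) v" by simp
  finally show False using e nz by (simp add: vec.linear_0[OF lin_funpow[OF D]])
qed

text \<open>Cauchy product of two exponentials: the terms in which the triangle i + j <= 2 N and the
  square i, j <= N differ contain at least an N-th power and vanish.\<close>

lemma (in leibniz) truncexp_hom:
  assumes N: "\<And>y. (D1 ^^ N) y = 0" "\<And>z. (D2 ^^ N) z = 0" "\<And>w. (D3 ^^ N) w = 0"
  shows "truncexp N D3 (B y z) = B (truncexp N D1 y) (truncexp N D2 z)"
proof -
  let ?g = "\<lambda>i j. (inverse (fact i) * inverse (fact j)) *s B ((D1 ^^ i) y) ((D2 ^^ j) z)"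
  have z1: "(D1 ^^ i) y = 0" if "N \<le> i" for i y using funpow_zero_mono[OF L(1) N(1) that] .
  have z2: "(D2 ^^ i) z = 0" if "N \<le> i" for i z using funpow_zero_mono[OF L(2) N(2) that] .
  have "truncexp N D3 (B y z) = truncexp (2 * N) D3 (B y z)"
    using truncexp_extend[OF L(3) N(3), of "2 * N"] by simp
  also have "\<dots> = (\<Sum>k<Suc (2 * N). \<Sum>i\<le>k. ?g i (k - i))"
    unfolding truncexp_def lessThan_Suc_atMost
  proof (rule sum.cong[OF HOL.refl])
    fix k
    have "inverse (fact k) * of_nat (k choose i) = (inverse (fact i) * inverse (fact (k - i)) :: complex)"
      if "i \<le> k" for i using that by (simp add: binomial_fact field_simps)
    then show "inverse (fact k) *s (D3 ^^ k) (B y z) = (\<Sum>i\<le>k. ?g i (k - i))"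
      by (simp add: binomial vec.scale_sum_right)
  qed
  also have "\<dots> = (\<Sum>(i,j)\<in>{(i,j). i + j < Suc (2 * N)}. ?g i j)"
    by (rule sum.triangle_reindex[symmetric])
  also have "\<dots> = (\<Sum>(i,j)\<in>{..N} \<times> {..N}. ?g i j)"
  proof (rule sum.mono_neutral_right)
    have "{(i,j). i + j < Suc (2 * N)} \<subseteq> {..2*N} \<times> {..2*N}" by auto
    then show "finite {(i,j). i + j < Suc (2 * N)}" by (rule finite_subset) auto
    show "{..N} \<times> {..N} \<subseteq> {(i,j). i + j < Suc (2 * N)}" by auto
    show "\<forall>p\<in>{(i,j). i + j < Suc (2 * N)} - {..N} \<times> {..N}. (case p of (i,j) \<Rightarrow> ?g i j) = 0"
    proof
      fix p assume p: "p \<in> {(i,j). i + j < Suc (2 * N)} - {..N} \<times> {..N}"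
      obtain i j where ij: "p = (i, j)" by (cases p)
      have "N \<le> i \<or> N \<le> j" using p ij by auto
      then have "B ((D1 ^^ i) y) ((D2 ^^ j) z) = 0"
        using z1 z2 by (auto simp: vec.linear_0[OF B1] vec.linear_0[OF B2])
      then show "(case p of (i,j) \<Rightarrow> ?g i j) = 0" by (simp add: ij)
    qed
  qed
  also have "\<dots> = (\<Sum>i\<le>N. \<Sum>j\<le>N. ?g i j)" by (simp add: sum.cartesian_product)
  also have "\<dots> = B (truncexp N D1 y) (truncexp N D2 z)"
    by (simp add: truncexp_def vec.linear_sum[OF B1] vec.linear_sum[OF B2]
        vec.linear_scale[OF B1] vec.linear_scale[OF B2] vec.scale_sum_right)
       (subst sum.swap, simp add: mult.commute)
  finally show ?thesis .
qed

section \<open>Simultaneous generalized eigenspaces\<close>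

lemma evnil_image: "evnil D v \<Longrightarrow> lin D \<Longrightarrow> evnil D (D v)"
  unfolding evnil_def by (metis funpow_swap1 vec.linear_0)

lemma evnil_shift_shift:
  assumes T: "lin T" and v: "evnil (shift T b) v"
  shows "evnil (shift T b) (shift T a v)"
proof -
  note s = subspace_evnil[OF lin_shift[OF T, of b]]
  have "shift T a v = shift T b v + (b - a) *s v"
    by (simp add: shift_def vec.scale_left_diff_distrib)
  moreover have "evnil (shift T b) (shift T b v)" using evnil_image[OF v lin_shift[OF T]] .
  moreover have "evnil (shift T b) ((b - a) *s v)" using vec.subspace_scale[OF s, of v "b - a"] v by blast
  ultimately show ?thesis using vec.subspace_add[OF s, of "shift T b v" "(b - a) *s v"] by simp
qed

text \<open>Induction on the exponent reduces to a true eigenvector for a, on which T - b acts as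
  the nonzero scalar a - b.\<close>

lemma evnil_shift_unique:
  fixes T :: "complex^'n \<Rightarrow> complex^'n"
  assumes T: "lin T" and "evnil (shift T a) v" "evnil (shift T b) v" "a \<noteq> b"
  shows "v = 0"
proof -
  obtain k where "(shift T a ^^ k) v = 0" using assms(2) by (auto simp: evnil_def)
  then show ?thesis using assms(3)
  proof (induction k arbitrary: v)
    case (Suc k)
    have "shift T a v = 0"
    proof (rule Suc.IH)
      show "(shift T a ^^ k) (shift T a v) = 0" using Suc.prems(1) by (simp only: funpow_Suc_right comp_apply)
    qed (rule evnil_shift_shift[OF T Suc.prems(2)])
    then have e: "T v = a *s v" by (simp add: shift_def)
    have p: "(shift T b ^^ j) v = (a - b) ^ j *s v" for j
    proof (induction j)
      case (Suc j)
      have "shift T b v = (a - b) *s v" by (simp add: shift_def e vec.scale_left_diff_distrib)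
      then show ?case using Suc by (simp add: vec.linear_scale[OF lin_shift[OF T]] mult.commute left_diff_distrib vec.scale_left_diff_distrib)
    qed simp
    obtain j where "(shift T b ^^ j) v = 0" using Suc.prems(2) by (auto simp: evnil_def)
    then show ?case using p[of j] \<open>a \<noteq> b\<close> by simp
  qed simp
qed

text \<open>The stability axiom is what a nilpotent algebra of operators provides, and commuting
  operators satisfy it too. Commutativity of H is itself deduced from the weight theory, so ad H has
  to enter in this weaker form.\<close>

locale gws_family =
  fixes T :: "'h \<Rightarrow> complex^'n \<Rightarrow> complex^'n" and S :: "'h set"
  assumes linT: "h \<in> S \<Longrightarrow> lin (T h)"
    and stab: "\<lbrakk>h \<in> S; h' \<in> S; evnil (shift (T h) a) v\<rbrakk> \<Longrightarrow> evnil (shift (T h) a) (T h' v)"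
begin

definition gws :: "('h \<Rightarrow> complex) \<Rightarrow> (complex^'n) set" where
  "gws f = {v. \<forall>h\<in>S. evnil (shift (T h) (f h)) v}"

lemma subspace_gws: "vec.subspace (gws f)"
proof -
  have "gws f = (\<Inter>h\<in>S. {v. evnil (shift (T h) (f h)) v})" by (auto simp: gws_def)
  also have "vec.subspace \<dots>"
    by (intro vec.subspace_Inter) (auto intro!: subspace_evnil lin_shift linT)
  finally show ?thesis .
qed

lemma gws_stable: "v \<in> gws f \<Longrightarrow> h \<in> S \<Longrightarrow> T h v \<in> gws f"
  by (auto simp: gws_def intro: stab)

text \<open>If every \<open>T h\<close> has a single eigenvalue on U, then U lies in one
  simultaneous space; otherwise the generalized eigenspaces of some \<open>T h\<close> in U are
  proper stable subspaces, and induction on the dimension applies.\<close>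

lemma gws_span:
  assumes "vec.subspace U" "\<And>h. h \<in> S \<Longrightarrow> T h ` U \<subseteq> U"
  shows "U \<subseteq> vec.span (\<Union>f. gws f \<inter> U)"
  using assms
proof (induction "vec.dim U" arbitrary: U rule: less_induct)
  case less
  note U = less.prems
  show ?case
  proof (cases "\<forall>h\<in>S. \<exists>a. \<forall>u\<in>U. evnil (shift (T h) a) u")
    case True
    then obtain f where "\<forall>h\<in>S. \<forall>u\<in>U. evnil (shift (T h) (f h)) u" by metis
    then have "U \<subseteq> gws f" by (auto simp: gws_def)
    then show ?thesis using vec.span_superset[of "\<Union>f. gws f \<inter> U"] by blast
  next
    case False
    then obtain h where h: "h \<in> S" "\<And>a. \<exists>u\<in>U. \<not> evnil (shift (T h) a) u" by blast
    let ?K = "\<lambda>a. {u \<in> U. evnil (shift (T h) a) u}"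
    have K: "?K a \<subseteq> vec.span (\<Union>f. gws f \<inter> U)" for a
    proof -
      have sub: "vec.subspace (?K a)"
        using vec.subspace_inter[OF U(1) subspace_evnil[OF lin_shift[OF linT[OF h(1)], of a]]]
        by (simp add: Int_def)
      have "?K a \<subset> U" using h(2)[of a] by blast
      then have "vec.dim (?K a) < vec.dim U"
        using vec.dim_psubset[of "?K a" U] sub U(1) vec.span_eq_iff by metis
      moreover have "T h' ` ?K a \<subseteq> ?K a" if "h' \<in> S" for h'
        using U(2)[OF that] stab[OF h(1) that] by auto
      ultimately have "?K a \<subseteq> vec.span (\<Union>f. gws f \<inter> ?K a)" using less.hyps sub by blast
      also have "\<dots> \<subseteq> vec.span (\<Union>f. gws f \<inter> U)" by (intro vec.span_mono) blast
      finally show ?thesis .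
    qed
    have "U \<subseteq> vec.span (\<Union>a. ?K a)"
      using generalized_eigenvectors_span[OF linT[OF h(1)] U(1) U(2)[OF h(1)]] .
    also have "\<dots> \<subseteq> vec.span (\<Union>f. gws f \<inter> U)"
      using K by (intro vec.span_minimal vec.subspace_span) blast
    finally show ?thesis .
  qed
qed

lemma gws_cong: "(\<And>h. h \<in> S \<Longrightarrow> f h = g h) \<Longrightarrow> gws f = gws g"
  by (auto simp: gws_def)

text \<open>Choose h with g h different from f0 h, which exists in S because members of F vanish
  outside S. A power of T h - f0 h removes the f0 term and leaves a shorter relation; by induction v
  g is a generalized eigenvector of \<open>T h\<close> for two eigenvalues.\<close>

lemma gws_indep:
  assumes "finite F" "\<And>f x. f \<in> F \<Longrightarrow> x \<notin> S \<Longrightarrow> f x = 0"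
    "\<And>f. f \<in> F \<Longrightarrow> v f \<in> gws f" "(\<Sum>f\<in>F. v f) = 0" "f \<in> F"
  shows "v f = 0"
  using assms
proof (induction F arbitrary: v f rule: finite_induct)
  case (insert f0 F)
  note z = insert.prems(1) note vg = insert.prems(2)
  have F: "v g = 0" if g: "g \<in> F" for g
  proof -
    have "g \<noteq> f0" using g insert.hyps by blast
    then obtain h where h: "g h \<noteq> f0 h" by blast
    have hS: "h \<in> S"
    proof (rule ccontr)
      assume "h \<notin> S"
      then have "g h = 0" "f0 h = 0" using z g by blast+
      then show False using h by simp
    qed
    let ?D = "shift (T h) (f0 h) ^^ CARD('n)"
    have L: "lin (shift (T h) (f0 h))" using linT[OF hS] by (rule lin_shift)
    have D0: "?D (v f0) = 0" using vg[of f0] hS by (intro funpow_bound[OF L]) (auto simp: gws_def)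
    have "(\<Sum>g\<in>F. ?D (v g)) = ?D (\<Sum>g\<in>insert f0 F. v g)"
      using insert.hyps D0 by (simp add: vec.linear_sum[OF lin_funpow[OF L]] vec.linear_add[OF lin_funpow[OF L]])
    also have "\<dots> = 0" by (simp only: insert.prems(3) vec.linear_0[OF lin_funpow[OF L]])
    finally have s: "(\<Sum>g\<in>F. ?D (v g)) = 0" .
    have "(shift (T h) (f0 h)) ` gws g' \<subseteq> gws g'" for g'
      by (rule stable_shift[OF subspace_gws]) (auto intro: gws_stable hS)
    then have "?D (v g') \<in> gws g'" if "g' \<in> F" for g'
      using vg[of g'] that by (intro stable_funpow) auto
    then have "?D (v g) = 0"
      using z s by (intro insert.IH[of "\<lambda>g. ?D (v g)"]) (auto intro: g)
    then have "evnil (shift (T h) (f0 h)) (v g)" unfolding evnil_def by blast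
    moreover have "evnil (shift (T h) (g h)) (v g)" using vg[of g] g hS by (auto simp: gws_def)
    ultimately show ?thesis using evnil_shift_unique[OF linT[OF hS]] h by metis
  qed
  moreover have "v f0 = 0" using insert.prems(3) insert.hyps F by simp
  ultimately show ?case using insert.prems(4) by blast
qed simp

definition wts :: "('h \<Rightarrow> complex) set" where
  "wts = {f. (\<forall>x. x \<notin> S \<longrightarrow> f x = 0) \<and> gws f \<noteq> {0}}"

lemma finite_wts: "finite wts"
proof (rule finite_if_finite_subsets_card_bdd[THEN conjunct1])
  fix F assume F: "F \<subseteq> wts" "finite F"
  have "\<forall>f\<in>F. \<exists>v. v \<in> gws f \<and> v \<noteq> 0"
    using F vec.subspace_0[OF subspace_gws] by (auto simp: wts_def)
  then obtain v where v: "\<And>f. f \<in> F \<Longrightarrow> v f \<in> gws f \<and> v f \<noteq> 0" by metis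
  have zero: "c f = 0" if "(\<Sum>f\<in>F. c f *s v f) = 0" "f \<in> F" for c f
  proof -
    have "c f *s v f = 0"
      using gws_indep[of F "\<lambda>f. c f *s v f" f] F that v
      by (auto simp: wts_def intro!: vec.subspace_scale[OF subspace_gws])
    then show ?thesis using v that by auto
  qed
  have inj: "inj_on v F"
  proof (rule inj_onI, rule ccontr)
    fix f g assume fg: "f \<in> F" "g \<in> F" "v f = v g" "f \<noteq> g"
    let ?c = "\<lambda>h. if h = f then 1 else if h = g then -1 else (0::complex)"
    have "(\<Sum>h\<in>F. ?c h *s v h) = (\<Sum>h\<in>{f,g}. ?c h *s v h)"
      using F fg by (intro sum.mono_neutral_right) auto
    also have "\<dots> = 0" using fg by simp
    finally show False using zero[of ?c f] fg by auto
  qed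
  have "vec.independent (v ` F)"
  proof (rule vec.independent_if_scalars_zero)
    show "finite (v ` F)" using F by blast
    fix c x assume c: "(\<Sum>x\<in>v ` F. c x *s x) = 0" and x: "x \<in> v ` F"
    have "(\<Sum>f\<in>F. c (v f) *s v f) = 0" using c by (simp add: sum.reindex[OF inj])
    then show "c x = 0" using zero[of "\<lambda>f. c (v f)"] x by auto
  qed
  then have "card (v ` F) \<le> vec.dim (UNIV :: (complex^'n) set)"
    by (intro vec.independent_card_le_dim) auto
  then show "card F \<le> CARD('n)" using card_image[OF inj] by (simp only: vec_dim_card)
qed

lemma wts_span: "vec.span (\<Union>f\<in>wts. gws f) = UNIV"
proof -
  have "UNIV \<subseteq> vec.span (\<Union>f. gws f \<inter> UNIV)" by (rule gws_span) auto
  also have "\<dots> \<subseteq> vec.span (\<Union>f\<in>wts. gws f)"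
  proof (rule vec.span_minimal)
    show "(\<Union>f. gws f \<inter> UNIV) \<subseteq> vec.span (\<Union>f\<in>wts. gws f)"
    proof
      fix v assume "v \<in> (\<Union>f. gws f \<inter> UNIV)"
      then obtain f where f: "v \<in> gws f" by blast
      let ?f = "\<lambda>x. if x \<in> S then f x else 0"
      have v: "v \<in> gws ?f" using f gws_cong[of f ?f] by auto
      show "v \<in> vec.span (\<Union>f\<in>wts. gws f)"
      proof (cases "v = 0")
        case True then show ?thesis by (simp add: vec.span_zero)
      next
        case False
        then have "?f \<in> wts" using v by (auto simp: wts_def)
        then show ?thesis using v by (intro vec.span_base) blast
      qed
    qed
  qed (rule vec.subspace_span)
  finally show ?thesis by blast
qed

end

section \<open>Independent families of subspaces\<close>

definition indep_fam :: "'i set \<Rightarrow> ('i \<Rightarrow> (complex^'n) set) \<Rightarrow> bool" where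
  "indep_fam I U \<longleftrightarrow> finite I \<and> (\<forall>i\<in>I. vec.subspace (U i)) \<and>
     (\<forall>v. (\<forall>i\<in>I. v i \<in> U i) \<longrightarrow> (\<Sum>i\<in>I. v i) = 0 \<longrightarrow> (\<forall>i\<in>I. v i = 0))"

definition is_proj :: "(complex^'n) set \<Rightarrow> (complex^'n \<Rightarrow> complex^'n) \<Rightarrow> bool" where
  "is_proj U p \<longleftrightarrow> lin p \<and> (\<forall>v. p v \<in> U) \<and> (\<forall>u\<in>U. p u = u)"

lemma is_proj_exists:
  assumes "vec.subspace U" shows "\<exists>p. is_proj U p"
proof -
  obtain B where B: "B \<subseteq> U" "vec.independent B" "U \<subseteq> vec.span B" "card B = vec.dim U" using vec.basis_exists[of U] by blast
  have sB: "vec.span B = U" using B assms by (metis vec.span_minimal subset_antisym)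
  obtain g where g: "lin g" "\<forall>x\<in>B. g x = id x" "range g = vec.span (id ` B)"
    using vec.linear_independent_extend_subspace[OF B(2), of id] by blast
  have "lin (\<lambda>x::complex^'n. x)" by (intro linI) auto
  then have "g u = u" if "u \<in> U" for u
    using vec.linear_eq_on[OF g(1), of "\<lambda>x. x" u B] g(2) that sB by auto
  moreover have "g v \<in> U" for v using g(3) sB by (auto simp: image_id)
  ultimately show ?thesis using g(1) unfolding is_proj_def by blast
qed

definition sumsp :: "'i set \<Rightarrow> ('i \<Rightarrow> (complex^'n) set) \<Rightarrow> (complex^'n) set" where
  "sumsp I U = {\<Sum>i\<in>I. v i |v. \<forall>i\<in>I. v i \<in> U i}"

lemma sumsp_incl:
  assumes "indep_fam I U" "i \<in> I" shows "U i \<subseteq> sumsp I U"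
proof
  fix u assume u: "u \<in> U i"
  let ?v = "\<lambda>j. if j = i then u else 0"
  have "u = (\<Sum>j\<in>I. ?v j)" using assms by (auto simp: indep_fam_def)
  moreover have "\<forall>j\<in>I. ?v j \<in> U j" using u assms by (auto simp: indep_fam_def vec.subspace_0)
  ultimately show "u \<in> sumsp I U" unfolding sumsp_def by blast
qed

lemma subspace_sumsp:
  assumes "indep_fam I U" shows "vec.subspace (sumsp I U)"
proof (rule vec.subspaceI)
  have s: "\<And>i. i \<in> I \<Longrightarrow> vec.subspace (U i)" using assms by (auto simp: indep_fam_def)
  show "0 \<in> sumsp I U" unfolding sumsp_def
    by (rule CollectI, rule exI[of _ "\<lambda>_. 0"]) (auto simp: vec.subspace_0 s)
  {fix x y assume "x \<in> sumsp I U" "y \<in> sumsp I U"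
    then obtain v w where vw: "x = (\<Sum>i\<in>I. v i)" "\<forall>i\<in>I. v i \<in> U i" "y = (\<Sum>i\<in>I. w i)" "\<forall>i\<in>I. w i \<in> U i"
      unfolding sumsp_def by blast
    show "x + y \<in> sumsp I U" unfolding sumsp_def
      by (rule CollectI, rule exI[of _ "\<lambda>i. v i + w i"]) (use vw in \<open>auto simp: sum.distrib vec.subspace_add s\<close>)}
  fix c x assume "x \<in> sumsp I U"
  then obtain v where v: "x = (\<Sum>i\<in>I. v i)" "\<forall>i\<in>I. v i \<in> U i" unfolding sumsp_def by blast
  show "c *s x \<in> sumsp I U" unfolding sumsp_def
    by (rule CollectI, rule exI[of _ "\<lambda>i. c *s v i"]) (use v in \<open>auto simp: vec.scale_sum_right vec.subspace_scale s\<close>)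
qed

lemma sumsp_UNIV:
  assumes "indep_fam I U" "vec.span (\<Union>i\<in>I. U i) = UNIV" shows "sumsp I U = UNIV"
proof -
  have "vec.span (\<Union>i\<in>I. U i) \<subseteq> sumsp I U"
    using sumsp_incl[OF assms(1)] by (intro vec.span_minimal subspace_sumsp assms) blast
  then show ?thesis using assms by blast
qed

lemma projections_exist:
  assumes ind: "indep_fam I U"
  shows "\<exists>P. (\<forall>i\<in>I. is_proj (U i) (P i) \<and> (\<forall>j\<in>I. j \<noteq> i \<longrightarrow> (\<forall>u\<in>U j. P i u = 0)))
     \<and> is_proj (sumsp I U) (\<lambda>v. \<Sum>i\<in>I. P i v)"
proof -
  obtain g where g: "is_proj (sumsp I U) g" using is_proj_exists[OF subspace_sumsp[OF ind]] by blast
  have lg: "lin g" using g by (auto simp: is_proj_def)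
  have s: "\<And>i. i \<in> I \<Longrightarrow> vec.subspace (U i)" using ind by (auto simp: indep_fam_def)
  have "\<forall>x. \<exists>v. g x = (\<Sum>i\<in>I. v i) \<and> (\<forall>i\<in>I. v i \<in> U i)"
    using g by (auto simp: is_proj_def sumsp_def)
  then obtain c where c: "\<And>x. g x = (\<Sum>i\<in>I. c x i)" "\<And>x i. i \<in> I \<Longrightarrow> c x i \<in> U i" by metis
  have uniq: "v i = w i" if "\<And>i. i \<in> I \<Longrightarrow> v i \<in> U i" "\<And>i. i \<in> I \<Longrightarrow> w i \<in> U i"
      "(\<Sum>i\<in>I. v i) = (\<Sum>i\<in>I. w i)" "i \<in> I" for v w i
  proof -
    have "\<forall>i\<in>I. v i - w i \<in> U i" using that by (auto simp: vec.subspace_diff s)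
    moreover have "(\<Sum>i\<in>I. v i - w i) = 0" using that by (simp add: sum_subtractf)
    ultimately have "v i - w i = 0"
      using ind[unfolded indep_fam_def, THEN conjunct2, THEN conjunct2, THEN spec, of "\<lambda>i. v i - w i"] that(4)
      by blast
    then show ?thesis by simp
  qed
  define P where "P i x = c x i" for i x
  have lin: "lin (P i)" if i: "i \<in> I" for i
  proof (rule linI)
    fix x y
    have "c (x + y) i = c x i + c y i"
      by (rule uniq[of "c (x + y)" "\<lambda>i. c x i + c y i" i])
         (auto simp: i c(2) vec.subspace_add s sum.distrib c(1)[symmetric] vec.linear_add[OF lg])
    then show "P i (x + y) = P i x + P i y" by (simp add: P_def)
  next
    fix a x
    have "c (a *s x) i = a *s c x i"
      by (rule uniq[of "c (a *s x)" "\<lambda>i. a *s c x i" i])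
         (auto simp: i c(2) vec.subspace_scale s vec.scale_sum_right[symmetric] c(1)[symmetric] vec.linear_scale[OF lg])
    then show "P i (a *s x) = a *s P i x" by (simp add: P_def)
  qed
  have val: "P i u = (if i = j then u else 0)" if ij: "i \<in> I" "j \<in> I" and u: "u \<in> U j" for i j u
  proof -
    have "g u = u" using g u sumsp_incl[OF ind ij(2)] by (auto simp: is_proj_def)
    moreover have "u = (\<Sum>i\<in>I. if i = j then u else 0)" using ind ij by (auto simp: indep_fam_def)
    ultimately have "c u i = (if i = j then u else 0)"
      using uniq[of "c u" "\<lambda>i. if i = j then u else 0" i] c(2)[of _ u] ij c(1)[of u] u s
      by (auto simp: vec.subspace_0)
    then show ?thesis by (simp add: P_def)
  qed
  have sg: "(\<lambda>v. \<Sum>i\<in>I. P i v) = g" by (auto simp: P_def c(1))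
  have "P i v \<in> U i" if "i \<in> I" for i v using c(2)[OF that] by (simp add: P_def)
  then show ?thesis using lin val g by (intro exI[of _ P]) (auto simp: sg is_proj_def)
qed

section \<open>Traces\<close>

text \<open>P has the basis vectors as columns and Q is its inverse, so this is invariance of the
  trace under conjugation.\<close>

lemma trace_basis:
  fixes A :: "complex^'n^'n"
  assumes B: "vec.independent B" "vec.span B = UNIV"
  shows "trace A = (\<Sum>b\<in>B. vec.representation B (A *v b) b)"
proof -
  let ?r = "vec.representation B"
  have fin: "finite B" using B(1) by (rule vec.finiteI_independent)
  have "card B = CARD('n)" using vec.dim_eq_card_independent[OF B(1)] vec.dim_span[of B] unfolding B(2) vec_dim_card by simp
  then obtain f where f: "bij_betw f (UNIV :: 'n set) B"
    using finite_same_card_bij[of "UNIV :: 'n set" B] fin by auto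
  define P :: "complex^'n^'n" where "P = (\<chi> i j. f j $ i)"
  define Q :: "complex^'n^'n" where "Q = (\<chi> j i. ?r (axis i 1) (f j))"
  have PQ: "P ** Q = mat 1"
  proof -
    have "(\<Sum>j\<in>UNIV. f j $ i * ?r (axis k 1) (f j)) = (if i = k then 1 else 0)" for i k
    proof -
      have "(\<Sum>j\<in>UNIV. f j $ i * ?r (axis k 1) (f j)) = (\<Sum>b\<in>B. b $ i * ?r (axis k 1) b)"
        using sum.reindex_bij_betw[OF f, of "\<lambda>b. b $ i * ?r (axis k 1) b"] .
      also have "\<dots> = (\<Sum>b\<in>B. ?r (axis k 1) b *s b) $ i" by (simp add: mult.commute)
      also have "(\<Sum>b\<in>B. ?r (axis k 1) b *s b) = axis k 1"
        using vec.sum_representation_eq[OF B(1) _ fin, of "axis k 1"] B(2) by auto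
      finally show ?thesis by (simp add: axis_def)
    qed
    then show ?thesis by (simp add: P_def Q_def matrix_matrix_mult_def mat_def vec_eq_iff)
  qed
  have "trace A = trace (A ** (P ** Q))" by (simp add: PQ)
  also have "\<dots> = trace (Q ** (A ** P))" using trace_mul_sym[of "A ** P" Q] by (simp add: matrix_mul_assoc)
  also have "\<dots> = (\<Sum>j\<in>UNIV. ?r (A *v f j) (f j))"
    unfolding trace_def
  proof (rule sum.cong[OF HOL.refl])
    fix j
    have "(Q ** (A ** P)) $ j $ j = (\<Sum>i\<in>UNIV. ?r (axis i 1) (f j) * (A *v f j) $ i)"
      by (simp add: matrix_matrix_mult_def Q_def P_def matrix_vector_mult_def)
    also have "\<dots> = ?r (\<Sum>i\<in>UNIV. (A *v f j) $ i *s axis i 1) (f j)"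
      using B by (simp add: vec.representation_sum vec.representation_scale mult.commute)
    also have "(\<Sum>i\<in>UNIV. (A *v f j) $ i *s axis i 1) = A *v f j"
      by (rule basis_expansion)
    finally show "(Q ** (A ** P)) $ j $ j = ?r (A *v f j) (f j)" .
  qed
  also have "\<dots> = (\<Sum>b\<in>B. ?r (A *v b) b)" using sum.reindex_bij_betw[OF f, of "\<lambda>b. ?r (A *v b) b"] .
  finally show ?thesis .
qed

definition ftr :: "(complex^'n \<Rightarrow> complex^'n) \<Rightarrow> complex" where
  "ftr T = trace (matrix T)"

lemma ftr_basis:
  assumes "lin T" "vec.independent B" "vec.span B = UNIV"
  shows "ftr T = (\<Sum>b\<in>B. vec.representation B (T b) b)"
  using trace_basis[OF assms(2,3), of "matrix T"] by (simp add: ftr_def matrix_works[OF assms(1)])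

lemma ftr_add: "ftr (\<lambda>v. S v + T v) = ftr S + ftr T"
  by (simp add: ftr_def trace_def matrix_def sum.distrib)

lemma ftr_diff: "ftr (\<lambda>v. S v - T v) = ftr S - ftr T"
  by (simp add: ftr_def trace_def matrix_def sum_subtractf)

lemma ftr_scale: "ftr (\<lambda>v. c *s T v) = c * ftr T"
  by (simp add: ftr_def trace_def matrix_def sum_distrib_left)

lemma ftr_zero: "ftr (\<lambda>v. 0) = 0"
  by (simp add: ftr_def trace_def matrix_def)

lemma ftr_sum: "ftr (\<lambda>v. \<Sum>i\<in>I. T i v) = (\<Sum>i\<in>I. ftr (T i))"
proof (cases "finite I")
  case True
  then show ?thesis by (induction I rule: finite_induct) (auto simp: ftr_zero ftr_add)
qed (simp add: ftr_zero)

lemma ftr_commute: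
  assumes "lin S" "lin T" shows "ftr (\<lambda>v. S (T v)) = ftr (\<lambda>v. T (S v))"
  using matrix_compose_gen[OF assms(1,2)] matrix_compose_gen[OF assms(2,1)]
    trace_mul_sym[of "matrix S" "matrix T"]
  by (simp add: ftr_def comp_def)

text \<open>In a basis of the whole space that extends one of U, the diagonal entries of p are 1 on
  the part from U and 0 elsewhere, since p maps everything into U.\<close>

lemma ftr_proj:
  assumes "is_proj U p" "vec.subspace U" shows "ftr p = of_nat (vec.dim U)"
proof -
  obtain C where C: "C \<subseteq> U" "vec.independent C" "U \<subseteq> vec.span C" "card C = vec.dim U"
    using vec.basis_exists[of U] by blast
  obtain B where B: "C \<subseteq> B" "B \<subseteq> UNIV" "vec.independent B" "UNIV \<subseteq> vec.span B"
    by (rule vec.maximal_independent_subset_extend[OF subset_UNIV C(2)])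
  have fin: "finite B" using B(3) by (rule vec.finiteI_independent)
  have sB: "vec.span B = UNIV" using B by blast
  have 1: "vec.representation B (p b) b = (if b \<in> C then 1 else 0)" if b: "b \<in> B" for b
  proof (cases "b \<in> C")
    case True
    then have "p b = b" using C assms by (auto simp: is_proj_def)
    then show ?thesis using True vec.representation_basis[OF B(3) b] by simp
  next
    case False
    have "p b \<in> vec.span C" using assms C by (auto simp: is_proj_def)
    then have "vec.representation B (p b) b = vec.representation C (p b) b"
      using vec.representation_extend[OF B(3) _ B(1)] by metis
    also have "\<dots> = 0" using False vec.representation_ne_zero by metis
    finally show ?thesis using False by simp
  qed
  have "ftr p = (\<Sum>b\<in>B. if b \<in> C then 1 else 0)"
    using ftr_basis[OF _ B(3) sB, of p] 1 assms by (auto simp: is_proj_def cong: sum.cong)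
  also have "\<dots> = of_nat (card C)"
    using fin B(1) by (simp add: sum.If_cases Int_absorb1)
  finally show ?thesis using C by simp
qed

text \<open>A basis adapted to the chain of kernels of D^j gives zero diagonal, since D moves each
  kernel into the previous one.\<close>

lemma ftr_nilpotent:
  fixes D :: "complex^'n \<Rightarrow> complex^'n"
  assumes D: "lin D" and nil: "\<And>v. evnil D v" shows "ftr D = 0"
proof -
  have "\<exists>B. vec.independent B \<and> vec.span B = {v. (D ^^ j) v = 0} \<and>
          (\<forall>b\<in>B. vec.representation B (D b) b = 0)" for j
  proof (induction j)
    case 0
    show ?case by (rule exI[of _ "{}"]) (auto simp: vec.independent_empty)
  next
    case (Suc j)
    then obtain C where C: "vec.independent C" "vec.span C = {v. (D ^^ j) v = 0}"
        "\<And>b. b \<in> C \<Longrightarrow> vec.representation C (D b) b = 0" by blast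
    let ?K = "{v. (D ^^ Suc j) v = 0}"
    have sub: "vec.subspace ?K" by (rule vec.linear_subspace_kernel[OF lin_funpow[OF D]])
    have CK: "C \<subseteq> ?K"
    proof
      fix b assume "b \<in> C"
      then have "(D ^^ j) b = 0" using C(2) vec.span_base[of b C] by blast
      then show "b \<in> ?K" using funpow_zero_mono[OF D, of j b "Suc j"] by simp
    qed
    obtain B where B: "C \<subseteq> B" "B \<subseteq> ?K" "vec.independent B" "?K \<subseteq> vec.span B"
      by (rule vec.maximal_independent_subset_extend[OF CK C(1)])
    have "vec.representation B (D b) b = 0" if b: "b \<in> B" for b
    proof -
      have "D b \<in> vec.span C" using B(2) b C(2) by (auto simp: funpow_swap1)
      then have "vec.representation B (D b) b = vec.representation C (D b) b"
        using vec.representation_extend[OF B(3) _ B(1)] by metis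
      also have "\<dots> = 0" using C(3) vec.representation_ne_zero by metis
      finally show ?thesis .
    qed
    moreover have "vec.span B = ?K" using B sub by (metis vec.span_minimal subset_antisym)
    ultimately show ?case using B(3) by blast
  qed
  from this[of "CARD('n)"] obtain B where B: "vec.independent B" "vec.span B = {v. (D ^^ CARD('n)) v = 0}"
    "\<And>b. b \<in> B \<Longrightarrow> vec.representation B (D b) b = 0" by blast
  have "vec.span B = UNIV" using B(2) funpow_bound[OF D nil] by auto
  then show ?thesis using ftr_basis[OF D B(1)] B(3) by (simp add: ftr_basis[OF D B(1)])
qed

lemma lin_comp: "lin S \<Longrightarrow> lin T \<Longrightarrow> lin (\<lambda>v. S (T v))"
  by (intro linI) (auto simp: vec.linear_add vec.linear_scale)

lemma ftr_gen_eigenspace: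
  assumes p: "is_proj U p" and U: "vec.subspace U" and T: "lin T" "T ` U \<subseteq> U"
    and nil: "\<And>u. u \<in> U \<Longrightarrow> evnil (shift T c) u"
  shows "ftr (\<lambda>v. T (p v)) = c * of_nat (vec.dim U)"
proof -
  let ?D = "shift T c" let ?E = "\<lambda>v. ?D (p v)"
  have lp: "lin p" and pU: "\<And>v. p v \<in> U" and pid: "\<And>u. u \<in> U \<Longrightarrow> p u = u" using p by (auto simp: is_proj_def)
  have lE: "lin ?E" using lin_comp[OF lin_shift[OF T(1)] lp] .
  have DU: "?D ` U \<subseteq> U" by (rule stable_shift[OF U T(2)])
  have E: "(?E ^^ k) u = (?D ^^ k) u" if "u \<in> U" for k u
    by (induction k) (auto simp: pid stable_funpow[OF DU that])
  have "evnil ?E v" for v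
  proof -
    obtain k where k: "(?D ^^ k) (p v) = 0" using nil[OF pU[of v]] by (auto simp: evnil_def)
    have "(?E ^^ Suc k) v = (?E ^^ k) (?D (p v))" by (simp only: funpow_Suc_right comp_apply)
    also have "\<dots> = (?D ^^ k) (?D (p v))" using E DU pU by blast
    also have "\<dots> = ?D ((?D ^^ k) (p v))" by (simp add: funpow_swap1)
    also have "\<dots> = 0" using k vec.linear_0[OF lin_shift[OF T(1)]] by simp
    finally show ?thesis unfolding evnil_def by blast
  qed
  then have "ftr ?E = 0" by (intro ftr_nilpotent lE)
  moreover have "(\<lambda>v. T (p v)) = (\<lambda>v. ?E v + c *s p v)" by (auto simp: shift_def)
  ultimately show ?thesis by (simp add: ftr_add ftr_scale ftr_proj[OF p U])
qed

lemma ftr_commutator: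
  assumes p: "is_proj U p" and S: "lin S" "S ` U \<subseteq> U" and T: "lin T" "T ` U \<subseteq> U"
  shows "ftr (\<lambda>v. S (T (p v)) - T (S (p v))) = 0"
proof -
  have lp: "lin p" and pU: "\<And>v. p v \<in> U" and pid: "\<And>u. u \<in> U \<Longrightarrow> p u = u" using p by (auto simp: is_proj_def)
  have "ftr (\<lambda>v. S (T (p v))) = ftr (\<lambda>v. S (p (T (p v))))" using pid pU T by (simp add: image_subset_iff)
  also have "\<dots> = ftr (\<lambda>v. T (p (S (p v))))"
    by (rule ftr_commute[OF lin_comp[OF S(1) lp] lin_comp[OF T(1) lp]])
  also have "\<dots> = ftr (\<lambda>v. T (S (p v)))" using pid pU S by (simp add: image_subset_iff)
  finally show ?thesis by (simp add: ftr_diff)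
qed

lemma indep_fam_subset:
  assumes "indep_fam I U" "J \<subseteq> I" "\<And>i. i \<in> J \<Longrightarrow> V i \<subseteq> U i \<and> vec.subspace (V i)"
  shows "indep_fam J V"
  unfolding indep_fam_def
proof (intro conjI allI impI)
  show "finite J" using assms finite_subset by (auto simp: indep_fam_def)
  show "\<forall>i\<in>J. vec.subspace (V i)" using assms by auto
  fix v assume v: "\<forall>i\<in>J. v i \<in> V i" "(\<Sum>i\<in>J. v i) = 0"
  let ?w = "\<lambda>i. if i \<in> J then v i else 0"
  have "(\<Sum>i\<in>I. ?w i) = (\<Sum>i\<in>J. v i)"
    using assms by (intro sum.mono_neutral_cong_right) (auto simp: indep_fam_def)
  moreover have "\<forall>i\<in>I. ?w i \<in> U i"
  proof
    fix i assume "i \<in> I"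
    then show "?w i \<in> U i" using v(1) assms(1) assms(3)[of i] by (auto simp: indep_fam_def vec.subspace_0)
  qed
  ultimately have w0: "\<forall>i\<in>I. ?w i = 0"
    using assms(1)[unfolded indep_fam_def, THEN conjunct2, THEN conjunct2, THEN spec, of ?w] v(2) by argo
  show "\<forall>i\<in>J. v i = 0"
  proof
    fix i assume "i \<in> J"
    then show "v i = 0" using w0[THEN bspec, of i] assms(2) by auto
  qed
qed

lemma sumsp_stable:
  assumes "lin T" and ind: "indep_fam I U" and st: "\<And>i u. i \<in> I \<Longrightarrow> u \<in> U i \<Longrightarrow> T u \<in> sumsp I U"
  shows "T ` sumsp I U \<subseteq> sumsp I U"
proof
  fix x assume "x \<in> T ` sumsp I U"
  then obtain v where v: "x = T (\<Sum>i\<in>I. v i)" "\<forall>i\<in>I. v i \<in> U i" by (auto simp: sumsp_def)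
  then have "x = (\<Sum>i\<in>I. T (v i))" by (simp add: vec.linear_sum[OF assms(1)])
  then show "x \<in> sumsp I U" using v st by (auto intro!: vec.subspace_sum[OF subspace_sumsp[OF ind]])
qed

text \<open>The trace device behind weight strings: R = [S, T] has trace 0 on a sum that is stable
  under S and T, and the trace is also the sum of eigenvalues times dimensions.\<close>

lemma commutator_weights:
  assumes ind: "indep_fam I U"
    and S: "lin S" "S ` sumsp I U \<subseteq> sumsp I U" and T: "lin T" "T ` sumsp I U \<subseteq> sumsp I U"
    and R: "lin R" "\<And>v. R v = S (T v) - T (S v)"
    and RU: "\<And>i. i \<in> I \<Longrightarrow> R ` U i \<subseteq> U i" "\<And>i u. i \<in> I \<Longrightarrow> u \<in> U i \<Longrightarrow> evnil (shift R (c i)) u"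
  shows "(\<Sum>i\<in>I. c i * of_nat (vec.dim (U i))) = 0"
proof -
  obtain P where P: "\<forall>i\<in>I. is_proj (U i) (P i)" "is_proj (sumsp I U) (\<lambda>v. \<Sum>i\<in>I. P i v)"
    using projections_exist[OF ind] by blast
  have "(\<Sum>i\<in>I. c i * of_nat (vec.dim (U i))) = (\<Sum>i\<in>I. ftr (\<lambda>v. R (P i v)))"
  proof (rule sum.cong[OF HOL.refl])
    fix i assume i: "i \<in> I"
    show "c i * of_nat (vec.dim (U i)) = ftr (\<lambda>v. R (P i v))"
      using ftr_gen_eigenspace[of "U i" "P i" R "c i"] P(1) ind R(1) RU i by (auto simp: indep_fam_def)
  qed
  also have "\<dots> = ftr (\<lambda>v. R (\<Sum>i\<in>I. P i v))"
    by (simp add: ftr_sum[symmetric] vec.linear_sum[OF R(1)])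
  also have "\<dots> = 0" unfolding R(2) by (rule ftr_commutator[OF P(2) S T])
  finally show ?thesis .
qed

lemma ftr_off_diagonal:
  assumes "lin p" "lin T" "\<And>v. p (p v) = p v" "\<And>v. p (T (p v)) = 0"
  shows "ftr (\<lambda>v. T (p v)) = 0"
proof -
  have "ftr (\<lambda>v. T (p v)) = ftr (\<lambda>v. T (p (p v)))" by (simp add: assms)
  also have "\<dots> = ftr (\<lambda>v. p (T (p v)))" by (rule ftr_commute[OF lin_comp[OF assms(2,1)] assms(1)])
  finally show ?thesis by (simp add: assms ftr_zero)
qed

lemma funpow_commute_comp:
  assumes "\<And>v. D (E v) = E (D v)"
  shows "((\<lambda>v. E (D v)) ^^ k) u = (E ^^ k) ((D ^^ k) u)"
proof (induction k)
  case (Suc k)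
  have "D ((E ^^ k) w) = (E ^^ k) (D w)" for w by (induction k) (auto simp: assms)
  then show ?case using Suc by simp
qed simp

lemma evnil_commute_comp:
  fixes D E :: "complex^'n \<Rightarrow> complex^'n"
  assumes "\<And>v. D (E v) = E (D v)" "lin E" "evnil D u"
  shows "evnil (\<lambda>v. E (D v)) u"
proof -
  obtain k where "(D ^^ k) u = 0" using assms(3) by (auto simp: evnil_def)
  then have "((\<lambda>v. E (D v)) ^^ k) u = 0"
    using funpow_commute_comp[of D E k u] assms(1) vec.linear_0[OF lin_funpow[OF assms(2)], of k] by simp
  then show ?thesis unfolding evnil_def by blast
qed

text \<open>In a nonzero stable subspace of least dimension, an eigenspace of one member is again
  stable by commutativity, so every member acts there as a scalar.\<close>

lemma common_eigenvector:
  fixes T :: "'h \<Rightarrow> complex^'n \<Rightarrow> complex^'n"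
  assumes U: "vec.subspace U" "U \<noteq> {0}" and T: "\<And>h. h \<in> S \<Longrightarrow> lin (T h)"
    and "\<And>h. h \<in> S \<Longrightarrow> T h ` U \<subseteq> U"
    and com: "\<And>h h' v. \<lbrakk>h \<in> S; h' \<in> S; v \<in> U\<rbrakk> \<Longrightarrow> T h (T h' v) = T h' (T h v)"
  shows "\<exists>v\<in>U. v \<noteq> 0 \<and> (\<forall>h\<in>S. \<exists>a. T h v = a *s v)"
proof -
  let ?Q = "\<lambda>W. vec.subspace W \<and> W \<noteq> {0} \<and> W \<subseteq> U \<and> (\<forall>h\<in>S. T h ` W \<subseteq> W)"
  have "?Q U" using assms by auto
  then obtain W where W: "?Q W" and min: "\<And>W'. ?Q W' \<Longrightarrow> vec.dim W \<le> vec.dim W'"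
    using ex_has_least_nat[of ?Q U vec.dim] by blast
  obtain v where v: "v \<in> W" "v \<noteq> 0" using W vec.subspace_0[of W] by blast
  have "\<exists>a. T h v = a *s v" if h: "h \<in> S" for h
  proof -
    obtain a u where u: "u \<in> W" "u \<noteq> 0" "T h u = a *s u"
      using eigenvector_exists[OF T[OF h], of W] W h by blast
    let ?W = "{w \<in> W. T h w = a *s w}"
    have sub: "vec.subspace ?W" using W
      by (auto intro!: vec.subspaceI simp: vec.subspace_0 vec.subspace_add vec.subspace_scale
          vec.linear_0[OF T[OF h]] vec.linear_add[OF T[OF h]] vec.linear_scale[OF T[OF h]] vec.scale_right_distrib mult.commute)
    have "T h' ` ?W \<subseteq> ?W" if h': "h' \<in> S" for h'
    proof
      fix x assume "x \<in> T h' ` ?W"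
      then obtain w where w: "w \<in> W" "T h w = a *s w" "x = T h' w" by blast
      have "T h x = a *s x" using com[OF h h', of w] w W by (auto simp: vec.linear_scale[OF T[OF h']])
      then show "x \<in> ?W" using w W h' by blast
    qed
    then have "?Q ?W" using sub W u by auto
    then have "vec.dim W \<le> vec.dim ?W" by (rule min)
    then have "?W = W" using vec.subspace_dim_equal[of ?W W] sub W by auto
    then show ?thesis using v by blast
  qed
  then show ?thesis using v W by blast
qed

section \<open>Simple Lie algebras\<close>

text \<open>The transpositions (12) and (23) of the arguments are conjugate in the symmetric group,
  so they can act by 1 and by -1 only on 0.\<close>

lemma sym_antisym_zero:
  fixes g :: "'a \<Rightarrow> 'a \<Rightarrow> 'a \<Rightarrow> complex^'n"
  assumes s: "\<And>x y z. g x y z = g y x z" and a: "\<And>x y z. g x y z = - g x z y"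
  shows "g x y z = 0"
proof -
  have "g x y z = - g x y z" by (metis s a minus_minus)
  then have "2 *s g x y z = 0" by (metis add.right_inverse vec.scale_one vec.scale_left_distrib one_add_one)
  then show ?thesis by simp
qed

lemma eq_diff_if_sums_zero: "a + (b + c) + d = 0 \<Longrightarrow> a + b + e = 0 \<Longrightarrow> d = e - c" for a b c d e :: "'a::ab_group_add"
proof -
  assume "a + (b + c) + d = 0" "a + b + e = 0"
  then have "d = - (a + (b + c))" "e = - (a + b)" by (metis minus_unique)+
  then show ?thesis by simp
qed

lemma diff_eq_if_sums_zero: "a - b + c = 0 \<Longrightarrow> a' - b' + c = 0 \<Longrightarrow> a - a' = b - b'" for a b c :: "'a::ab_group_add"
proof -
  assume "a - b + c = 0" "a' - b' + c = 0"
  then have "a = b - c" "a' = b' - c" by (simp_all add: algebra_simps)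
  then show ?thesis by simp
qed

locale simple_lie =
  fixes br :: "complex^'n \<Rightarrow> complex^'n \<Rightarrow> complex^'n"
  assumes simple: "simple_lie_algebra br"
begin

lemma lie: "lie_algebra br"
  using simple by (simp add: simple_lie_algebra_def)

lemma ideal_trivial: "lie_ideal br I \<Longrightarrow> I = {0} \<or> I = UNIV"
  using simple by (simp add: simple_lie_algebra_def)

lemma nonabelian: "\<exists>x y. br x y \<noteq> 0"
  using simple by (simp add: simple_lie_algebra_def)

lemma br_self [simp]: "br x x = 0"
  using lie by (simp add: lie_algebra_def)

lemma lin_br1: "lin (\<lambda>x. br x y)"
  using lie by (intro linI) (auto simp: lie_algebra_def)

lemmas br_add1 = vec.linear_add[OF lin_br1] and br_scale1 = vec.linear_scale[OF lin_br1]
  and br_01 [simp] = vec.linear_0[OF lin_br1] and br_neg1 = vec.linear_neg[OF lin_br1]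
  and br_sum1 = vec.linear_sum[OF lin_br1] and br_diff1 = vec.linear_diff[OF lin_br1]

lemma jacobi0: "br x (br y z) + br y (br z x) + br z (br x y) = 0"
  using lie by (simp add: lie_algebra_def)

text \<open>The definition of a Lie algebra in use only demands linearity in the first argument, so
  antisymmetry is not a formal consequence of \<open>br x x = 0\<close>; there are counterexamples among
  nilpotent algebras. For a simple algebra one first shows that the double bracket is trilinear.\<close>

lemma br_02 [simp]: "br x 0 = 0"
  using jacobi0[of x 0 0] by simp

text \<open>Linearity is given on the left only. Moving x along y itself is computable, because br y
  y = 0 makes br (x + s y) y independent of s, and the Jacobi identity transfers this to the double
  bracket.\<close>

lemma triple_along: "br y (br u (x + s *s y)) = br y (br u x) + s *s br y (br u y)"
proof -
  have e: "br (x' + s *s y) y = br x' y" for x' s by (simp add: br_add1 br_scale1)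
  have 1: "br y (br u (x' + s *s y)) = br y (br u x') - s *s br y (br y u)" for x' s
  proof -
    have "br u (br x' y) + (br x' (br y u) + s *s br y (br y u)) + br y (br u (x' + s *s y)) = 0"
      using jacobi0[of u "x' + s *s y" y] unfolding e by (simp add: br_add1 br_scale1)
    moreover have "br u (br x' y) + br x' (br y u) + br y (br u x') = 0" by (rule jacobi0)
    ultimately show ?thesis by (rule eq_diff_if_sums_zero)
  qed
  have "br y (br u y) = - br y (br y u)" using 1[of 0 1] by simp
  then show ?thesis using 1[of x s] by simp
qed

text \<open>The additivity defect g is symmetric in its first two arguments; additivity along the
  outer factor (\<open>triple_along\<close>), polarized at y + z, makes it antisymmetric in the last
  two.\<close>

lemma triple_add3: "br y (br u (x + z)) = br y (br u x) + br y (br u z)"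
proof -
  define g where "g x z y = br y (br u (x + z)) - br y (br u x) - br y (br u z)" for x z y
  have tri: "br y (br u (x + y)) = br y (br u x) + br y (br u y)" for x y using triple_along[of y u x 1] by simp
  have "g x z y = - g x y z" for x y z
  proof -
    have "br (y + z) (br u (x + (y + z))) = br (y + z) (br u x) + br (y + z) (br u (y + z))" by (rule tri)
    moreover have "br y (br u (x + (y + z))) = br y (br u (x + z)) + br y (br u y)"
      using tri[of y "x + z"] by (simp add: add.assoc add.commute[of z y])
    moreover have "br z (br u (x + (y + z))) = br z (br u (x + y)) + br z (br u z)"
      using tri[of z "x + y"] by (simp add: add.assoc)
    moreover have "br y (br u (y + z)) = br y (br u z) + br y (br u y)"
      using tri[of y z] by (simp add: add.commute)
    moreover have "br z (br u (y + z)) = br z (br u y) + br z (br u z)" using tri[of z y] by simp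
    ultimately show ?thesis unfolding g_def br_add1 by (simp add: algebra_simps)
  qed
  moreover have "g x z y = g z x y" for x z y by (simp add: g_def add.commute)
  ultimately have "g x z y = 0" using sym_antisym_zero[of g] by blast
  then show ?thesis by (simp add: g_def algebra_simps)
qed

lemma triple_add2: "br y (br (u + v) x) = br y (br u x) + br y (br v x)"
proof -
  have *: "br y (br u x) = - br u (br x y) - br x (br y u)" for u
    using jacobi0[of y u x] by (simp add: add_eq_0_iff algebra_simps)
  show ?thesis unfolding *[of u] *[of v] *[of "u + v"] by (simp add: triple_add3 br_add1)
qed

lemma triple_alt: "br u (br x y) = - br u (br y x)"
proof -
  have "br u (br (x + y) (x + y)) = br u (br x y) + br u (br y x)"
    unfolding triple_add2 triple_add3 by (simp add: add.commute)
  then have "br u (br x y) + br u (br y x) = 0" by simp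
  then show ?thesis by (simp add: add_eq_0_iff)
qed

lemma triple_scale3: "br y (br u (s *s z)) = s *s br y (br u z)"
proof -
  define k where "k y u z = br y (br u (s *s z)) - s *s br y (br u z)" for y u z
  have *: "br y (br u (s *s y)) = s *s br y (br u y)" for y u using triple_along[of y u 0 s] by simp
  have anti13: "k y u z = - k z u y" for y u z
  proof -
    have "br (y + z) (br u (s *s (y + z))) = s *s br (y + z) (br u (y + z))" by (rule *)
    then show ?thesis unfolding k_def
      by (simp add: br_add1 triple_add3 vec.scale_right_distrib * algebra_simps)
  qed
  have sym12: "k y u z = k u y z" for y u z
  proof -
    have "br y (br u (s *s z)) + br u (br (s *s z) y) + br (s *s z) (br y u) = 0" by (rule jacobi0)
    then have 1: "br y (br u (s *s z)) - br u (br y (s *s z)) + s *s br z (br y u) = 0"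
      using triple_alt[of u "s *s z" y] by (simp add: br_scale1)
    have "br y (br u z) - br u (br y z) + br z (br y u) = 0"
      using jacobi0[of y u z] triple_alt[of u z y] by simp
    then have "s *s br y (br u z) - s *s br u (br y z) + s *s br z (br y u) = 0"
      by (metis vec.scale_right_distrib vec.scale_right_diff_distrib vec.scale_zero_right)
    with 1 show ?thesis unfolding k_def by (rule diff_eq_if_sums_zero)
  qed
  have "k y u z = 0"
  proof (rule sym_antisym_zero[of "\<lambda>a b c. k b a c"])
  fix a b c
    show "k b a c = k a b c" by (rule sym12)
    show "k b a c = - k c a b" by (rule anti13)
  qed
  then show ?thesis by (simp add: k_def)
qed

lemma br_anti: "br y z = - br z y"
proof -
  \<comment> \<open>Double brackets are linear in the innermost argument, so the vectors that all of
    them kill form an ideal; it contains every br y z + br z y.\<close>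
  let ?P = "{v. \<forall>x u. br u (br x v) = 0}"
  have "lie_ideal br ?P"
    unfolding lie_ideal_def
    by (intro conjI vec.subspaceI) (auto simp: triple_add3 triple_scale3)
  moreover have "?P \<noteq> UNIV"
  proof
    \<comment> \<open>If all double brackets vanished, the line spanned by br x0 y0 would be an
      ideal, hence everything; then y0 = br x' y0 gives br x0 y0 = 0.\<close>
    assume "?P = UNIV"
    then have z: "br u (br x v) = 0" for u x v by blast
    obtain x0 y0 where w: "br x0 y0 \<noteq> 0" using nonabelian by blast
    let ?I = "vec.span {br x0 y0}"
    have I: "\<exists>x. v = br x y0" if "v \<in> ?I" for v
      using that by (auto simp: vec.span_singleton br_scale1[symmetric])
    have "lie_ideal br ?I"
      unfolding lie_ideal_def
    proof (intro conjI allI impI vec.subspace_span)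
      fix x y assume "y \<in> ?I"
      then obtain x' where "y = br x' y0" using I by blast
      then have "br x y = 0" using z by simp
      then show "br x y \<in> ?I" by (simp add: vec.span_zero)
    qed
    moreover have "?I \<noteq> {0}" using w vec.span_base[of "br x0 y0" "{br x0 y0}"] by auto
    ultimately have "?I = UNIV" using ideal_trivial by blast
    then obtain x' where "y0 = br x' y0" using I by blast
    then have "br x0 y0 = 0" using z by metis
    then show False using w by simp
  qed
  ultimately have P: "?P = {0}" using ideal_trivial by blast
  have "br u (br x (br y z + br z y)) = 0" for u x
  proof -
    have "br u (br x (br y z)) = br u (br (- x) (br z y))"
      by (subst triple_alt[of x y z]) (simp add: br_neg1)
    also have "\<dots> = - br u (br x (br z y))"
      using triple_add2[of u x "- x" "br z y"] by (simp add: add_eq_0_iff)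
    finally show ?thesis by (simp add: triple_add3)
  qed
  then have "br y z + br z y \<in> ?P" by blast
  then have "br y z + br z y = 0" unfolding P by simp
  then show ?thesis by (simp add: add_eq_0_iff)
qed


lemma lin_br2: "lin (br x)"
proof (rule linI)
  fix y z :: "complex^'n" and c
  show "br x (y + z) = br x y + br x z" using br_anti[of x] by (simp add: br_add1)
  show "br x (c *s y) = c *s br x y" using br_anti[of x] by (simp add: br_scale1)
qed

lemmas br_add2 = vec.linear_add[OF lin_br2] and br_scale2 = vec.linear_scale[OF lin_br2]
  and br_neg2 = vec.linear_neg[OF lin_br2]
  and br_sum2 = vec.linear_sum[OF lin_br2] and br_diff2 = vec.linear_diff[OF lin_br2]

lemma jacobi: "br x (br y z) = br (br x y) z + br y (br x z)"
  using jacobi0[of x y z] br_anti[of z x] br_anti[of "br x y" z]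
  by (simp add: br_neg2 algebra_simps add_eq_0_iff)

lemma leibniz_shift: "leibniz br (shift (br h) a) (shift (br h) b) (shift (br h) (a + b))"
  by unfold_locales
     (auto simp: br_add1 br_add2 br_scale1 br_scale2 shift_def jacobi[of h] br_diff1 br_diff2
       vec.scale_left_distrib vec.scale_right_distrib vec.scale_right_diff_distrib mult.commute algebra_simps)

lemma evnil_br:
  "evnil (shift (br h) a) y \<Longrightarrow> evnil (shift (br h) b) z \<Longrightarrow> evnil (shift (br h) (a + b)) (br y z)"
  by (rule leibniz.evnil[OF leibniz_shift])

section \<open>The Killing form \<open>\<kappa>\<close>, the derived algebra and the centre\<close>

definition \<kappa> :: "complex^'n \<Rightarrow> complex^'n \<Rightarrow> complex" where
  "\<kappa> x y = ftr (\<lambda>v. br x (br y v))"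

lemma lin_br_br: "lin (\<lambda>v. br x (br y v))"
  by (rule lin_comp[OF lin_br2 lin_br2])

lemma \<kappa>_commute: "\<kappa> x y = \<kappa> y x"
  unfolding \<kappa>_def by (rule ftr_commute[OF lin_br2 lin_br2])

lemma \<kappa>_add1: "\<kappa> (x + y) z = \<kappa> x z + \<kappa> y z"
  by (simp add: \<kappa>_def br_add1 ftr_add)

lemma \<kappa>_scale1: "\<kappa> (c *s x) z = c * \<kappa> x z"
  by (simp add: \<kappa>_def br_scale1 ftr_scale)

lemma \<kappa>_add2: "\<kappa> z (x + y) = \<kappa> z x + \<kappa> z y"
  using \<kappa>_add1[of x y z] by (simp add: \<kappa>_commute)

lemma \<kappa>_scale2: "\<kappa> z (c *s x) = c * \<kappa> z x"
  using \<kappa>_scale1[of c x z] by (simp add: \<kappa>_commute)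

lemma \<kappa>_0 [simp]: "\<kappa> 0 y = 0" "\<kappa> y 0 = 0"
  using \<kappa>_scale1[of 0 0 y] \<kappa>_scale2[of y 0 0] by simp_all

lemma \<kappa>_neg1: "\<kappa> (- x) y = - \<kappa> x y"
  using \<kappa>_scale1[of "-1" x y] by simp

lemma \<kappa>_sum2: "\<kappa> x (\<Sum>i\<in>I. y i) = (\<Sum>i\<in>I. \<kappa> x (y i))"
proof (cases "finite I")
  case True then show ?thesis by (induction I rule: finite_induct) (auto simp: \<kappa>_add2)
qed simp

lemma \<kappa>_invariant: "\<kappa> (br x y) z = \<kappa> x (br y z)"
proof -
  have j: "br (br x y) v = br x (br y v) - br y (br x v)" for x y v using jacobi[of x y v] by simp
  have "\<kappa> (br x y) z = ftr (\<lambda>v. br x (br y (br z v))) - ftr (\<lambda>v. br y (br x (br z v)))"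
    by (simp add: \<kappa>_def j ftr_diff)
  also have "ftr (\<lambda>v. br y (br x (br z v))) = ftr (\<lambda>v. br x (br z (br y v)))"
    by (rule ftr_commute[OF lin_br2 lin_br_br])
  also have "ftr (\<lambda>v. br x (br y (br z v))) - ftr (\<lambda>v. br x (br z (br y v))) = \<kappa> x (br y z)"
    by (simp add: \<kappa>_def j br_diff2 ftr_diff)
  finally show ?thesis .
qed

lemma radical_trivial: "(\<forall>x y. \<kappa> x y = 0) \<or> (\<forall>x. (\<forall>y. \<kappa> x y = 0) \<longrightarrow> x = 0)"
proof -
  let ?R = "{x. \<forall>y. \<kappa> x y = 0}"
  have "\<kappa> (br z x) y = 0" if "\<forall>y. \<kappa> x y = 0" for x y z
    using that \<kappa>_invariant[of x z y] br_anti[of z x] by (simp add: \<kappa>_neg1)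
  then have "lie_ideal br ?R"
    unfolding lie_ideal_def by (auto intro!: vec.subspaceI simp: \<kappa>_add1 \<kappa>_scale1)
  then show ?thesis using ideal_trivial by blast
qed

lemma derived_UNIV: "vec.span {br x y |x y. True} = UNIV"
proof -
  let ?D = "vec.span {br x y |x y. True}"
  have "lie_ideal br ?D"
    unfolding lie_ideal_def by (auto intro!: vec.subspace_span vec.span_base)
  moreover have "?D \<noteq> {0}"
  proof -
    obtain x y where xy: "br x y \<noteq> 0" using nonabelian by blast
    have "br x y \<in> ?D" by (rule vec.span_base) blast
    then show ?thesis using xy by blast
  qed
  ultimately show ?thesis using ideal_trivial by blast
qed

lemma center_trivial: "(\<And>y. br y z = 0) \<Longrightarrow> z = 0"
proof -
  let ?Z = "{z. \<forall>y. br y z = 0}"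
  have "lie_ideal br ?Z" unfolding lie_ideal_def by (auto intro!: vec.subspaceI simp: br_add2 br_scale2)
  moreover have "?Z \<noteq> UNIV" using nonabelian by blast
  ultimately have "?Z = {0}" using ideal_trivial by blast
  then show "(\<And>y. br y z = 0) \<Longrightarrow> z = 0" by blast
qed

end

section \<open>Cartan subalgebras and roots\<close>

locale cartan = simple_lie br for br :: "complex^'n \<Rightarrow> complex^'n \<Rightarrow> complex^'n" +
  fixes H :: "(complex^'n) set"
  assumes cartan: "cartan_subalgebra br H"
begin

lemma subspace_H: "vec.subspace H" and H_closed: "x \<in> H \<Longrightarrow> y \<in> H \<Longrightarrow> br x y \<in> H"
  using cartan by (auto simp: cartan_subalgebra_def lie_subalgebra_def)

lemma H_0 [simp]: "0 \<in> H"
  using subspace_H by (rule vec.subspace_0)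

lemma H_normalizer: "(\<And>h. h \<in> H \<Longrightarrow> br h x \<in> H) \<Longrightarrow> x \<in> H"
proof -
  assume "\<And>h. h \<in> H \<Longrightarrow> br h x \<in> H"
  then have "br x h \<in> H" if "h \<in> H" for h
    using br_anti[of x h] that vec.subspace_neg[OF subspace_H] by simp
  then show "x \<in> H" using cartan unfolding cartan_subalgebra_def by blast
qed

text \<open>The upper central series of H, over which the induction in Engel's theorem runs.\<close>

definition upper_central :: "nat \<Rightarrow> (complex^'n) set" where
  "upper_central j = {y \<in> H. \<forall>xs. set xs \<subseteq> H \<longrightarrow> length xs = j \<longrightarrow> foldr br xs y = 0}"

lemma upper_central_0: "upper_central 0 = {0}"
  by (auto simp: upper_central_def)

lemma upper_central_Suc: "y \<in> upper_central (Suc j) \<Longrightarrow> h \<in> H \<Longrightarrow> br h y \<in> upper_central j"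
proof -
  assume y: "y \<in> upper_central (Suc j)" and h: "h \<in> H"
  have "foldr br xs (br h y) = 0" if "set xs \<subseteq> H" "length xs = j" for xs
  proof -
    have "set (xs @ [h]) \<subseteq> H" "length (xs @ [h]) = Suc j" using that h by auto
    then have "foldr br (xs @ [h]) y = 0" using y unfolding upper_central_def by blast
    then show ?thesis by simp
  qed
  then show "br h y \<in> upper_central j" using y h H_closed by (auto simp: upper_central_def)
qed

lemma upper_central_H: "\<exists>k. upper_central k = H"
proof -
  obtain k where "\<forall>xs y. set xs \<subseteq> H \<longrightarrow> length xs = k \<longrightarrow> y \<in> H \<longrightarrow> foldr br xs y = 0"
    using cartan unfolding cartan_subalgebra_def by blast
  then have "upper_central k = H" by (auto simp: upper_central_def)
  then show ?thesis by blast
qed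

lemma ad_H_nilpotent: "h \<in> H \<Longrightarrow> y \<in> H \<Longrightarrow> evnil (br h) y"
proof -
  assume h: "h \<in> H" "y \<in> H"
  obtain k where k: "upper_central k = H" using upper_central_H by blast
  have "y \<in> upper_central k" using k h by simp
  then have "foldr br (replicate k h) y = 0"
    using h unfolding upper_central_def by (elim CollectE conjE allE[of _ "replicate k h"]) auto
  moreover have "foldr br (replicate j h) y = (br h ^^ j) y" for j by (induction j) auto
  ultimately show "evnil (br h) y" by (auto simp: evnil_def)
qed

text \<open>Engel's theorem for H acting on W/W0. Take a stable U of least dimension strictly above
  W0. Along the upper central series each z maps U into W0: the part of U that z sends to W0 is
  stable, as brackets of z with H lie lower in the series, and it exceeds W0 because z acts
  nilpotently modulo W0.\<close>

lemma engel:
  assumes W: "vec.subspace W" "vec.subspace W0" "W0 \<subset> W"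
    and st: "\<And>h. h \<in> H \<Longrightarrow> br h ` W \<subseteq> W" "\<And>h. h \<in> H \<Longrightarrow> br h ` W0 \<subseteq> W0"
    and nil: "\<And>h w. h \<in> H \<Longrightarrow> w \<in> W \<Longrightarrow> \<exists>k. (br h ^^ k) w \<in> W0"
  shows "\<exists>v\<in>W - W0. \<forall>h\<in>H. br h v \<in> W0"
proof -
  let ?Q = "\<lambda>U. vec.subspace U \<and> W0 \<subset> U \<and> U \<subseteq> W \<and> (\<forall>h\<in>H. br h ` U \<subseteq> U)"
  have "?Q W" using W st by blast
  then obtain U where U: "?Q U" and min: "\<And>U'. ?Q U' \<Longrightarrow> vec.dim U \<le> vec.dim U'"
    using ex_has_least_nat[of ?Q W vec.dim] by blast
  obtain u where u: "u \<in> U" "u \<notin> W0" using U by blast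
  have "\<forall>z\<in>upper_central j. \<forall>u\<in>U. br z u \<in> W0" for j
  proof (induction j)
    case 0
    show ?case using vec.subspace_0[OF W(2)] by (simp add: upper_central_0)
  next
    case (Suc j)
    show ?case
    proof
      fix z assume z: "z \<in> upper_central (Suc j)"
      then have zH: "z \<in> H" by (auto simp: upper_central_def)
      let ?U = "{u \<in> U. br z u \<in> W0}"
      have sub: "vec.subspace ?U" using U W(2)
        by (auto intro!: vec.subspaceI simp: vec.subspace_0 vec.subspace_add vec.subspace_scale br_add2 br_scale2)
      have "br h x \<in> ?U" if h: "h \<in> H" and x: "x \<in> ?U" for h x
      proof -
        have "br h z \<in> upper_central j" using upper_central_Suc z h by blast
        then have "br (br h z) x \<in> W0" using Suc x by blast
        then have "- br (br h z) x \<in> W0" using vec.subspace_neg[OF W(2)] by blast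
        moreover have "br h (br z x) \<in> W0" using x st(2)[OF h] by blast
        moreover have "br z (br h x) = br h (br z x) + (- br (br h z) x)"
          using jacobi[of h z x] by simp
        ultimately have "br z (br h x) \<in> W0" using vec.subspace_add[OF W(2)] by metis
        moreover have "br h x \<in> U" using U h x by blast
        ultimately show ?thesis by blast
      qed
      moreover have "W0 \<subset> ?U"
      proof -
        have "W0 \<subseteq> ?U" using U st(2)[OF zH] by blast
        moreover have "\<exists>x. x \<in> ?U \<and> x \<notin> W0"
        proof -
          define k where "k = (LEAST k. (br z ^^ k) u \<in> W0)"
          have "(br z ^^ k) u \<in> W0" unfolding k_def
            by (rule LeastI_ex, rule nil[OF zH]) (use u U in blast)
          moreover from this have "k \<noteq> 0" using u by (metis funpow_0)
          then obtain j where j: "k = Suc j" by (metis not0_implies_Suc)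
          have "(br z ^^ j) u \<notin> W0" using not_less_Least[of j "\<lambda>k. (br z ^^ k) u \<in> W0"] j k_def by auto
          moreover have "(br z ^^ j) u \<in> U" using U zH u by (intro stable_funpow) auto
          ultimately show ?thesis using j by auto
        qed
        ultimately show ?thesis by blast
      qed
      ultimately have "?Q ?U" using sub U by (intro conjI ballI image_subsetI) auto
      then have "vec.dim U \<le> vec.dim ?U" by (rule min)
      then have "?U = U" using vec.subspace_dim_equal[of ?U U] sub U by auto
      then show "\<forall>u\<in>U. br z u \<in> W0" by blast
    qed
  qed
  then have "\<forall>h\<in>H. br h u \<in> W0" using upper_central_H u by metis
  then show ?thesis using u U by blast
qed

sublocale ad: gws_family br H
proof (rule gws_family.intro, goal_cases)
  case (1 h)
  show ?case by (rule lin_br2)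
next
  case (2 h h' a v)
  \<comment> \<open>Since H is nilpotent, h' is a generalized eigenvector of ad h for 0, and
    brackets add eigenvalues.\<close>
  have "evnil (shift (br h) 0) h'" using ad_H_nilpotent[OF 2(1,2)] by simp
  from evnil_br[OF this 2(3)] show ?case by simp
qed

abbreviation "G \<equiv> ad.gws"
abbreviation "\<Lambda> \<equiv> ad.wts"

lemma G_br: "x \<in> G f \<Longrightarrow> y \<in> G g \<Longrightarrow> br x y \<in> G (\<lambda>h. f h + g h)"
  by (auto simp: ad.gws_def intro: evnil_br)

text \<open>A larger generalized 0-space would contain, by Engel on its quotient by H, a vector
  outside H that normalizes H.\<close>

lemma G_zero: "G (\<lambda>_. 0) = H"
proof (rule ccontr)
  assume ne: "\<not> ?thesis"
  have sub: "H \<subseteq> G (\<lambda>_. 0)" using ad_H_nilpotent by (auto simp: ad.gws_def)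
  have nil: "\<exists>k. (br h ^^ k) w \<in> H" if "h \<in> H" "w \<in> G (\<lambda>_. 0)" for h w
  proof -
    have "evnil (br h) w" using that by (simp add: ad.gws_def)
    then obtain k where "(br h ^^ k) w = 0" by (auto simp: evnil_def)
    then show ?thesis by (metis H_0)
  qed
  have "\<exists>v\<in>G (\<lambda>_. 0) - H. \<forall>h\<in>H. br h v \<in> H"
    using engel[OF ad.subspace_gws subspace_H _ _ _ nil] sub ne ad.gws_stable H_closed by blast
  then show False using H_normalizer by blast
qed

lemma indep_G: "indep_fam \<Lambda> G"
  unfolding indep_fam_def
proof (intro conjI allI impI ballI ad.finite_wts ad.subspace_gws)
  fix v f assume v: "\<forall>i\<in>\<Lambda>. v i \<in> G i" "(\<Sum>i\<in>\<Lambda>. v i) = 0" and f: "f \<in> \<Lambda>"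
  show "v f = 0"
  proof (rule ad.gws_indep[OF ad.finite_wts _ _ v(2) f])
    show "g x = 0" if "g \<in> \<Lambda>" "x \<notin> H" for g x using that by (simp add: ad.wts_def)
    show "v g \<in> G g" if "g \<in> \<Lambda>" for g using v(1) that by blast
  qed
qed

text \<open>Sums and negatives of weights occur as indices of G. Only values on H matter, and the
  member of \<open>\<Lambda>\<close> is the copy that vanishes outside H.\<close>

lemma G_trivial_or_wt: "G f = {0} \<or> (\<exists>g\<in>\<Lambda>. (\<forall>h\<in>H. g h = f h) \<and> G g = G f)"
proof -
  let ?g = "\<lambda>x. if x \<in> H then f x else 0"
  have g: "G ?g = G f" by (rule ad.gws_cong) auto
  show ?thesis
  proof (cases "G f = {0}")
    case False
    then have "?g \<in> \<Lambda>" using g by (auto simp: ad.wts_def)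
    then show ?thesis using g by (intro disjI2 bexI[of _ ?g]) auto
  qed simp
qed

definition Pr :: "(complex^'n \<Rightarrow> complex) \<Rightarrow> complex^'n \<Rightarrow> complex^'n" where
  "Pr = (SOME P. (\<forall>i\<in>\<Lambda>. is_proj (G i) (P i) \<and> (\<forall>j\<in>\<Lambda>. j \<noteq> i \<longrightarrow> (\<forall>u\<in>G j. P i u = 0)))
     \<and> is_proj (sumsp \<Lambda> G) (\<lambda>v. \<Sum>i\<in>\<Lambda>. P i v))"

lemma Pr_props: "(\<forall>i\<in>\<Lambda>. is_proj (G i) (Pr i) \<and> (\<forall>j\<in>\<Lambda>. j \<noteq> i \<longrightarrow> (\<forall>u\<in>G j. Pr i u = 0)))
     \<and> is_proj (sumsp \<Lambda> G) (\<lambda>v. \<Sum>i\<in>\<Lambda>. Pr i v)"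
  using someI_ex[OF projections_exist[OF indep_G]] unfolding Pr_def .

lemma Pr_proj: "f \<in> \<Lambda> \<Longrightarrow> is_proj (G f) (Pr f)"
  using Pr_props by blast

lemma Pr_lin: "f \<in> \<Lambda> \<Longrightarrow> lin (Pr f)" and Pr_in: "f \<in> \<Lambda> \<Longrightarrow> Pr f v \<in> G f"
  and Pr_id: "f \<in> \<Lambda> \<Longrightarrow> v \<in> G f \<Longrightarrow> Pr f v = v"
  using Pr_proj[of f] by (auto simp: is_proj_def)

lemma Pr_sum: "(\<Sum>f\<in>\<Lambda>. Pr f v) = v"
  using Pr_props sumsp_UNIV[OF indep_G ad.wts_span] by (auto simp: is_proj_def)

lemma Pr_other: "f \<in> \<Lambda> \<Longrightarrow> u \<in> G g \<Longrightarrow> h \<in> H \<Longrightarrow> f h \<noteq> g h \<Longrightarrow> Pr f u = 0"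
proof -
  assume a: "f \<in> \<Lambda>" "u \<in> G g" "h \<in> H" "f h \<noteq> g h"
  from G_trivial_or_wt[of g] show "Pr f u = 0"
  proof
    assume "G g = {0}" then show ?thesis using a Pr_lin[OF a(1)] by (auto simp: vec.linear_0)
  next
    assume "\<exists>g'\<in>\<Lambda>. (\<forall>h\<in>H. g' h = g h) \<and> G g' = G g"
    then obtain g' where g': "g' \<in> \<Lambda>" "g' h = g h" "G g' = G g" using a(3) by blast
    then have "g' \<noteq> f" using a by auto
    then show ?thesis using Pr_props a g' by metis
  qed
qed

lemma ftr_decompose: "lin T \<Longrightarrow> ftr T = (\<Sum>f\<in>\<Lambda>. ftr (\<lambda>v. T (Pr f v)))"
proof -
  assume T: "lin T"
  have "(\<Sum>f\<in>\<Lambda>. ftr (\<lambda>v. T (Pr f v))) = ftr (\<lambda>v. T (\<Sum>f\<in>\<Lambda>. Pr f v))"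
    by (simp add: ftr_sum[symmetric] vec.linear_sum[OF T])
  then show ?thesis by (simp add: Pr_sum)
qed

section \<open>Linearity of the weights and Cartan's criterion\<close>

definition d :: "(complex^'n \<Rightarrow> complex) \<Rightarrow> nat" where
  "d f = vec.dim (G f)"

lemma d_pos: "f \<in> \<Lambda> \<Longrightarrow> d f > 0"
  using vec.dim_eq_0[of "G f"] vec.subspace_0[OF ad.subspace_gws, of f] unfolding d_def ad.wts_def by auto

lemma ftr_weight: "f \<in> \<Lambda> \<Longrightarrow> h \<in> H \<Longrightarrow> ftr (\<lambda>v. br h (Pr f v)) = f h * of_nat (d f)"
  unfolding d_def
  by (rule ftr_gen_eigenspace[OF Pr_proj ad.subspace_gws lin_br2])
     (auto simp: ad.gws_stable, simp add: ad.gws_def)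

text \<open>f h times the positive dimension d f is the trace of ad h on G f, and this trace is
  additive in h.\<close>

lemma wt_add: "f \<in> \<Lambda> \<Longrightarrow> x \<in> H \<Longrightarrow> y \<in> H \<Longrightarrow> f (x + y) = f x + f y"
  using ftr_weight[of f "x + y"] ftr_weight[of f x] ftr_weight[of f y] d_pos[of f] vec.subspace_add[OF subspace_H, of x y]
  by (simp add: br_add1 ftr_add flip: distrib_right)

lemma wt_scale: "f \<in> \<Lambda> \<Longrightarrow> x \<in> H \<Longrightarrow> f (c *s x) = c * f x"
  using ftr_weight[of f "c *s x"] ftr_weight[of f x] d_pos[of f] vec.subspace_scale[OF subspace_H, of x c]
  by (simp add: br_scale1 ftr_scale)

lemma wt_0: "f \<in> \<Lambda> \<Longrightarrow> f 0 = 0"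
  using wt_scale[of f 0 0] by simp

lemma wt_br: "f \<in> \<Lambda> \<Longrightarrow> x \<in> H \<Longrightarrow> y \<in> H \<Longrightarrow> f (br x y) = 0"
proof -
  assume a: "f \<in> \<Lambda>" "x \<in> H" "y \<in> H"
  have "ftr (\<lambda>v. br x (br y (Pr f v)) - br y (br x (Pr f v))) = 0"
    using a by (intro ftr_commutator[OF Pr_proj] lin_br2) (auto simp: ad.gws_stable)
  moreover have "br (br x y) v = br x (br y v) - br y (br x v)" for v using jacobi[of x y v] by simp
  ultimately have "ftr (\<lambda>v. br (br x y) (Pr f v)) = 0" by simp
  then show ?thesis using ftr_weight[OF a(1) H_closed[OF a(2,3)]] d_pos[OF a(1)] by simp
qed

lemma in_sumsp_G:
  assumes "J \<subseteq> \<Lambda>" "u \<in> G f" "\<And>g. g \<in> \<Lambda> \<Longrightarrow> (\<And>h. h \<in> H \<Longrightarrow> g h = f h) \<Longrightarrow> g \<in> J"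
  shows "u \<in> sumsp J G"
proof -
  have ind: "indep_fam J G" by (rule indep_fam_subset[OF indep_G assms(1)]) (simp add: ad.subspace_gws)
  from G_trivial_or_wt[of f] show ?thesis
  proof
    assume "G f = {0}"
    then show ?thesis using assms(2) vec.subspace_0[OF subspace_sumsp[OF ind]] by simp
  next
    assume "\<exists>g\<in>\<Lambda>. (\<forall>h\<in>H. g h = f h) \<and> G g = G f"
    then show ?thesis using assms sumsp_incl[OF ind] by blast
  qed
qed

text \<open>The string of all weights \<mu> + j f is stable under x and y, so t = [x, y] has trace 0
  on it. This reads \<mu>(t) D + f(t) E = 0 with integers D > 0 and E.\<close>

lemma real_ratio:
  assumes x: "x \<in> G f" and y: "y \<in> G (\<lambda>h. - f h)" and \<mu>: "\<mu> \<in> \<Lambda>"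
  shows "br x y \<in> H" "\<exists>r::real. \<mu> (br x y) = of_real r * f (br x y)"
proof -
  let ?t = "br x y"
  have "?t \<in> G (\<lambda>h. f h + - f h)" by (rule G_br[OF x y])
  then show t: "?t \<in> H" using G_zero by simp
  let ?J = "{\<nu> \<in> \<Lambda>. \<exists>j::int. \<forall>h\<in>H. \<nu> h = \<mu> h + of_int j * f h}"
  have JL: "?J \<subseteq> \<Lambda>" by blast
  have ind: "indep_fam ?J G" by (rule indep_fam_subset[OF indep_G JL]) (simp add: ad.subspace_gws)
  have fin: "finite ?J" using JL ad.finite_wts finite_subset by blast
  have stx: "br x ` sumsp ?J G \<subseteq> sumsp ?J G"
  proof (rule sumsp_stable[OF lin_br2 ind])
    fix \<nu> u assume \<nu>: "\<nu> \<in> ?J" and u: "u \<in> G \<nu>"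
    obtain j where j: "\<forall>h\<in>H. \<nu> h = \<mu> h + of_int j * f h" using \<nu> by blast
    show "br x u \<in> sumsp ?J G"
      by (rule in_sumsp_G[OF JL G_br[OF x u]]) (use j in \<open>auto intro!: exI[of _ "j + 1"] simp: algebra_simps\<close>)
  qed
  have sty: "br y ` sumsp ?J G \<subseteq> sumsp ?J G"
  proof (rule sumsp_stable[OF lin_br2 ind])
    fix \<nu> u assume \<nu>: "\<nu> \<in> ?J" and u: "u \<in> G \<nu>"
    obtain j where j: "\<forall>h\<in>H. \<nu> h = \<mu> h + of_int j * f h" using \<nu> by blast
    show "br y u \<in> sumsp ?J G"
      by (rule in_sumsp_G[OF JL G_br[OF y u]]) (use j in \<open>auto intro!: exI[of _ "j - 1"] simp: algebra_simps\<close>)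
  qed
  have tr0: "(\<Sum>\<nu>\<in>?J. \<nu> ?t * of_nat (vec.dim (G \<nu>))) = 0"
  proof (rule commutator_weights[OF ind lin_br2 stx lin_br2 sty lin_br2[of ?t]])
    show "br ?t v = br x (br y v) - br y (br x v)" for v using jacobi[of x y v] by simp
    show "br ?t ` G i \<subseteq> G i" for i using ad.gws_stable t by blast
    show "evnil (shift (br ?t) (i ?t)) u" if "u \<in> G i" for i u using that t by (auto simp: ad.gws_def)
  qed
  have "\<exists>j. \<forall>\<nu>\<in>?J. \<forall>h\<in>H. \<nu> h = \<mu> h + of_int (j \<nu> :: int) * f h" by (rule bchoice) blast
  then obtain j where j: "\<forall>\<nu>\<in>?J. \<forall>h\<in>H. \<nu> h = \<mu> h + of_int (j \<nu> :: int) * f h" by blast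
  have "(\<Sum>\<nu>\<in>?J. (\<mu> ?t + of_int (j \<nu>) * f ?t) * of_nat (d \<nu>)) = (\<Sum>\<nu>\<in>?J. \<nu> ?t * of_nat (d \<nu>))"
    using t j by (intro sum.cong) auto
  also have "\<dots> = 0" unfolding d_def by (rule tr0)
  finally have "(\<Sum>\<nu>\<in>?J. (\<mu> ?t + of_int (j \<nu>) * f ?t) * of_nat (d \<nu>)) = 0" .
  then have e: "\<mu> ?t * of_nat (\<Sum>\<nu>\<in>?J. d \<nu>) = - f ?t * of_int (\<Sum>\<nu>\<in>?J. j \<nu> * int (d \<nu>))"
  proof -
    have "(\<Sum>\<nu>\<in>?J. (\<mu> ?t + of_int (j \<nu>) * f ?t) * of_nat (d \<nu>))
        = (\<Sum>\<nu>\<in>?J. \<mu> ?t * of_nat (d \<nu>)) + (\<Sum>\<nu>\<in>?J. f ?t * of_int (j \<nu> * int (d \<nu>)))"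
      unfolding sum.distrib[symmetric] by (rule sum.cong) (auto simp: algebra_simps)
    also have "\<dots> = \<mu> ?t * of_nat (\<Sum>\<nu>\<in>?J. d \<nu>) + f ?t * of_int (\<Sum>\<nu>\<in>?J. j \<nu> * int (d \<nu>))"
      by (simp only: sum_distrib_left[symmetric] of_nat_sum of_int_sum)
    finally show ?thesis using \<open>(\<Sum>\<nu>\<in>?J. (\<mu> ?t + of_int (j \<nu>) * f ?t) * of_nat (d \<nu>)) = 0\<close>
      by (simp only: mult_minus_left eq_neg_iff_add_eq_0)
  qed
  have "\<mu> \<in> ?J" using \<mu> by (auto intro!: exI[of _ 0])
  then have "(\<Sum>\<nu>\<in>?J. d \<nu>) > 0" using d_pos[OF \<mu>] fin by (meson sum_pos2 zero_le)
  then obtain D :: nat and E :: int where "D > 0" "\<mu> ?t * of_nat D = - f ?t * of_int E" using e by blast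
  then have "\<mu> ?t = of_real (- (of_int E / of_nat D)) * f ?t" by (simp add: field_simps)
  then show "\<exists>r::real. \<mu> ?t = of_real r * f ?t" by blast
qed

lemma \<kappa>_square: "h \<in> H \<Longrightarrow> \<kappa> h h = (\<Sum>f\<in>\<Lambda>. (f h)\<^sup>2 * of_nat (d f))"
  unfolding \<kappa>_def ftr_decompose[OF lin_br_br[of h h]]
proof (rule sum.cong[OF HOL.refl])
  fix f assume h: "h \<in> H" and f: "f \<in> \<Lambda>"
  show "ftr (\<lambda>v. br h (br h (Pr f v))) = (f h)\<^sup>2 * of_nat (d f)"
    unfolding d_def
  proof (rule ftr_gen_eigenspace[OF Pr_proj[OF f] ad.subspace_gws lin_br_br[of h h]])
    show "(\<lambda>v. br h (br h v)) ` G f \<subseteq> G f" using ad.gws_stable h by blast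
    fix u assume "u \<in> G f"
    then have u: "evnil (shift (br h) (f h)) u" using h by (auto simp: ad.gws_def)
    have "shift (\<lambda>v. br h (br h v)) ((f h)\<^sup>2) = (\<lambda>v. shift (br h) (- f h) (shift (br h) (f h) v))"
      by (auto simp: shift_def br_diff2 br_scale2 power2_eq_square vec.scale_right_diff_distrib)
    moreover have "evnil (\<lambda>v. shift (br h) (- f h) (shift (br h) (f h) v)) u"
      by (rule evnil_commute_comp[OF _ lin_shift[OF lin_br2] u])
         (auto simp: shift_def br_diff2 br_add2 br_scale2 vec.scale_right_diff_distrib vec.scale_right_distrib algebra_simps)
    ultimately show "evnil (shift (\<lambda>v. br h (br h v)) ((f h)\<^sup>2)) u" by simp
  qed
qed

lemma \<kappa>_H: "h \<in> H \<Longrightarrow> h' \<in> H \<Longrightarrow> \<kappa> h h' = (\<Sum>f\<in>\<Lambda>. f h * f h' * of_nat (d f))"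
proof -
  assume h: "h \<in> H" "h' \<in> H"
  have "\<kappa> (h + h') (h + h') = \<kappa> h h + \<kappa> h' h' + 2 * \<kappa> h h'"
    using \<kappa>_commute[of h' h] by (simp add: \<kappa>_add1 \<kappa>_add2)
  moreover have "\<kappa> (h + h') (h + h') = (\<Sum>f\<in>\<Lambda>. (f h)\<^sup>2 * of_nat (d f)) + (\<Sum>f\<in>\<Lambda>. (f h')\<^sup>2 * of_nat (d f))
       + 2 * (\<Sum>f\<in>\<Lambda>. f h * f h' * of_nat (d f))"
  proof -
    have "\<kappa> (h + h') (h + h') = (\<Sum>f\<in>\<Lambda>. (f h)\<^sup>2 * of_nat (d f) + (f h')\<^sup>2 * of_nat (d f) + 2 * (f h * f h' * of_nat (d f)))"
      unfolding \<kappa>_square[OF vec.subspace_add[OF subspace_H h]]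
      by (rule sum.cong) (auto simp: h wt_add power2_sum algebra_simps)
    then show ?thesis by (simp only: sum.distrib sum_distrib_left)
  qed
  ultimately show ?thesis using \<kappa>_square h by simp
qed

text \<open>All weights at t are real multiples of f(t), so \<open>\<kappa>\<close> t t is f(t)^2
  times a sum of real squares with positive multiplicities; it vanishes only if all weights vanish
  at t.\<close>

lemma Cartan_vanishing:
  assumes x: "x \<in> G f" and y: "y \<in> G (\<lambda>h. - f h)" and k: "\<kappa> (br x y) (br x y) = 0" and \<mu>: "\<mu> \<in> \<Lambda>"
  shows "\<mu> (br x y) = 0"
proof -
  let ?t = "br x y"
  have t: "?t \<in> H" by (rule real_ratio(1)[OF x y \<mu>])
  have "\<forall>\<nu>\<in>\<Lambda>. \<exists>r::real. \<nu> ?t = of_real r * f ?t" using real_ratio(2)[OF x y] by blast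
  then obtain r where r: "\<And>\<nu>. \<nu> \<in> \<Lambda> \<Longrightarrow> \<nu> ?t = of_real (r \<nu> :: real) * f ?t" by metis
  show ?thesis
  proof (cases "f ?t = 0")
    case True then show ?thesis using r \<mu> by simp
  next
    case False
    have "0 = (\<Sum>\<nu>\<in>\<Lambda>. (f ?t)\<^sup>2 * of_real ((r \<nu>)\<^sup>2 * of_nat (d \<nu>)))"
      using k \<kappa>_square[OF t] by (simp add: r power_mult_distrib mult_ac cong: sum.cong)
    also have "\<dots> = (f ?t)\<^sup>2 * of_real (\<Sum>\<nu>\<in>\<Lambda>. (r \<nu>)\<^sup>2 * of_nat (d \<nu>))" by (simp add: sum_distrib_left)
    finally have "(\<Sum>\<nu>\<in>\<Lambda>. (r \<nu>)\<^sup>2 * of_nat (d \<nu>)) = 0" using False by (simp del: of_real_sum)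
    then have "\<forall>\<nu>\<in>\<Lambda>. (r \<nu>)\<^sup>2 * of_nat (d \<nu>) = 0"
      using sum_nonneg_eq_0_iff[OF ad.finite_wts, of "\<lambda>\<nu>. (r \<nu>)\<^sup>2 * of_nat (d \<nu>)"] by simp
    then show ?thesis using r[OF \<mu>] d_pos[OF \<mu>] \<mu> by fastforce
  qed
qed

text \<open>The algebra equals its derived algebra, and the projection to weight 0 of a bracket of
  weight vectors survives only for opposite weights.\<close>

lemma H_generated: "H \<subseteq> vec.span {br x y |x y. \<exists>f\<in>\<Lambda>. x \<in> G f \<and> y \<in> G (\<lambda>h. - f h)}"
  (is "_ \<subseteq> vec.span ?X")
proof
  fix h assume h: "h \<in> H"
  show "h \<in> vec.span ?X"
  proof (cases "(\<lambda>_. 0) \<in> \<Lambda>")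
    case False
    then have "H = {0}" using G_zero by (auto simp: ad.wts_def)
    then show ?thesis using h by (simp add: vec.span_zero)
  next
    case True
    note P0 = Pr_lin[OF True]
    let ?S = "{w. Pr (\<lambda>_. 0) w \<in> vec.span ?X}"
    have "vec.subspace ?S"
      by (intro vec.subspaceI) (auto simp: vec.linear_0[OF P0] vec.linear_add[OF P0] vec.linear_scale[OF P0]
          vec.span_zero vec.span_add vec.span_scale)
    moreover have "{br x y |x y. True} \<subseteq> ?S"
    proof clarify
      fix x y
      have e: "br x y = (\<Sum>f\<in>\<Lambda>. \<Sum>g\<in>\<Lambda>. br (Pr f x) (Pr g y))"
        by (simp only: br_sum1[symmetric] br_sum2[symmetric] Pr_sum)
      have "Pr (\<lambda>_. 0) (br (Pr f x) (Pr g y)) \<in> vec.span ?X" if fg: "f \<in> \<Lambda>" "g \<in> \<Lambda>" for f g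
      proof (cases "\<forall>h\<in>H. f h + g h = 0")
        case sum0: True
        have "G g = G (\<lambda>h. - f h)" by (rule ad.gws_cong) (metis sum0 add.inverse_unique)
        then have "br (Pr f x) (Pr g y) \<in> ?X" using Pr_in fg by blast
        moreover have "Pr (\<lambda>_. 0) (br (Pr f x) (Pr g y)) = br (Pr f x) (Pr g y)"
          using G_br[OF Pr_in[OF fg(1)] Pr_in[OF fg(2)], of x y] ad.gws_cong[of "\<lambda>h. f h + g h" "\<lambda>_. 0"] sum0
          by (intro Pr_id[OF True]) auto
        ultimately show ?thesis by (simp only: vec.span_base)
      next
        case False
        then have "Pr (\<lambda>_. 0) (br (Pr f x) (Pr g y)) = 0"
          using Pr_other[OF True G_br[OF Pr_in[OF fg(1)] Pr_in[OF fg(2)]]] by metis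
        then show ?thesis by (simp add: vec.span_zero)
      qed
      then show "Pr (\<lambda>_. 0) (br x y) \<in> vec.span ?X"
        unfolding e by (simp add: vec.linear_sum[OF P0] vec.span_sum)
    qed
    ultimately have "vec.span {br x y |x y. True} \<subseteq> ?S" by (rule vec.span_minimal[rotated])
    then have "h \<in> ?S" using derived_UNIV by blast
    then show ?thesis using Pr_id[OF True, of h] h G_zero by simp
  qed
qed

text \<open>If all weights vanished, H would be the whole algebra, and the trivial centre would keep
  the upper central series at 0, against nilpotency.\<close>

lemma exists_nonzero_wt: "\<exists>\<mu>\<in>\<Lambda>. \<exists>h\<in>H. \<mu> h \<noteq> 0"
proof (rule ccontr)
  assume "\<not> ?thesis"
  then have z: "G f = H" if "f \<in> \<Lambda>" for f
    using that G_zero ad.gws_cong[of f "\<lambda>_. 0"] by auto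
  have "vec.span (\<Union>f\<in>\<Lambda>. G f) \<subseteq> H" using z by (intro vec.span_minimal subspace_H) blast
  then have HU: "H = UNIV" using ad.wts_span by blast
  have "upper_central j = {0}" for j
  proof (induction j)
    case (Suc j)
    have "z = 0" if "z \<in> upper_central (Suc j)" for z
      by (rule center_trivial) (use upper_central_Suc[OF that] Suc HU in auto)
    moreover have "0 \<in> upper_central (Suc j)"
    proof -
      have "foldr br xs 0 = 0" for xs by (induction xs) auto
      then show ?thesis by (simp add: upper_central_def)
    qed
    ultimately show ?case by blast
  qed (rule upper_central_0)
  then show False using upper_central_H HU nonabelian by (metis UNIV_I br_01 singletonD)
qed

text \<open>If \<open>\<kappa>\<close> vanished, every weight would vanish at all brackets of
  opposite weight vectors by \<open>Cartan_vanishing\<close>; these span H, against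
  \<open>exists_nonzero_wt\<close>.\<close>

lemma \<kappa>_nondegenerate: "(\<And>y. \<kappa> x y = 0) \<Longrightarrow> x = 0"
proof -
  have "\<not> (\<forall>x y. \<kappa> x y = 0)"
  proof
    assume z: "\<forall>x y. \<kappa> x y = 0"
    obtain \<mu> h where \<mu>: "\<mu> \<in> \<Lambda>" "h \<in> H" "\<mu> h \<noteq> 0" using exists_nonzero_wt by blast
    let ?K = "{h \<in> H. \<mu> h = 0}"
    have "vec.subspace ?K"
      using subspace_H \<mu>(1) by (intro vec.subspaceI)
        (auto simp: wt_0 wt_add wt_scale vec.subspace_add vec.subspace_scale)
    moreover have "{br x y |x y. \<exists>f\<in>\<Lambda>. x \<in> G f \<and> y \<in> G (\<lambda>h. - f h)} \<subseteq> ?K"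
      using Cartan_vanishing[OF _ _ _ \<mu>(1)] real_ratio(1)[OF _ _ \<mu>(1)] z by blast
    ultimately have "H \<subseteq> ?K" using H_generated vec.span_minimal by blast
    then show False using \<mu> by blast
  qed
  then show "(\<And>y. \<kappa> x y = 0) \<Longrightarrow> x = 0" using radical_trivial by blast
qed

text \<open>ad x followed after ad y moves every weight space to a different weight, so the
  composite has no diagonal part.\<close>

lemma \<kappa>_orthogonal:
  assumes "x \<in> G f" "y \<in> G g" "h \<in> H" "f h + g h \<noteq> 0"
  shows "\<kappa> x y = 0"
  unfolding \<kappa>_def ftr_decompose[OF lin_br_br[of x y]]
proof (rule sum.neutral, rule ballI)
  fix \<nu> assume \<nu>: "\<nu> \<in> \<Lambda>"
  show "ftr (\<lambda>v. br x (br y (Pr \<nu> v))) = 0"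
  proof (rule ftr_off_diagonal[OF Pr_lin[OF \<nu>] lin_br_br[of x y]])
    show "Pr \<nu> (Pr \<nu> v) = Pr \<nu> v" for v using Pr_id Pr_in \<nu> by blast
    fix v
    have "br x (br y (Pr \<nu> v)) \<in> G (\<lambda>h. f h + (g h + \<nu> h))" using assms G_br Pr_in[OF \<nu>] by blast
    then show "Pr \<nu> (br x (br y (Pr \<nu> v))) = 0"
      using assms(4) by (intro Pr_other[OF \<nu> _ assms(3)]) (auto simp: algebra_simps)
  qed
qed

lemma wts_separate_H:
  assumes h: "h \<in> H" and z: "\<And>\<mu>. \<mu> \<in> \<Lambda> \<Longrightarrow> \<mu> h = 0"
  shows "h = 0"
proof (rule \<kappa>_nondegenerate)
  fix y
  have "\<kappa> h (Pr f y) = 0" if f: "f \<in> \<Lambda>" for f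
  proof (cases "\<forall>h\<in>H. f h = 0")
    case True
    then have "Pr f y \<in> H" using Pr_in[OF f, of y] G_zero ad.gws_cong[of f "\<lambda>_. 0"] by auto
    then show ?thesis using z by (auto simp: \<kappa>_H[OF h] intro!: sum.neutral)
  next
    case False
    then obtain h' where "h' \<in> H" "f h' \<noteq> 0" by blast
    then show ?thesis using \<kappa>_orthogonal[of h "\<lambda>_. 0" "Pr f y" f h'] h G_zero Pr_in[OF f] by auto
  qed
  then have "(\<Sum>f\<in>\<Lambda>. \<kappa> h (Pr f y)) = 0" by simp
  then show "\<kappa> h y = 0" by (simp add: \<kappa>_sum2[symmetric] Pr_sum)
qed

lemma H_abelian: "x \<in> H \<Longrightarrow> y \<in> H \<Longrightarrow> br x y = 0"
  by (rule wts_separate_H) (auto simp: H_closed wt_br)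


section \<open>One-dimensional root spaces and sl_2-triples\<close>

lemma dual_vector:
  assumes x: "x \<in> G \<alpha>" "x \<noteq> 0"
  shows "\<exists>y\<in>G (\<lambda>h. - \<alpha> h). \<kappa> x y \<noteq> 0"
proof -
  obtain y where "\<kappa> x y \<noteq> 0" using \<kappa>_nondegenerate x(2) by blast
  then have "(\<Sum>\<nu>\<in>\<Lambda>. \<kappa> x (Pr \<nu> y)) \<noteq> 0" by (simp add: \<kappa>_sum2[symmetric] Pr_sum)
  then obtain \<nu> where \<nu>: "\<nu> \<in> \<Lambda>" "\<kappa> x (Pr \<nu> y) \<noteq> 0" by (meson sum.neutral)
  then have "\<forall>h\<in>H. \<alpha> h + \<nu> h = 0" using \<kappa>_orthogonal[OF x(1) Pr_in[OF \<nu>(1)]] by blast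
  then have "G \<nu> = G (\<lambda>h. - \<alpha> h)" by (intro ad.gws_cong) (metis add.inverse_unique)
  then show ?thesis using \<nu> Pr_in by blast
qed

lemma root_vector_exists:
  assumes "\<alpha> \<in> \<Lambda>"
  shows "\<exists>e\<in>G \<alpha>. e \<noteq> 0 \<and> (\<forall>h\<in>H. br h e = \<alpha> h *s e)"
proof -
  have ne: "G \<alpha> \<noteq> {0}" using assms by (simp add: ad.wts_def)
  have "\<exists>v\<in>G \<alpha>. v \<noteq> 0 \<and> (\<forall>h\<in>H. \<exists>a. br h v = a *s v)"
  proof (rule common_eigenvector[OF ad.subspace_gws ne])
    show "br h ` G \<alpha> \<subseteq> G \<alpha>" if "h \<in> H" for h using ad.gws_stable that by blast
    show "br h (br h' v) = br h' (br h v)" if "h \<in> H" "h' \<in> H" for h h' v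
      using jacobi[of h h' v] H_abelian that by simp
  qed (rule lin_br2)
  then obtain v where v: "v \<in> G \<alpha>" "v \<noteq> 0" "\<forall>h\<in>H. \<exists>a. br h v = a *s v" by blast
  have "br h v = \<alpha> h *s v" if h: "h \<in> H" for h
  proof -
    obtain a where a: "br h v = a *s v" using v(3) h by blast
    have "evnil (shift (br h) (\<alpha> h)) v" using v(1) h by (simp add: ad.gws_def)
    then have "a = \<alpha> h" using evnil_shift_unique[OF lin_br2 evnil_shift_eigen[of "br h", OF a]] v(2) by blast
    then show ?thesis using a by simp
  qed
  then show ?thesis using v by blast
qed

text \<open>[e, y] is a nonzero multiple of the Killing dual of \<alpha>. If \<alpha> vanished
  there, so would every weight by \<open>real_ratio\<close>, although weights separate H.\<close>

lemma coroot_direction: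
  assumes \<alpha>: "\<alpha> \<in> \<Lambda>" "h0 \<in> H" "\<alpha> h0 \<noteq> 0"
    and e: "e \<in> G \<alpha>" "\<And>h. h \<in> H \<Longrightarrow> br h e = \<alpha> h *s e"
    and y: "y \<in> G (\<lambda>h. - \<alpha> h)" "\<kappa> e y \<noteq> 0"
  shows "br e y \<in> H" "\<And>h. h \<in> H \<Longrightarrow> \<kappa> (br e y) h = \<alpha> h * \<kappa> e y" "\<alpha> (br e y) \<noteq> 0"
proof -
  let ?t = "br e y"
  show t: "?t \<in> H" by (rule real_ratio(1)[OF e(1) y(1) \<alpha>(1)])
  show k: "\<kappa> ?t h = \<alpha> h * \<kappa> e y" if h: "h \<in> H" for h
  proof -
    have "\<kappa> ?t h = \<kappa> h (br e y)" by (rule \<kappa>_commute)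
    also have "\<dots> = \<kappa> (br h e) y" by (rule \<kappa>_invariant[symmetric])
    finally show ?thesis by (simp add: e(2)[OF h] \<kappa>_scale1)
  qed
  show "\<alpha> ?t \<noteq> 0"
  proof
    assume 0: "\<alpha> ?t = 0"
    have "\<mu> ?t = 0" if "\<mu> \<in> \<Lambda>" for \<mu> using real_ratio(2)[OF e(1) y(1) that] 0 by auto
    then have "?t = 0" using wts_separate_H[OF t] by blast
    then show False using k[OF \<alpha>(2)] \<alpha>(3) y(2) by simp
  qed
qed

text \<open>Compare the trace of \<open>br e y\<close> on \<open>\<complex> e \<oplus> H \<oplus> \<Oplus>\<^sub>k G (- k \<alpha>)\<close> with \<open>0\<close>.\<close>

lemma root_string:
  assumes \<alpha>: "\<alpha> \<in> \<Lambda>" "h0 \<in> H" "\<alpha> h0 \<noteq> 0"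
  shows "(\<lambda>h. - \<alpha> h) \<in> \<Lambda>" "d (\<lambda>h. - \<alpha> h) = 1"
    "\<And>k \<nu>. 2 \<le> k \<Longrightarrow> \<nu> \<in> \<Lambda> \<Longrightarrow> \<not> (\<forall>h\<in>H. \<nu> h = - (of_nat k * \<alpha> h))"
proof -
  obtain e where e: "e \<in> G \<alpha>" "e \<noteq> 0" "\<And>h. h \<in> H \<Longrightarrow> br h e = \<alpha> h *s e"
    using root_vector_exists[OF \<alpha>(1)] by blast
  obtain y where y: "y \<in> G (\<lambda>h. - \<alpha> h)" "\<kappa> e y \<noteq> 0" using dual_vector[OF e(1,2)] by blast
  let ?t = "br e y" let ?n = "\<lambda>h. - \<alpha> h"
  note t = coroot_direction[OF \<alpha> e(1,3) y]
  have "y \<noteq> 0" using y(2) by auto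
  then show n: "?n \<in> \<Lambda>" using y(1) \<alpha>(1) by (auto simp: ad.wts_def)
  define K where "K = {\<nu> \<in> \<Lambda>. \<exists>k::nat. \<forall>h\<in>H. \<nu> h = - (of_nat k * \<alpha> h)}"
  define U where "U \<nu> = (if \<nu> = \<alpha> then vec.span {e} else G \<nu>)" for \<nu>
  have KL: "K \<subseteq> \<Lambda>" by (auto simp: K_def)
  have fin: "finite K" using KL ad.finite_wts finite_subset by blast
  have aK: "\<alpha> \<notin> K"
  proof
    assume "\<alpha> \<in> K"
    then obtain k :: nat where "\<alpha> h0 = - (of_nat k * \<alpha> h0)" using \<alpha>(2) by (auto simp: K_def)
    then have "\<alpha> h0 + of_nat k * \<alpha> h0 = 0" by (metis add.left_inverse)
    then have "of_nat (Suc k) * \<alpha> h0 = 0" by (simp add: algebra_simps)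
    then show False using \<alpha>(3) by (simp del: of_nat_Suc)
  qed
  have ind: "indep_fam (insert \<alpha> K) U"
  proof (rule indep_fam_subset[OF indep_G])
    show "insert \<alpha> K \<subseteq> \<Lambda>" using KL \<alpha> by blast
    have "vec.span {e} \<subseteq> G \<alpha>" using e by (intro vec.span_minimal ad.subspace_gws) auto
    then show "U i \<subseteq> G i \<and> vec.subspace (U i)" for i
      by (auto simp: U_def ad.subspace_gws)
  qed
  let ?S = "sumsp (insert \<alpha> K) U"
  have mem: "u \<in> ?S" if u: "u \<in> G f" and f: "\<forall>h\<in>H. f h = - (of_nat k * \<alpha> h)" for u f k
    using G_trivial_or_wt[of f]
  proof
    assume "G f = {0}"
    then show ?thesis using u vec.subspace_0[OF subspace_sumsp[OF ind]] by simp
  next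
    assume "\<exists>g\<in>\<Lambda>. (\<forall>h\<in>H. g h = f h) \<and> G g = G f"
    then obtain g where g: "g \<in> \<Lambda>" "\<forall>h\<in>H. g h = f h" "G g = G f" by blast
    then have gK: "g \<in> K" using f by (auto simp: K_def)
    then have "U g = G f" using aK g by (auto simp: U_def)
    then show ?thesis using sumsp_incl[OF ind, of g] gK u by blast
  qed
  have eS: "c *s e \<in> ?S" for c
  proof -
    have "c *s e \<in> U \<alpha>" by (simp add: U_def vec.span_base vec.span_scale)
    then show ?thesis using sumsp_incl[OF ind, of \<alpha>] by blast
  qed
  have cases: "(\<exists>c. u = c *s e) \<or> (u \<in> G i \<and> (\<exists>k::nat. \<forall>h\<in>H. i h = - (of_nat k * \<alpha> h)))"
    if "i \<in> insert \<alpha> K" "u \<in> U i" for i u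
    using that by (auto simp: U_def K_def vec.span_singleton split: if_splits)
  have st_e: "br e ` ?S \<subseteq> ?S"
  proof (rule sumsp_stable[OF lin_br2 ind])
    fix i u assume "i \<in> insert \<alpha> K" "u \<in> U i"
    from cases[OF this] show "br e u \<in> ?S"
    proof (elim disjE exE conjE)
      fix c assume "u = c *s e"
      then show ?thesis using eS[of 0] by (simp add: br_scale2)
    next
      fix k :: nat assume u: "u \<in> G i" and k: "\<forall>h\<in>H. i h = - (of_nat k * \<alpha> h)"
      show ?thesis
      proof (cases k)
        case 0
        then have "u \<in> H" using u k G_zero ad.gws_cong[of i "\<lambda>_. 0"] by auto
        then show ?thesis using e(3) br_anti[of e u] eS[of "- \<alpha> u"] by simp
      next
        case (Suc j)
        show ?thesis by (rule mem[OF G_br[OF e(1) u], of j]) (simp add: k Suc algebra_simps)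
      qed
    qed
  qed
  have st_y: "br y ` ?S \<subseteq> ?S"
  proof (rule sumsp_stable[OF lin_br2 ind])
    fix i u assume "i \<in> insert \<alpha> K" "u \<in> U i"
    from cases[OF this] show "br y u \<in> ?S"
    proof (elim disjE exE conjE)
      fix c assume "u = c *s e"
      then have "br y u = - c *s ?t" using br_anti[of y e] by (simp add: br_scale2)
      also have "\<dots> \<in> G (\<lambda>_. 0)" unfolding G_zero by (rule vec.subspace_scale[OF subspace_H t(1)])
      finally show ?thesis by (rule mem[of _ _ 0]) simp
    next
      fix k :: nat assume u: "u \<in> G i" and k: "\<forall>h\<in>H. i h = - (of_nat k * \<alpha> h)"
      show ?thesis by (rule mem[OF G_br[OF y(1) u], of "Suc k"]) (simp add: k algebra_simps)
    qed
  qed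
  have "(\<Sum>i\<in>insert \<alpha> K. i ?t * of_nat (vec.dim (U i))) = 0"
  proof (rule commutator_weights[OF ind lin_br2 st_e lin_br2 st_y lin_br2[of ?t]])
    show "br ?t v = br e (br y v) - br y (br e v)" for v using jacobi[of e y v] by simp
    fix i assume i: "i \<in> insert \<alpha> K"
    show "br ?t ` U i \<subseteq> U i"
    proof (cases "i = \<alpha>")
      case True
      have "br ?t (c *s e) = (c * \<alpha> ?t) *s e" for c by (simp add: br_scale2 e(3)[OF t(1)])
      then show ?thesis by (auto simp: U_def True vec.span_singleton)
    next
      case False then show ?thesis using ad.gws_stable t(1) by (auto simp: U_def)
    qed
    fix u assume "u \<in> U i"
    moreover have "vec.span {e} \<subseteq> G \<alpha>" using e by (intro vec.span_minimal ad.subspace_gws) auto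
    ultimately have "u \<in> G i" by (auto simp: U_def split: if_splits)
    then show "evnil (shift (br ?t) (i ?t)) u" using t(1) by (simp add: ad.gws_def)
  qed
  moreover have "vec.dim (U \<alpha>) = 1" using e(2) by (simp add: U_def)
  moreover have "vec.dim (U i) = d i" if "i \<in> K" for i using that aK by (auto simp: U_def d_def)
  \<comment> \<open>The line through e contributes \<alpha>(t), and each space of weight -k \<alpha>
    contributes -k \<alpha>(t) d. So the sum of all k d is 1: besides k = 0 only k = 1 occurs, with
    dimension 1.\<close>
  ultimately have "\<alpha> ?t + (\<Sum>i\<in>K. i ?t * of_nat (d i)) = 0"
    using fin aK by (simp cong: sum.cong)
  moreover have "\<exists>k. \<forall>\<nu>\<in>K. \<forall>h\<in>H. \<nu> h = - (of_nat (k \<nu> :: nat) * \<alpha> h)"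
    by (rule bchoice) (auto simp: K_def)
  then obtain k where k: "\<And>\<nu> h. \<nu> \<in> K \<Longrightarrow> h \<in> H \<Longrightarrow> \<nu> h = - (of_nat (k \<nu> :: nat) * \<alpha> h)" by blast
  moreover have "(\<Sum>i\<in>K. i ?t * of_nat (d i)) = - \<alpha> ?t * of_nat (\<Sum>i\<in>K. k i * d i)"
    unfolding of_nat_sum sum_distrib_left by (rule sum.cong) (auto simp: k[OF _ t(1)])
  ultimately have "\<alpha> ?t * (1 - of_nat (\<Sum>i\<in>K. k i * d i)) = 0" by (simp add: algebra_simps)
  then have "of_nat (\<Sum>i\<in>K. k i * d i) = (1::complex)" using t(3) by simp
  then have s1: "(\<Sum>i\<in>K. k i * d i) = 1" using of_nat_eq_1_iff by blast
  have le1: "k i * d i \<le> 1" if "i \<in> K" for i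
    using member_le_sum[OF that, of "\<lambda>i. k i * d i"] fin s1 by simp
  have nK: "?n \<in> K" using n by (auto simp: K_def intro!: exI[of _ 1])
  have "- \<alpha> ?t = - (of_nat (k ?n) * \<alpha> ?t)" by (rule k[OF nK t(1)])
  then have "(of_nat (k ?n) :: complex) = 1" using t(3) by simp
  then have "k ?n = 1" using of_nat_eq_1_iff by blast
  then show "d ?n = 1" using le1[OF nK] d_pos[OF n] by simp
  fix j :: nat and \<nu> assume j: "2 \<le> j" and \<nu>: "\<nu> \<in> \<Lambda>"
  show "\<not> (\<forall>h\<in>H. \<nu> h = - (of_nat j * \<alpha> h))"
  proof
    assume a: "\<forall>h\<in>H. \<nu> h = - (of_nat j * \<alpha> h)"
    then have \<nu>K: "\<nu> \<in> K" using \<nu> by (auto simp: K_def)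
    have "of_nat j * \<alpha> ?t = of_nat (k \<nu>) * \<alpha> ?t" using a k[OF \<nu>K t(1)] t(1) by simp
    then have "j = k \<nu>" using t(3) by simp
    then have "2 * 1 \<le> k \<nu> * d \<nu>" using j d_pos[OF \<nu>] by (intro mult_le_mono) auto
    then show False using le1[OF \<nu>K] by simp
  qed
qed

lemma root_space_subset_G: "root_space br H \<alpha> \<subseteq> G \<alpha>"
  by (auto simp: root_space_def ad.gws_def intro: evnil_shift_eigen)

text \<open>\<open>root_string\<close>, applied to the negative of \<alpha>, yields the dimension
  and the multiples; a one-dimensional \<open>G \<alpha>\<close> is then spanned by the true
  eigenvector in it.\<close>

lemma nonzero_wt_root:
  assumes \<alpha>: "\<alpha> \<in> \<Lambda>" "h0 \<in> H" "\<alpha> h0 \<noteq> 0"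
  shows "d \<alpha> = 1" "root_space br H \<alpha> = G \<alpha>"
    "\<And>k \<nu>. 2 \<le> k \<Longrightarrow> \<nu> \<in> \<Lambda> \<Longrightarrow> \<not> (\<forall>h\<in>H. \<nu> h = of_nat k * \<alpha> h)"
proof -
  note n = root_string(1)[OF \<alpha>]
  have n0: "- \<alpha> h0 \<noteq> 0" using \<alpha> by simp
  show d1: "d \<alpha> = 1" using root_string(2)[OF n \<alpha>(2) n0] by simp
  show "\<And>k \<nu>. 2 \<le> k \<Longrightarrow> \<nu> \<in> \<Lambda> \<Longrightarrow> \<not> (\<forall>h\<in>H. \<nu> h = of_nat k * \<alpha> h)"
    using root_string(3)[OF n \<alpha>(2) n0] by simp
  obtain e where e: "e \<in> G \<alpha>" "e \<noteq> 0" "\<And>h. h \<in> H \<Longrightarrow> br h e = \<alpha> h *s e"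
    using root_vector_exists[OF \<alpha>(1)] by blast
  have sub: "vec.span {e} \<subseteq> G \<alpha>" using e by (intro vec.span_minimal ad.subspace_gws) auto
  have "vec.span {e} = G \<alpha>"
    using vec.subspace_dim_equal[OF vec.subspace_span ad.subspace_gws sub] d1 e(2) by (simp add: d_def)
  moreover have "vec.span {e} \<subseteq> root_space br H \<alpha>"
    by (auto simp: vec.span_singleton root_space_def br_scale2 e(3) mult.commute)
  ultimately show "root_space br H \<alpha> = G \<alpha>" using root_space_subset_G by blast
qed

lemma roots_eq: "roots br H = {\<alpha> \<in> \<Lambda>. \<exists>h\<in>H. \<alpha> h \<noteq> 0}"
proof (intro set_eqI iffI)
  fix \<alpha> assume a: "\<alpha> \<in> roots br H"
  have "0 \<in> root_space br H \<alpha>" by (simp add: root_space_def)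
  then have "G \<alpha> \<noteq> {0}" using a root_space_subset_G[of \<alpha>] unfolding roots_def by blast
  then show "\<alpha> \<in> {\<alpha> \<in> \<Lambda>. \<exists>h\<in>H. \<alpha> h \<noteq> 0}" using a by (auto simp: roots_def hfun_def ad.wts_def)
next
  fix \<alpha> assume a: "\<alpha> \<in> {\<alpha> \<in> \<Lambda>. \<exists>h\<in>H. \<alpha> h \<noteq> 0}"
  then obtain h where h: "h \<in> H" "\<alpha> h \<noteq> 0" by blast
  then show "\<alpha> \<in> roots br H" using a nonzero_wt_root(2)[of \<alpha> h]
    by (auto simp: roots_def hfun_def ad.wts_def)
qed

lemma finite_roots: "finite (roots br H)"
  unfolding roots_eq using ad.finite_wts by simp

lemma root_space_zero: "root_space br H (\<lambda>_. 0) = H"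
  using root_space_subset_G[of "\<lambda>_. 0"] G_zero H_abelian by (auto simp: root_space_def)

lemma root_wt: "\<alpha> \<in> roots br H \<Longrightarrow> \<alpha> \<in> \<Lambda>"
  by (simp add: roots_eq)

lemma root_nonzero: "\<alpha> \<in> roots br H \<Longrightarrow> \<exists>h\<in>H. \<alpha> h \<noteq> 0"
  by (simp add: roots_eq)

lemma root_neg: "\<alpha> \<in> roots br H \<Longrightarrow> (\<lambda>t. - \<alpha> t) \<in> roots br H"
  using root_string(1) by (auto simp: roots_eq)

lemma root_multiple:
  "\<alpha> \<in> roots br H \<Longrightarrow> \<nu> \<in> roots br H \<Longrightarrow> 2 \<le> k \<Longrightarrow> \<not> (\<forall>h\<in>H. \<nu> h = of_nat k * \<alpha> h)"
  using nonzero_wt_root(3) by (auto simp: roots_eq)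

lemma root_space_eq_G: "\<alpha> \<in> roots br H \<Longrightarrow> root_space br H \<alpha> = G \<alpha>"
  using nonzero_wt_root(2) by (auto simp: roots_eq)

lemma root_decomposition: "vec.span (H \<union> (\<Union>\<alpha>\<in>roots br H. root_space br H \<alpha>)) = UNIV"
proof -
  have "G f \<subseteq> H \<union> (\<Union>\<alpha>\<in>roots br H. root_space br H \<alpha>)" if f: "f \<in> \<Lambda>" for f
  proof (cases "f \<in> roots br H")
    case True then show ?thesis using root_space_eq_G by blast
  next
    case False
    then have "G f = H" using f G_zero ad.gws_cong[of f "\<lambda>_. 0"] by (auto simp: roots_eq)
    then show ?thesis by blast
  qed
  then have "vec.span (\<Union>f\<in>\<Lambda>. G f) \<subseteq> vec.span (H \<union> (\<Union>\<alpha>\<in>roots br H. root_space br H \<alpha>))"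
    by (intro vec.span_mono) blast
  then show ?thesis using ad.wts_span by blast
qed

lemma roots_separate_H:
  assumes "h \<in> H" "\<And>\<alpha>. \<alpha> \<in> roots br H \<Longrightarrow> \<alpha> h = 0" shows "h = 0"
  using wts_separate_H[OF assms(1)] assms by (auto simp: roots_eq)

text \<open>f is scaled so that \<alpha>([e, f]) = 2. The two root spaces are lines, so their
  brackets span the line of [e, f], and the definite description in \<open>coroot\<close> picks out
  [e, f].\<close>

lemma sl2_triple:
  assumes \<alpha>: "\<alpha> \<in> roots br H"
  shows "\<exists>e f. e \<noteq> 0 \<and> f \<noteq> 0 \<and> root_space br H \<alpha> = vec.span {e} \<and> root_space br H (\<lambda>t. - \<alpha> t) = vec.span {f}
     \<and> br e f = coroot br H \<alpha>"
    and "coroot br H \<alpha> \<in> H" "\<alpha> (coroot br H \<alpha>) = 2"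
    and "\<exists>c. \<forall>h\<in>H. \<kappa> (coroot br H \<alpha>) h = c * \<alpha> h"
proof -
  obtain h0 where h0: "h0 \<in> H" "\<alpha> h0 \<noteq> 0" using root_nonzero[OF \<alpha>] by blast
  note aL = root_wt[OF \<alpha>]
  obtain e where e: "e \<in> G \<alpha>" "e \<noteq> 0" "\<And>h. h \<in> H \<Longrightarrow> br h e = \<alpha> h *s e"
    using root_vector_exists[OF aL] by blast
  obtain y where y: "y \<in> G (\<lambda>h. - \<alpha> h)" "\<kappa> e y \<noteq> 0" using dual_vector[OF e(1,2)] by blast
  note t = coroot_direction[OF aL h0 e(1,3) y]
  have span1: "vec.span {x} = G \<beta>" if "\<beta> \<in> roots br H" "x \<in> G \<beta>" "x \<noteq> 0" for x \<beta>
  proof -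
    have "d \<beta> = 1" using nonzero_wt_root(1) that(1) by (auto simp: roots_eq)
    moreover have "vec.span {x} \<subseteq> G \<beta>" using that by (intro vec.span_minimal ad.subspace_gws) auto
    ultimately show ?thesis
      using vec.subspace_dim_equal[OF vec.subspace_span ad.subspace_gws] that(3) by (simp add: d_def)
  qed
  define f where "f = (2 / \<alpha> (br e y)) *s y"
  have f0: "f \<noteq> 0" using t(3) y(2) by (auto simp: f_def)
  have fG: "f \<in> G (\<lambda>h. - \<alpha> h)" using y(1) by (simp add: f_def vec.subspace_scale ad.subspace_gws)
  have re: "root_space br H \<alpha> = vec.span {e}" using span1[OF \<alpha> e(1,2)] root_space_eq_G[OF \<alpha>] by simp
  have rf: "root_space br H (\<lambda>t. - \<alpha> t) = vec.span {f}"
    using span1[OF root_neg[OF \<alpha>] fG f0] root_space_eq_G[OF root_neg[OF \<alpha>]] by simp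
  have bef: "br e f = (2 / \<alpha> (br e y)) *s br e y" by (simp add: f_def br_scale2)
  have hH: "br e f \<in> H" unfolding bef using t(1) by (simp add: vec.subspace_scale[OF subspace_H])
  have a2: "\<alpha> (br e f) = 2" unfolding bef using t(1,3) by (simp add: wt_scale[OF aL])
  let ?X = "{br x y |x y. x \<in> root_space br H \<alpha> \<and> y \<in> root_space br H (\<lambda>t. - \<alpha> t)}"
  have "?X \<subseteq> vec.span {br e f}"
    unfolding re rf by (auto simp: vec.span_singleton br_scale1 br_scale2)
  then have X: "vec.span ?X \<subseteq> vec.span {br e f}" by (intro vec.span_minimal vec.subspace_span)
  have "br e f \<in> ?X" unfolding re rf using vec.span_base[of e "{e}"] vec.span_base[of f "{f}"] by blast
  then have in_X: "br e f \<in> vec.span ?X" by (rule vec.span_base)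
  have cr: "coroot br H \<alpha> = br e f"
    unfolding coroot_def
  proof (rule the_equality)
    fix h assume h: "h \<in> H \<and> h \<in> vec.span ?X \<and> \<alpha> h = 2"
    then obtain c where c: "h = c *s br e f" using X by (auto simp: vec.span_singleton)
    then have "c * 2 = 2" using h wt_scale[OF aL hH, of c] a2 by simp
    then show "h = br e f" using c by simp
  qed (use hH in_X a2 in blast)
  show "coroot br H \<alpha> \<in> H" "\<alpha> (coroot br H \<alpha>) = 2" unfolding cr by (fact hH a2)+
  show "\<exists>e f. e \<noteq> 0 \<and> f \<noteq> 0 \<and> root_space br H \<alpha> = vec.span {e} \<and> root_space br H (\<lambda>t. - \<alpha> t) = vec.span {f}
     \<and> br e f = coroot br H \<alpha>"
    using e(2) f0 re rf cr by metis
  have "\<forall>h\<in>H. \<kappa> (br e f) h = (2 / \<alpha> (br e y) * \<kappa> e y) * \<alpha> h"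
    unfolding bef using t(2) by (simp add: \<kappa>_scale1)
  then show "\<exists>c. \<forall>h\<in>H. \<kappa> (coroot br H \<alpha>) h = c * \<alpha> h" unfolding cr by blast
qed

end

section \<open>Representations\<close>

lemma mat_scalar_vec: "mat c *v (v :: complex^'d) = c *s v"
proof -
  have "(\<Sum>j\<in>UNIV. (if i = j then c else 0) * v $ j) = c * v $ i" for i
    by (simp add: if_distrib[of "\<lambda>x. x * _"] cong: if_cong)
  then show ?thesis by (simp add: vec_eq_iff matrix_vector_mult_def mat_def)
qed

lemma lin_injI:
  assumes T: "lin T" and "\<And>v. T v = 0 \<Longrightarrow> v = 0" shows "inj T"
proof (rule injI)
  fix x y assume "T x = T y"
  then have "T (x - y) = 0" by (simp add: vec.linear_diff[OF T])
  then show "x = y" using assms(2) by fastforce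
qed

locale lie_rep_on = simple_lie br for br :: "complex^'n \<Rightarrow> complex^'n \<Rightarrow> complex^'n" +
  fixes \<phi> :: "complex^'n \<Rightarrow> complex^'d^'d"
  assumes rep: "lie_rep br \<phi>"
begin

abbreviation "act x \<equiv> (*v) (\<phi> x)"

lemma lin_act: "lin (act x)"
  by (rule matrix_vector_mul_linear_gen)

lemma lin_act1: "lin (\<lambda>x. act x v)"
  using rep by (intro linI) (auto simp: lie_rep_def matrix_vector_mult_add_rdistrib
      matrix_vector_mul_assoc[symmetric] mat_scalar_vec)

lemmas act_add1 = vec.linear_add[OF lin_act1] and act_scale1 = vec.linear_scale[OF lin_act1]
  and act_01 = vec.linear_0[OF lin_act1] and act_neg1 = vec.linear_neg[OF lin_act1]
  and act_add2 = vec.linear_add[OF lin_act] and act_scale2 = vec.linear_scale[OF lin_act]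
  and act_diff2 = vec.linear_diff[OF lin_act] and act_02 = vec.linear_0[OF lin_act]

lemma act_br: "act (br x y) v = act x (act y v) - act y (act x v)"
  using rep by (simp add: lie_rep_def matrix_vector_mult_diff_rdistrib matrix_vector_mul_assoc)

lemma leibniz_act: "leibniz (\<lambda>L v. act L v) (br x) (act x) (act x)"
  by (rule leibniz.intro) (rule lin_act1 lin_act lin_br2, simp add: act_br)+

text \<open>Conjugation by \<open>exp (\<phi> x)\<close> realizes \<open>exp (ad x)\<close>.\<close>

lemma exp_intertwiner:
  assumes x: "ad_nilpotent br x" and nil: "\<And>v. evnil (act x) v"
  defines "N \<equiv> CARD('n) + CARD('d)"
  shows "truncexp N (act x) (act L v) = act (exp_ad br x L) (truncexp N (act x) v)"
    and "exp_ad br x L = truncexp N (br x) L"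
proof -
  have b: "(br x ^^ CARD('n)) y = 0" for y
    using x by (intro funpow_bound lin_br2) (auto simp: ad_nilpotent_def evnil_def)
  have a: "(act x ^^ CARD('d)) v = 0" for v by (rule funpow_bound[OF lin_act nil])
  have bN: "(br x ^^ N) y = 0" for y using funpow_zero_mono[OF lin_br2 b] by (simp add: N_def)
  have aN: "(act x ^^ N) v = 0" for v using funpow_zero_mono[OF lin_act a] by (simp add: N_def)
  have e: "exp_ad br x L = truncexp N (br x) L" for L
    using truncexp_extend[OF lin_br2 b, of N] by (simp add: exp_ad_def truncexp_def N_def)
  show "exp_ad br x L = truncexp N (br x) L" by (rule e)
  show "truncexp N (act x) (act L v) = act (exp_ad br x L) (truncexp N (act x) v)"
    unfolding e by (rule leibniz.truncexp_hom[OF leibniz_act bN aN aN])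
qed

lemma exp_conjugates:
  assumes x: "ad_nilpotent br x" and nil: "\<And>v. evnil (act x) v"
  shows "\<exists>M. invertible M \<and> (\<forall>L. M ** \<phi> L = \<phi> (exp_ad br x L) ** M)"
proof -
  let ?N = "CARD('n) + CARD('d)"
  let ?E = "truncexp ?N (act x)"
  have lE: "lin ?E" by (rule lin_truncexp[OF lin_act])
  have M: "matrix ?E *v v = ?E v" for v by (rule matrix_works[OF lE])
  have "inj ((*v) (matrix ?E))"
    unfolding M by (rule lin_injI[OF lE]) (rule truncexp_inj[OF lin_act nil])
  then have "\<exists>B. B ** matrix ?E = mat 1" using matrix_left_invertible_injective by blast
  then have "invertible (matrix ?E)" by (simp add: invertible_left_inverse)
  moreover have "matrix ?E ** \<phi> L = \<phi> (exp_ad br x L) ** matrix ?E" for L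
    using exp_intertwiner(1)[OF x nil] by (subst matrix_eq) (simp add: M matrix_vector_mul_assoc[symmetric])
  ultimately show ?thesis by blast
qed

text \<open>exp (\<open>\<phi>\<close> x) conjugates one matrix into the other. Nilpotency of
  \<open>\<phi>\<close> x is a separate assumption, supplied for root vectors by
  \<open>root_vector_nilpotent\<close>.\<close>

lemma det_exp_ad:
  assumes "ad_nilpotent br x" "\<And>v. evnil (act x) v"
  shows "det (mat z + \<phi> (exp_ad br x L)) = det (mat z + \<phi> L)"
proof -
  obtain M where M: "invertible M" "M ** \<phi> L = \<phi> (exp_ad br x L) ** M"
    using exp_conjugates[OF assms] by blast
  have "M *v (act L v) = act (exp_ad br x L) (M *v v)" for v
    by (simp add: matrix_vector_mul_assoc M(2))
  then have "M ** (mat z + \<phi> L) = (mat z + \<phi> (exp_ad br x L)) ** M"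
    by (subst matrix_eq) (simp add: matrix_vector_mul_assoc[symmetric] matrix_vector_mult_add_rdistrib
       mat_scalar_vec vec.linear_add[OF matrix_vector_mul_linear_gen] vec.linear_scale[OF matrix_vector_mul_linear_gen])
  then have "det M * det (mat z + \<phi> L) = det (mat z + \<phi> (exp_ad br x L)) * det M"
    by (metis det_mul)
  moreover have "det M \<noteq> 0" using M(1) by (simp add: invertible_det_nz)
  ultimately show ?thesis by simp
qed

lemma trace_power_exp_ad:
  assumes "ad_nilpotent br x" "\<And>v. evnil (act x) v"
  shows "ftr (act (exp_ad br x L) ^^ k) = ftr (act L ^^ k)"
proof -
  obtain M where M: "invertible M" "M ** \<phi> L = \<phi> (exp_ad br x L) ** M"
    using exp_conjugates[OF assms] by blast
  obtain M' where M': "M ** M' = mat 1" "M' ** M = mat 1" using M(1) by (auto simp: invertible_def)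
  have c: "M *v (act L v) = act (exp_ad br x L) (M *v v)" for v
    by (simp add: matrix_vector_mul_assoc M(2))
  have p: "M *v ((act L ^^ k) v) = (act (exp_ad br x L) ^^ k) (M *v v)" for v
    by (induction k) (simp_all add: c)
  have i: "M *v (M' *v v) = v" "M' *v (M *v v) = v" for v by (simp_all add: matrix_vector_mul_assoc M')
  have "ftr (act (exp_ad br x L) ^^ k) = ftr (\<lambda>v. M *v ((act L ^^ k) (M' *v v)))"
    unfolding p i by simp
  also have "\<dots> = ftr (\<lambda>v. (act L ^^ k) (M' *v (M *v v)))"
    by (rule ftr_commute[OF matrix_vector_mul_linear_gen lin_comp[OF lin_funpow[OF lin_act] matrix_vector_mul_linear_gen]])
  finally show ?thesis by (simp add: i)
qed

end

section \<open>The adjoint representation as a matrix representation\<close>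

context simple_lie begin

definition adm :: "complex^'n \<Rightarrow> complex^'n^'n" where
  "adm x = matrix (br x)"

lemma adm_mult [simp]: "adm x *v v = br x v"
  unfolding adm_def by (rule matrix_works[OF lin_br2])

lemma adm_fun [simp]: "(*v) (adm x) = br x"
  by (rule ext) simp

lemma adm_rep: "lie_rep br adm"
  unfolding lie_rep_def
proof (intro conjI allI)
  fix x y c
  show "adm (x + y) = adm x + adm y"
    by (subst matrix_eq) (simp add: matrix_vector_mult_add_rdistrib br_add1)
  show "adm (c *s x) = mat c ** adm x"
    by (subst matrix_eq) (simp add: matrix_vector_mul_assoc[symmetric] mat_scalar_vec br_scale1)
  show "adm (br x y) = adm x ** adm y - adm y ** adm x"
    using jacobi[of x y]
    by (subst matrix_eq) (simp add: matrix_vector_mul_assoc[symmetric] matrix_vector_mult_diff_rdistrib)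
qed

sublocale adj: lie_rep_on br adm
  by unfold_locales (rule adm_rep)

end

text \<open>The spanning assumption says that H acts diagonalizably. It covers the adjoint
  representation as well as the irreducible ones, so facts about weights also serve for
  roots.\<close>

locale weight_rep = cartan br H + lie_rep_on br \<phi>
  for br :: "complex^'n \<Rightarrow> complex^'n \<Rightarrow> complex^'n" and H and \<phi> :: "complex^'n \<Rightarrow> complex^'d^'d" +
  assumes wspan: "vec.span (\<Union>\<nu>\<in>rep_weights H \<phi>. weight_space H \<phi> \<nu>) = UNIV"
begin

abbreviation "ws \<equiv> weight_space H \<phi>"
abbreviation "W \<equiv> rep_weights H \<phi>"

lemma subspace_ws: "vec.subspace (ws \<nu>)"
  by (intro vec.subspaceI) (auto simp: weight_space_def act_02 act_add2 act_scale2 vec.scale_right_distrib mult.commute)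

lemma act_H: "h \<in> H \<Longrightarrow> h' \<in> H \<Longrightarrow> act h (act h' v) = act h' (act h v)"
  using act_br[of h h' v] H_abelian[of h h'] by (simp add: act_01)

sublocale rw: gws_family act H
proof (rule gws_family.intro, goal_cases)
  case (1 h)
  show ?case by (rule lin_act)
next
  case (2 h h' a v)
  have "shift (act h) a (act h' v) = act h' (shift (act h) a v)" for v
    using act_H[OF 2(1,2)] by (simp add: shift_def act_diff2 act_scale2)
  then have "(shift (act h) a ^^ k) (act h' v) = act h' ((shift (act h) a ^^ k) v)" for k v
    by (induction k) simp_all
  then show ?case using 2(3) unfolding evnil_def by (metis act_02)
qed

lemma ws_gws: "ws \<nu> \<subseteq> rw.gws \<nu>"
  by (auto simp: weight_space_def rw.gws_def intro: evnil_shift_eigen)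

lemma W_wts: "W \<subseteq> rw.wts"
proof
  fix \<nu> assume \<nu>: "\<nu> \<in> W"
  then have "ws \<nu> \<noteq> {0}" by (simp add: rep_weights_def)
  moreover have "0 \<in> ws \<nu>" using subspace_ws by (rule vec.subspace_0)
  ultimately have "rw.gws \<nu> \<noteq> {0}" using ws_gws[of \<nu>] by blast
  then show "\<nu> \<in> rw.wts" using \<nu> by (simp add: rw.wts_def rep_weights_def hfun_def)
qed

lemma finite_W: "finite W"
  using W_wts rw.finite_wts finite_subset by blast

lemma indep_ws: "indep_fam W ws"
  unfolding indep_fam_def
proof (intro conjI allI impI ballI finite_W subspace_ws)
  fix v \<nu> assume v: "\<forall>i\<in>W. v i \<in> ws i" "(\<Sum>i\<in>W. v i) = 0" and \<nu>: "\<nu> \<in> W"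
  show "v \<nu> = 0"
  proof (rule rw.gws_indep[OF finite_W _ _ v(2) \<nu>])
    show "g x = 0" if "g \<in> W" "x \<notin> H" for g x using that by (simp add: rep_weights_def hfun_def)
    show "v g \<in> rw.gws g" if "g \<in> W" for g using v(1) ws_gws that by blast
  qed
qed

lemma ws_vector: "\<nu> \<in> W \<Longrightarrow> \<exists>v\<in>ws \<nu>. v \<noteq> 0"
  using vec.subspace_0[OF subspace_ws] by (auto simp: rep_weights_def)

lemma W_add: "\<nu> \<in> W \<Longrightarrow> x \<in> H \<Longrightarrow> y \<in> H \<Longrightarrow> \<nu> (x + y) = \<nu> x + \<nu> y"
  and W_scale: "\<nu> \<in> W \<Longrightarrow> x \<in> H \<Longrightarrow> \<nu> (c *s x) = c * \<nu> x"
proof -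
  assume \<nu>: "\<nu> \<in> W" and x: "x \<in> H"
  obtain v where v: "v \<in> ws \<nu>" "v \<noteq> 0" using ws_vector[OF \<nu>] by blast
  have a: "act h v = \<nu> h *s v" if "h \<in> H" for h using v(1) that by (simp add: weight_space_def)
  have "\<nu> (c *s x) *s v = act (c *s x) v" using x by (simp add: a vec.subspace_scale[OF subspace_H])
  also have "\<dots> = (c * \<nu> x) *s v" by (simp add: act_scale1 a[OF x])
  finally have "\<nu> (c *s x) *s v = (c * \<nu> x) *s v" .
  then show "\<nu> (c *s x) = c * \<nu> x" using v(2) by (metis vec.scale_cancel_right)
  assume y: "y \<in> H"
  have "\<nu> (x + y) *s v = (\<nu> x + \<nu> y) *s v"
    using a[of "x + y"] a[OF x] a[OF y] x y by (simp add: vec.subspace_add[OF subspace_H] act_add1 vec.scale_left_distrib)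
  then show "\<nu> (x + y) = \<nu> x + \<nu> y" using v(2) by (metis vec.scale_cancel_right)
qed

lemma act_root:
  assumes "x \<in> root_space br H \<alpha>" "v \<in> ws \<nu>" shows "act x v \<in> ws (\<lambda>h. \<nu> h + \<alpha> h)"
  unfolding weight_space_def
proof (rule CollectI, rule ballI)
  fix h assume h: "h \<in> H"
  have "act h (act x v) = act (br h x) v + act x (act h v)" by (simp add: act_br)
  also have "\<dots> = (\<nu> h + \<alpha> h) *s act x v"
    using assms h by (simp add: root_space_def weight_space_def act_scale1 act_scale2 vec.scale_left_distrib add.commute)
  finally show "act h (act x v) = (\<nu> h + \<alpha> h) *s act x v" .
qed

lemma act_root_funpow:
  assumes "x \<in> root_space br H \<alpha>" "v \<in> ws \<nu>" shows "(act x ^^ k) v \<in> ws (\<lambda>h. \<nu> h + of_nat k * \<alpha> h)"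
proof (induction k)
  case (Suc k)
  have "(\<lambda>h. \<nu> h + of_nat k * \<alpha> h + \<alpha> h) = (\<lambda>h. \<nu> h + of_nat (Suc k) * \<alpha> h)" by (auto simp: algebra_simps)
  then show ?case using act_root[OF assms(1) Suc] by simp
qed (use assms in simp)

text \<open>Each application of x adds \<alpha> to the weight; the weights \<nu> + k \<alpha> differ
  at h0, and there are only finitely many weights.\<close>

lemma root_vector_nilpotent:
  assumes x: "x \<in> root_space br H \<alpha>" and \<alpha>: "h0 \<in> H" "\<alpha> h0 \<noteq> 0"
  shows "evnil (act x) v"
proof -
  have "evnil (act x) v" if v: "v \<in> ws \<nu>" for v \<nu>
  proof (rule ccontr)
    assume "\<not> ?thesis"
    then have nz: "(act x ^^ k) v \<noteq> 0" for k by (auto simp: evnil_def)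
    define g where "g k h = (if h \<in> H then \<nu> h + of_nat k * \<alpha> h else 0)" for k :: nat and h
    have "ws (g k) = ws (\<lambda>h. \<nu> h + of_nat k * \<alpha> h)" for k by (auto simp: weight_space_def g_def)
    then have "(act x ^^ k) v \<in> ws (g k)" for k using act_root_funpow[OF x v, of k] by simp
    then have "g k \<in> W" for k using nz by (auto simp: rep_weights_def hfun_def g_def)
    then have "range g \<subseteq> W" by blast
    moreover have "inj g"
    proof (rule injI)
      fix i j assume "g i = g j"
      then have "g i h0 = g j h0" by simp
      then show "i = j" using \<alpha> by (simp add: g_def)
    qed
    ultimately show False using finite_W range_inj_infinite finite_subset by blast
  qed
  then have "(\<Union>\<nu>\<in>W. ws \<nu>) \<subseteq> {v. evnil (act x) v}" by blast
  then have "vec.span (\<Union>\<nu>\<in>W. ws \<nu>) \<subseteq> {v. evnil (act x) v}"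
    by (rule vec.span_minimal) (rule subspace_evnil[OF lin_act])
  then show ?thesis using wspan by blast
qed

end

context cartan begin

lemma H_adm_weight: "weight_space H adm \<nu> = root_space br H \<nu>"
  by (simp add: weight_space_def root_space_def)

lemma adm_weights: "rep_weights H adm \<subseteq> insert (\<lambda>_. 0) (roots br H)"
  by (auto simp: rep_weights_def H_adm_weight roots_def hfun_def fun_eq_iff)

lemma roots_adm_weights: "roots br H \<subseteq> rep_weights H adm"
  by (auto simp: rep_weights_def H_adm_weight roots_def)

sublocale adjw: weight_rep br H adm
proof (unfold_locales, goal_cases)
  case 1
  have "H \<subseteq> vec.span (\<Union>\<nu>\<in>rep_weights H adm. weight_space H adm \<nu>)"
  proof
    fix h assume h: "h \<in> H"
    show "h \<in> vec.span (\<Union>\<nu>\<in>rep_weights H adm. weight_space H adm \<nu>)"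
    proof (cases "h = 0")
      case True then show ?thesis by (simp add: vec.span_zero)
    next
      case False
      then have "(\<lambda>_. 0) \<in> rep_weights H adm"
        using h root_space_zero by (auto simp: rep_weights_def hfun_def H_adm_weight)
      moreover have "h \<in> weight_space H adm (\<lambda>_. 0)" using h root_space_zero by (simp add: H_adm_weight)
      ultimately show ?thesis by (intro vec.span_base) blast
    qed
  qed
  moreover have "(\<Union>\<alpha>\<in>roots br H. root_space br H \<alpha>) \<subseteq> vec.span (\<Union>\<nu>\<in>rep_weights H adm. weight_space H adm \<nu>)"
    using roots_adm_weights vec.span_superset by (fastforce simp: H_adm_weight)
  ultimately have "vec.span (H \<union> (\<Union>\<alpha>\<in>roots br H. root_space br H \<alpha>))
      \<subseteq> vec.span (\<Union>\<nu>\<in>rep_weights H adm. weight_space H adm \<nu>)"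
    by (intro vec.span_minimal vec.subspace_span) blast
  then show ?case using root_decomposition by blast
qed

lemma root_vector_ad_nilpotent:
  assumes "x \<in> root_space br H \<alpha>" "h0 \<in> H" "\<alpha> h0 \<noteq> 0" shows "ad_nilpotent br x"
proof -
  have "evnil (br x) v" for v using adjw.root_vector_nilpotent[OF assms, of v] by (simp add: evnil_def)
  then have "(br x ^^ CARD('n)) v = 0" for v by (intro funpow_bound lin_br2)
  then show ?thesis unfolding ad_nilpotent_def by blast
qed

lemma exp_ad_order3:
  assumes x: "ad_nilpotent br x" and y: "br x (br x (br x y)) = 0"
  shows "exp_ad br x y = y + br x y + (1/2) *s br x (br x y)"
proof -
  have nil: "evnil (adj.act x) v" for v using x by (auto simp: ad_nilpotent_def evnil_def)
  have "exp_ad br x y = truncexp (CARD('n) + CARD('n)) (br x) y"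
    using adj.exp_intertwiner(2)[OF x nil] .
  \<comment> \<open>A priori \<open>CARD('n)\<close> may be below 3, so the sum is lengthened past
    both bounds before it is cut at 3.\<close>
  also have "\<dots> = truncexp (3 + (CARD('n) + CARD('n))) (br x) y"
  proof (rule truncexp_extend[symmetric, OF lin_br2])
    have "(br x ^^ CARD('n)) y = 0" using x by (intro funpow_bound lin_br2) (auto simp: ad_nilpotent_def evnil_def)
    then show "(br x ^^ (CARD('n) + CARD('n))) y = 0" by (rule funpow_zero_mono[OF lin_br2]) simp
  qed simp
  also have "\<dots> = truncexp 3 (br x) y"
    by (rule truncexp_extend[OF lin_br2]) (use y in \<open>auto simp: numeral_3_eq_3\<close>)
  also have "\<dots> = y + br x y + (1/2) *s br x (br x y)"
    using y by (simp add: truncexp_def numeral_3_eq_3 numeral_2_eq_2)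
  finally show ?thesis .
qed

text \<open>The automorphism \<open>exp (ad e) exp (- ad f) exp (ad e)\<close> acts on \<open>H\<close> as a reflection.\<close>

lemma exp_reflection:
  assumes \<alpha>: "\<alpha> \<in> roots br H"
    and e: "e \<in> root_space br H \<alpha>" and f: "f \<in> root_space br H (\<lambda>t. - \<alpha> t)" and ef: "br e f = coroot br H \<alpha>"
    and h: "h \<in> H"
  shows "exp_ad br e (exp_ad br (- f) (exp_ad br e h)) = h - \<alpha> h *s coroot br H \<alpha>"
proof -
  let ?t = "coroot br H \<alpha>"
  note t = sl2_triple(2,3)[OF \<alpha>]
  obtain h0 where h0: "h0 \<in> H" "\<alpha> h0 \<noteq> 0" using root_nonzero[OF \<alpha>] by blast
  have ne: "ad_nilpotent br e" by (rule root_vector_ad_nilpotent[OF e h0])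
  have "- f \<in> root_space br H (\<lambda>t. - \<alpha> t)" using f by (simp add: root_space_def br_neg2)
  then have nf: "ad_nilpotent br (- f)" by (rule root_vector_ad_nilpotent[OF _ h0(1)]) (use h0 in simp)
  have he: "br e h = - \<alpha> h *s e" if "h \<in> H" for h
    using e that br_anti[of e h] by (simp add: root_space_def)
  have hf: "br f h = \<alpha> h *s f" if "h \<in> H" for h
    using f that br_anti[of f h] by (simp add: root_space_def)
  have fe: "br f e = - ?t" using ef br_anti[of f e] by simp
  have E: "exp_ad br e h = h - \<alpha> h *s e" if "h \<in> H" for h
    using that by (subst exp_ad_order3[OF ne]) (simp_all add: he br_scale2 br_neg2)
  have F: "exp_ad br (- f) h = h - \<alpha> h *s f" if "h \<in> H" for h
    using that by (subst exp_ad_order3[OF nf]) (simp_all add: hf br_scale2 br_neg2 br_neg1)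
  \<comment> \<open>[-f, e] is the coroot t, and [-f, t] = -2 f, which the factor 1/2 turns into
    -f.\<close>
  have Fe: "exp_ad br (- f) e = e + ?t - f"
    by (subst exp_ad_order3[OF nf])
       (simp_all add: fe hf t br_neg2 br_neg1 br_scale2 vec_eq_iff)
  have linF: "lin (exp_ad br (- f))" using lin_truncexp[OF lin_br2, of "CARD('n)" "- f"]
    by (simp add: exp_ad_def[abs_def] truncexp_def[abs_def])
  have linE: "lin (exp_ad br e)" using lin_truncexp[OF lin_br2, of "CARD('n)" e]
    by (simp add: exp_ad_def[abs_def] truncexp_def[abs_def])
  have Ee: "exp_ad br e e = e" by (subst exp_ad_order3[OF ne]) simp_all
  let ?h = "h - \<alpha> h *s ?t"
  have hH: "?h \<in> H" using h t by (intro vec.subspace_diff vec.subspace_scale subspace_H)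
  have ah: "\<alpha> ?h = - \<alpha> h"
  proof -
    have "\<alpha> ?h = \<alpha> (h + (- \<alpha> h) *s ?t)" by simp
    also have "\<dots> = \<alpha> h + \<alpha> ((- \<alpha> h) *s ?t)"
      using h t by (intro wt_add[OF root_wt[OF \<alpha>]] vec.subspace_scale subspace_H)
    also have "\<dots> = - \<alpha> h" by (subst wt_scale[OF root_wt[OF \<alpha>] t(1)]) (simp add: t)
    finally show ?thesis .
  qed
  have "exp_ad br (- f) (exp_ad br e h) = ?h - \<alpha> h *s e"
    by (simp add: E[OF h] vec.linear_diff[OF linF] vec.linear_scale[OF linF] F[OF h] Fe
        vec.scale_right_diff_distrib vec.scale_right_distrib)
  also have "exp_ad br e \<dots> = exp_ad br e ?h - \<alpha> h *s exp_ad br e e"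
    by (simp only: vec.linear_diff[OF linE, of ?h] vec.linear_scale[OF linE])
  also have "\<dots> = ?h" unfolding E[OF hH] Ee ah by simp
  finally show ?thesis .
qed

end

section \<open>Weyl symmetry and integrality of weights\<close>

context weight_rep begin

text \<open>\<theta> = exp e exp (-f) exp e on V intertwines each h with its reflected copy, so it
  maps the \<nu>-space injectively into the reflected one. Reflecting twice turns the inequality
  into an equality in \<open>orbit_weights\<close>.\<close>

lemma reflection_weight:
  assumes \<alpha>: "\<alpha> \<in> roots br H" and \<nu>: "\<nu> \<in> W"
  shows "reflection br H \<alpha> \<nu> \<in> W" "weight_mult H \<phi> \<nu> \<le> weight_mult H \<phi> (reflection br H \<alpha> \<nu>)"
proof -
  let ?t = "coroot br H \<alpha>"
  note t = sl2_triple(2,3)[OF \<alpha>]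
  obtain e f where ef: "root_space br H \<alpha> = vec.span {e}" "root_space br H (\<lambda>t. - \<alpha> t) = vec.span {f}" "br e f = ?t"
    using sl2_triple(1)[OF \<alpha>] by blast
  have e: "e \<in> root_space br H \<alpha>" and f: "f \<in> root_space br H (\<lambda>t. - \<alpha> t)"
    unfolding ef by (simp_all add: vec.span_base)
  then have f': "- f \<in> root_space br H (\<lambda>t. - \<alpha> t)" by (simp add: root_space_def br_neg2)
  obtain h0 where h0: "h0 \<in> H" "\<alpha> h0 \<noteq> 0" using root_nonzero[OF \<alpha>] by blast
  then have h0': "- \<alpha> h0 \<noteq> 0" by simp
  let ?N = "CARD('n) + CARD('d)"
  let ?E = "truncexp ?N (act e)" let ?F = "truncexp ?N (act (- f))"
  note nE = root_vector_nilpotent[OF e h0] and nF = root_vector_nilpotent[OF f' h0(1) h0']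
  note iE = exp_intertwiner(1)[OF root_vector_ad_nilpotent[OF e h0] nE]
  note iF = exp_intertwiner(1)[OF root_vector_ad_nilpotent[OF f' h0(1) h0'] nF]
  define \<theta> where "\<theta> v = ?E (?F (?E v))" for v
  have lE: "lin ?E" and lF: "lin ?F" by (rule lin_truncexp[OF lin_act])+
  have l\<theta>: "lin \<theta>" unfolding \<theta>_def[abs_def] by (rule lin_comp[OF lE lin_comp[OF lF lE]])
  have inj: "\<theta> v = 0 \<Longrightarrow> v = 0" for v
    unfolding \<theta>_def using truncexp_inj[OF lin_act nE] truncexp_inj[OF lin_act nF] by blast
  have i\<theta>: "\<theta> (act h v) = act (h - \<alpha> h *s ?t) (\<theta> v)" if "h \<in> H" for h v
    unfolding \<theta>_def iE iF exp_reflection[OF \<alpha> e f ef(3) that] ..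
  let ?r = "reflection br H \<alpha> \<nu>"
  have map: "\<theta> v \<in> ws ?r" if v: "v \<in> ws \<nu>" for v
    unfolding weight_space_def
  proof (rule CollectI, rule ballI)
    fix h assume h: "h \<in> H"
    let ?h = "h + (- \<alpha> h) *s ?t"
    have th: "c *s ?t \<in> H" for c using t by (simp add: vec.subspace_scale[OF subspace_H])
    have hH: "?h \<in> H" using h th by (intro vec.subspace_add[OF subspace_H])
    have "\<alpha> ?h = - \<alpha> h" using wt_add[OF root_wt[OF \<alpha>] h th, of "- \<alpha> h"] wt_scale[OF root_wt[OF \<alpha>] t(1), of "- \<alpha> h"] t by simp
    then have "?h - \<alpha> ?h *s ?t = h" by simp
    then have "act h (\<theta> v) = \<theta> (act ?h v)" unfolding i\<theta>[OF hH] by (simp only:)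
    also have "\<dots> = \<nu> ?h *s \<theta> v" using v hH by (simp add: weight_space_def vec.linear_scale[OF l\<theta>])
    also have "\<nu> ?h = ?r h"
      using W_add[OF \<nu> h th, of "- \<alpha> h"] W_scale[OF \<nu> t(1), of "- \<alpha> h"] by (simp add: reflection_def mult.commute)
    finally show "act h (\<theta> v) = ?r h *s \<theta> v" .
  qed
  have "hfun H ?r" using \<nu> \<alpha> by (auto simp: hfun_def reflection_def rep_weights_def roots_def)
  moreover obtain v where "v \<in> ws \<nu>" "v \<noteq> 0" using ws_vector[OF \<nu>] by blast
  then have "ws ?r \<noteq> {0}" using map[of v] inj[of v] by blast
  ultimately show "?r \<in> W" by (simp add: rep_weights_def)
  have "inj \<theta>" by (rule lin_injI[OF l\<theta>]) (rule inj)
  then have "vec.dim (\<theta> ` ws \<nu>) = vec.dim (ws \<nu>)"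
    by (intro vec.dim_image_eq[OF l\<theta>]) (rule inj_on_subset, auto)
  moreover have "vec.dim (\<theta> ` ws \<nu>) \<le> vec.dim (ws ?r)" using map by (intro vec.dim_subset) blast
  ultimately show "weight_mult H \<phi> \<nu> \<le> weight_mult H \<phi> ?r" by (simp add: weight_mult_def)
qed

text \<open>The sl_2 computation: w is the last nonzero e^j v, with value c at the coroot, and e
  f^(i+1) w = (i + 1) (c - i) f^i w. The last nonzero f^i w forces c = i, so \<nu> takes the value i
  - 2 j.\<close>

lemma weight_integral:
  assumes \<alpha>: "\<alpha> \<in> roots br H" and \<nu>: "\<nu> \<in> W"
  shows "\<nu> (coroot br H \<alpha>) \<in> \<int>"
proof -
  let ?t = "coroot br H \<alpha>"
  note t = sl2_triple(2,3)[OF \<alpha>]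
  obtain e f where ef: "root_space br H \<alpha> = vec.span {e}" "root_space br H (\<lambda>t. - \<alpha> t) = vec.span {f}" "br e f = ?t"
    using sl2_triple(1)[OF \<alpha>] by blast
  have e: "e \<in> root_space br H \<alpha>" and f: "f \<in> root_space br H (\<lambda>t. - \<alpha> t)"
    unfolding ef by (simp_all add: vec.span_base)
  obtain h0 where h0: "h0 \<in> H" "\<alpha> h0 \<noteq> 0" using root_nonzero[OF \<alpha>] by blast
  then have h0': "- \<alpha> h0 \<noteq> 0" by simp
  note nE = root_vector_nilpotent[OF e h0] and nF = root_vector_nilpotent[OF f h0(1) h0']
  have least: "\<exists>j. (D ^^ j) v \<noteq> 0 \<and> D ((D ^^ j) v) = 0" if "evnil D v" "v \<noteq> 0" for D :: "complex^'d \<Rightarrow> complex^'d" and v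
  proof -
    define k where "k = (LEAST k. (D ^^ k) v = 0)"
    have k: "(D ^^ k) v = 0" unfolding k_def using that(1) unfolding evnil_def by (rule LeastI_ex)
    then have "k \<noteq> 0" using that(2) by (metis funpow_0)
    then obtain j where j: "k = Suc j" by (metis not0_implies_Suc)
    then have "(D ^^ j) v \<noteq> 0" using not_less_Least[of j "\<lambda>k. (D ^^ k) v = 0"] k_def by auto
    then show ?thesis using k j by auto
  qed
  obtain v where v: "v \<in> ws \<nu>" "v \<noteq> 0" using ws_vector[OF \<nu>] by blast
  obtain j where j: "(act e ^^ j) v \<noteq> 0" "act e ((act e ^^ j) v) = 0" using least[OF nE v(2)] by blast
  define w where "w = (act e ^^ j) v"
  define c where "c = \<nu> ?t + of_nat j * 2"
  have ww: "w \<in> ws (\<lambda>h. \<nu> h + of_nat j * \<alpha> h)" unfolding w_def by (rule act_root_funpow[OF e v(1)])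
  have tw: "act ?t ((act f ^^ i) w) = (c - 2 * of_nat i) *s (act f ^^ i) w" for i
  proof -
    have "act ?t ((act f ^^ i) w) = (\<nu> ?t + of_nat j * \<alpha> ?t + of_nat i * - \<alpha> ?t) *s (act f ^^ i) w"
      using act_root_funpow[OF f ww, of i] t(1) unfolding weight_space_def by blast
    moreover have "\<nu> ?t + of_nat j * \<alpha> ?t + of_nat i * - \<alpha> ?t = c - 2 * of_nat i" by (simp add: c_def t)
    ultimately show ?thesis by metis
  qed
  have ew: "act e ((act f ^^ Suc i) w) = (of_nat (Suc i) * (c - of_nat i)) *s (act f ^^ i) w" for i
  proof (induction i)
    case 0
    show ?case using act_br[of e f w] tw[of 0] j(2) by (simp add: ef(3) w_def[symmetric] act_02)
  next
    case (Suc i)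
    let ?u = "(act f ^^ Suc i) w"
    have "act e (act f ?u) = act ?t ?u + act f (act e ?u)" using act_br[of e f ?u] by (simp add: ef(3))
    also have "\<dots> = (c - 2 * of_nat (Suc i)) *s ?u + (of_nat (Suc i) * (c - of_nat i)) *s ?u"
      unfolding Suc tw by (simp add: act_scale2)
    also have "\<dots> = (of_nat (Suc (Suc i)) * (c - of_nat (Suc i))) *s ?u"
      unfolding vec.scale_left_distrib[symmetric] by (rule arg_cong[where f = "\<lambda>a. a *s ?u"]) (simp add: algebra_simps)
    finally show ?case by simp
  qed
  have "w \<noteq> 0" using j(1) by (simp add: w_def)
  then obtain i where i: "(act f ^^ i) w \<noteq> 0" "act f ((act f ^^ i) w) = 0" using least[OF nF] by blast
  have "(of_nat (Suc i) * (c - of_nat i)) *s (act f ^^ i) w = 0" using ew[of i] i(2) by (simp add: act_02)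
  then have "of_nat (Suc i) * (c - of_nat i) = 0" using i(1) by (simp only: vec.scale_eq_0_iff) simp
  then have "c = of_nat i" by (simp del: of_nat_Suc)
  then have "\<nu> ?t = of_int (int i - 2 * int j)" by (simp add: c_def algebra_simps)
  then show ?thesis by simp
qed

end

text \<open>The span of all weight vectors is stable under H and under root vectors, hence under the
  whole algebra, and it contains a common eigenvector of the commuting operators from H;
  irreducibility makes it everything.\<close>

lemma (in cartan) irreducible_weight_rep:
  fixes \<phi> :: "complex^'n \<Rightarrow> complex^'d^'d"
  assumes rep: "lie_rep br \<phi>" and irr: "irreducible_rep \<phi>"
  shows "weight_rep br H \<phi>"
proof -
  interpret lie_rep_on br \<phi> by unfold_locales (rule rep)
  let ?ws = "weight_space H \<phi>" let ?W = "rep_weights H \<phi>"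
  let ?V = "vec.span (\<Union>\<nu>\<in>?W. ?ws \<nu>)"
  have norm: "v \<in> ?V" if v: "v \<in> ?ws \<nu>" for v \<nu>
  proof (cases "v = 0")
    case True then show ?thesis by (simp add: vec.span_zero)
  next
    case False
    let ?\<nu> = "\<lambda>h. if h \<in> H then \<nu> h else 0"
    have "v \<in> ?ws ?\<nu>" using v by (simp add: weight_space_def)
    moreover from this have "?\<nu> \<in> ?W" using False by (auto simp: rep_weights_def hfun_def)
    ultimately show ?thesis by (intro vec.span_base) blast
  qed
  have stab: "act x v \<in> ?V" if gen: "\<And>v \<nu>. v \<in> ?ws \<nu> \<Longrightarrow> act x v \<in> ?V" and v: "v \<in> ?V" for x v
  proof -
    have sub: "vec.subspace {v. act x v \<in> ?V}"
      by (intro vec.subspaceI) (auto simp: act_02 act_add2 act_scale2 vec.span_zero vec.span_add vec.span_scale)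
    have "(\<Union>\<nu>\<in>?W. ?ws \<nu>) \<subseteq> {v. act x v \<in> ?V}" using gen by blast
    then have "?V \<subseteq> {v. act x v \<in> ?V}" by (rule vec.span_minimal[OF _ sub])
    then show ?thesis using v by blast
  qed
  have H: "act h v \<in> ?V" if "h \<in> H" "v \<in> ?V" for h v
  proof (rule stab[OF _ that(2)])
    fix v \<nu> assume v: "v \<in> ?ws \<nu>"
    then have "act h v = \<nu> h *s v" using that(1) by (simp add: weight_space_def)
    then show "act h v \<in> ?V" using norm[OF v] by (simp add: vec.span_scale)
  qed
  have R: "act x v \<in> ?V" if "x \<in> root_space br H \<alpha>" "v \<in> ?V" for x \<alpha> v
  proof (rule stab[OF _ that(2)])
    fix v \<nu> assume v: "v \<in> ?ws \<nu>"
    have "act h (act x v) = (\<nu> h + \<alpha> h) *s act x v" if h: "h \<in> H" for h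
    proof -
      have "act h (act x v) = act (br h x) v + act x (act h v)" by (simp add: act_br)
      then show ?thesis using v h \<open>x \<in> root_space br H \<alpha>\<close>
        by (simp add: root_space_def weight_space_def act_scale1 act_scale2 vec.scale_left_distrib add.commute)
    qed
    then show "act x v \<in> ?V" by (intro norm[of _ "\<lambda>h. \<nu> h + \<alpha> h"]) (simp add: weight_space_def)
  qed
  let ?S = "{x. \<forall>v\<in>?V. act x v \<in> ?V}"
  have "vec.subspace ?S"
    by (intro vec.subspaceI) (auto simp: act_01 act_add1 act_scale1 vec.span_zero vec.span_add vec.span_scale)
  then have "vec.span (H \<union> (\<Union>\<alpha>\<in>roots br H. root_space br H \<alpha>)) \<subseteq> ?S"
    by (rule vec.span_minimal[rotated]) (use H R in blast)
  then have all: "\<forall>x. \<forall>v\<in>?V. act x v \<in> ?V" using root_decomposition by blast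
  have "\<exists>v\<in>UNIV. v \<noteq> 0 \<and> (\<forall>h\<in>H. \<exists>a. act h v = a *s v)"
  proof (rule common_eigenvector)
    show "(UNIV :: (complex^'d) set) \<noteq> {0}"
    proof
      assume "(UNIV :: (complex^'d) set) = {0}"
      then have "(axis undefined 1 :: complex^'d) = 0" by blast
      then show False by (simp add: axis_eq_0_iff)
    qed
    show "act h (act h' v) = act h' (act h v)" if "h \<in> H" "h' \<in> H" for h h' v
      using act_br[of h h' v] H_abelian[OF that] by (simp add: act_01)
  qed (auto simp: lin_act)
  then obtain v where v: "v \<noteq> 0" "\<forall>h\<in>H. \<exists>a. act h v = a *s v" by blast
  then obtain a where "\<forall>h\<in>H. act h v = a h *s v" by metis
  then have "v \<in> ?V" by (intro norm[of v a]) (simp add: weight_space_def)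
  then have "?V \<noteq> {0}" using v by blast
  then have "?V = UNIV" using irr all unfolding irreducible_rep_def by (meson vec.subspace_span)
  then show ?thesis by unfold_locales
qed

section \<open>Polynomial functions\<close>

text \<open>Over a finite variable type the product can run over all variables, so that evaluation
  is multiplicative in the exponent without tracking supports.\<close>

definition mono_eval :: "('v::finite \<Rightarrow>\<^sub>0 nat) \<Rightarrow> ('v \<Rightarrow> complex) \<Rightarrow> complex" where
  "mono_eval m a = (\<Prod>v\<in>UNIV. a v ^ Poly_Mapping.lookup m v)"

lemma mono_eval_keys:
  "(\<Prod>v\<in>Poly_Mapping.keys m. a v ^ Poly_Mapping.lookup m v) = mono_eval m (a :: 'v::finite \<Rightarrow> complex)"
  unfolding mono_eval_def
  by (rule prod.mono_neutral_left) (auto simp: Poly_Mapping.in_keys_iff)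

lemma mono_eval_add: "mono_eval (m + n) a = mono_eval m a * mono_eval n a"
  by (simp add: mono_eval_def Poly_Mapping.lookup_add power_add prod.distrib)

lemma mpoly_eval_superset:
  fixes p :: "'v::finite mpoly"
  assumes "finite K" "Poly_Mapping.keys p \<subseteq> K"
  shows "mpoly_eval p a = (\<Sum>m\<in>K. Poly_Mapping.lookup p m * mono_eval m a)"
  unfolding mpoly_eval_def mono_eval_keys
  by (rule sum.mono_neutral_left) (use assms in \<open>auto simp: Poly_Mapping.in_keys_iff\<close>)

lemma mpoly_eval_add: "mpoly_eval (p + q) a = mpoly_eval p a + mpoly_eval q (a :: 'v::finite \<Rightarrow> complex)"
proof -
  let ?K = "Poly_Mapping.keys p \<union> Poly_Mapping.keys q"
  have "Poly_Mapping.keys (p + q) \<subseteq> ?K" by (rule Poly_Mapping.keys_add)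
  then show ?thesis
    by (simp add: mpoly_eval_superset[of ?K] Poly_Mapping.lookup_add distrib_right sum.distrib)
qed

lemma mpoly_eval_0 [simp]: "mpoly_eval 0 a = 0"
  by (simp add: mpoly_eval_def)

lemma mpoly_eval_sum: "mpoly_eval (\<Sum>i\<in>I. p i) a = (\<Sum>i\<in>I. mpoly_eval (p i) (a :: 'v::finite \<Rightarrow> complex))"
  by (induction I rule: infinite_finite_induct) (auto simp: mpoly_eval_add)

lemma mpoly_eval_single: "mpoly_eval (Poly_Mapping.single m c) a = c * mono_eval m (a :: 'v::finite \<Rightarrow> complex)"
  by (simp add: mpoly_eval_superset[of "{m}"])

lemma mpoly_sum_single: "p = (\<Sum>m\<in>Poly_Mapping.keys p. Poly_Mapping.single m (Poly_Mapping.lookup p m))"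
proof (rule poly_mapping_eqI)
  fix k
  have "(\<Sum>m\<in>Poly_Mapping.keys p. Poly_Mapping.lookup (Poly_Mapping.single m (Poly_Mapping.lookup p m)) k)
      = (\<Sum>m\<in>Poly_Mapping.keys p. if m = k then Poly_Mapping.lookup p k else 0)"
    by (rule sum.cong) (auto simp: Poly_Mapping.lookup_single when_def)
  then show "Poly_Mapping.lookup p k
      = Poly_Mapping.lookup (\<Sum>m\<in>Poly_Mapping.keys p. Poly_Mapping.single m (Poly_Mapping.lookup p m)) k"
    by (simp add: Poly_Mapping.lookup_sum Poly_Mapping.in_keys_iff)
qed

lemma mpoly_eval_mult: "mpoly_eval (p * q) a = mpoly_eval p a * mpoly_eval q (a :: 'v::finite \<Rightarrow> complex)"
proof -
  let ?L = "Poly_Mapping.lookup" and ?K = "Poly_Mapping.keys"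
  have "p * q = (\<Sum>m\<in>?K p. Poly_Mapping.single m (?L p m)) * (\<Sum>n\<in>?K q. Poly_Mapping.single n (?L q n))"
    using mpoly_sum_single[of p] mpoly_sum_single[of q] by simp
  also have "\<dots> = (\<Sum>m\<in>?K p. \<Sum>n\<in>?K q. Poly_Mapping.single (m + n) (?L p m * ?L q n))"
    by (simp add: sum_product mult_single)
  finally have "mpoly_eval (p * q) a = (\<Sum>m\<in>?K p. \<Sum>n\<in>?K q. (?L p m * mono_eval m a) * (?L q n * mono_eval n a))"
    by (simp add: mpoly_eval_sum mpoly_eval_single mono_eval_add mult_ac)
  also have "\<dots> = mpoly_eval p a * mpoly_eval q a"
    unfolding mpoly_eval_def mono_eval_keys sum_product ..
  finally show ?thesis .
qed

lemma mpoly_eval_const: "mpoly_eval (Poly_Mapping.single 0 c) a = (c :: complex)"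
  for a :: "'v::finite \<Rightarrow> complex"
  by (simp add: mpoly_eval_single mono_eval_def)

lemma mpoly_eval_1 [simp]: "mpoly_eval 1 (a :: 'v::finite \<Rightarrow> complex) = 1"
  using mpoly_eval_const[of 1 a] by simp

lemma mpoly_eval_power: "mpoly_eval (p ^ k) a = mpoly_eval p (a :: 'v::finite \<Rightarrow> complex) ^ k"
  by (induction k) (auto simp: mpoly_eval_mult)

lemma mpoly_eval_prod: "mpoly_eval (\<Prod>i\<in>I. p i) a = (\<Prod>i\<in>I. mpoly_eval (p i) (a :: 'v::finite \<Rightarrow> complex))"
  by (induction I rule: infinite_finite_induct) (auto simp: mpoly_eval_mult)

lemma mpoly_eval_uminus: "mpoly_eval (- p) a = - mpoly_eval p (a :: 'v::finite \<Rightarrow> complex)"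
  using mpoly_eval_add[of p "- p" a] by (simp add: eq_neg_iff_add_eq_0 add.commute)

lemma mpoly_eval_diff: "mpoly_eval (p - q) a = mpoly_eval p a - mpoly_eval q (a :: 'v::finite \<Rightarrow> complex)"
  using mpoly_eval_add[of p "- q" a] by (simp add: mpoly_eval_uminus)

lemma digits_unique:
  fixes f g :: "nat \<Rightarrow> nat"
  assumes "\<forall>i<n. f i < N \<and> g i < N" "(\<Sum>i<n. f i * N ^ i) = (\<Sum>i<n. g i * N ^ i)" "i < n"
  shows "f i = g i"
  using assms
proof (induction n arbitrary: f g i)
  case (Suc n)
  have s: "(\<Sum>i<Suc n. f i * N ^ i) = f 0 + N * (\<Sum>i<n. f (Suc i) * N ^ i)" for f
    by (simp add: sum.lessThan_Suc_shift sum_distrib_left mult_ac del: sum.lessThan_Suc)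
  have e: "f 0 + N * (\<Sum>i<n. f (Suc i) * N ^ i) = g 0 + N * (\<Sum>i<n. g (Suc i) * N ^ i)"
    using Suc.prems(2) unfolding s .
  have lt: "f 0 < N" "g 0 < N" using Suc.prems(1) by auto
  have "(f 0 + N * (\<Sum>i<n. f (Suc i) * N ^ i)) mod N = (g 0 + N * (\<Sum>i<n. g (Suc i) * N ^ i)) mod N"
    using e by simp
  then have 0: "f 0 = g 0" using lt by simp
  have "(\<Sum>i<n. f (Suc i) * N ^ i) = (\<Sum>i<n. g (Suc i) * N ^ i)" using e 0 lt by simp
  then have "f (Suc j) = g (Suc j)" if "j < n" for j
    using Suc.IH[of "\<lambda>i. f (Suc i)" "\<lambda>i. g (Suc i)" j] Suc.prems(1) that by auto
  then show ?case using 0 Suc.prems(3) by (cases i) auto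
qed simp

text \<open>Kronecker substitution \<open>x\<^sub>i \<mapsto> t ^ N ^ i\<close> reduces to polynomials in one variable.\<close>

lemma mpoly_eval_inject_0:
  fixes p :: "'v::finite mpoly"
  assumes z: "\<And>a. mpoly_eval p a = 0" shows "p = 0"
proof (rule ccontr)
  assume "p \<noteq> 0"
  then obtain m0 where m0: "m0 \<in> Poly_Mapping.keys p" using keys_eq_empty by blast
  let ?K = "Poly_Mapping.keys p" and ?L = "Poly_Mapping.lookup"
  define n where "n = CARD('v)"
  obtain idx where idx: "bij_betw idx (UNIV :: 'v set) {..<n}"
    using ex_bij_betw_finite_nat[of "UNIV :: 'v set"] unfolding n_def atLeast0LessThan by auto
  \<comment> \<open>N exceeds every exponent, so the exponents of a monomial m are the base-N digits
    of \<open>e m\<close>, and distinct monomials stay distinct.\<close>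
  define N where "N = Suc (\<Sum>m\<in>?K. \<Sum>v\<in>UNIV. ?L m v)"
  have N: "?L m v < N" if "m \<in> ?K" for m v
  proof -
    have "?L m v \<le> (\<Sum>v\<in>UNIV. ?L m v)" by (rule member_le_sum) auto
    also have "\<dots> \<le> (\<Sum>m\<in>?K. \<Sum>v\<in>UNIV. ?L m v)"
      using that by (intro member_le_sum[of m ?K "\<lambda>m. \<Sum>v\<in>UNIV. ?L m v"]) auto
    finally show ?thesis by (simp add: N_def)
  qed
  define e where "e m = (\<Sum>v\<in>UNIV. ?L m v * N ^ idx v)" for m
  have inj: "m = m'" if m: "m \<in> ?K" "m' \<in> ?K" "e m = e m'" for m m'
  proof (rule poly_mapping_eqI)
    fix v
    let ?inv = "the_inv_into UNIV idx"
    have inv: "?inv (idx v) = v" for v using idx by (simp add: bij_betw_def the_inv_into_f_f)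
    have em: "e m = (\<Sum>i<n. ?L m (?inv i) * N ^ i)" for m
      unfolding e_def using sum.reindex_bij_betw[OF idx, of "\<lambda>i. ?L m (?inv i) * N ^ i"] by (simp add: inv)
    have "?L m (?inv (idx v)) = ?L m' (?inv (idx v))"
      by (rule digits_unique[of n _ N]) (use m em N idx in \<open>auto simp: bij_betw_def\<close>)
    then show "?L m v = ?L m' v" by (simp add: inv)
  qed
  define Q where "Q = (\<Sum>m\<in>?K. monom (?L p m) (e m))"
  have "poly Q t = 0" for t
  proof -
    have "mono_eval m (\<lambda>v. t ^ N ^ idx v) = t ^ e m" for m :: "'v \<Rightarrow>\<^sub>0 nat"
      by (simp add: mono_eval_def e_def power_sum mult.commute flip: power_mult)
    then have "poly Q t = mpoly_eval p (\<lambda>v. t ^ N ^ idx v)"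
      by (simp add: Q_def poly_sum poly_monom mpoly_eval_def mono_eval_keys)
    then show ?thesis using z by simp
  qed
  then have "Q = 0" using poly_all_0_iff_0 by blast
  moreover have "coeff Q (e m0) = ?L p m0"
  proof -
    have "coeff Q (e m0) = (\<Sum>m\<in>?K. if m = m0 then ?L p m0 else 0)"
      unfolding Q_def coeff_sum by (rule sum.cong) (use inj m0 in auto)
    then show ?thesis using m0 by simp
  qed
  ultimately show False using m0 by (simp add: Poly_Mapping.in_keys_iff)
qed

lemma mpoly_eval_inject:
  fixes p q :: "'v::finite mpoly"
  assumes "\<And>a. mpoly_eval p a = mpoly_eval q a" shows "p = q"
proof -
  have "p - q = 0" by (rule mpoly_eval_inject_0) (simp add: mpoly_eval_diff assms)
  then show ?thesis by simp
qed

text \<open>Scaling by s = 2 already decides: comparing coefficients gives 2^w = 2^k for the degree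
  w of each monomial.\<close>

lemma mpoly_total_degree_homogeneous:
  fixes p :: "'v::finite mpoly"
  assumes h: "\<And>s a. mpoly_eval p (\<lambda>v. s * a v) = s ^ k * mpoly_eval p a" and "p \<noteq> 0"
  shows "mpoly_total_degree p = k"
proof -
  let ?K = "Poly_Mapping.keys p" and ?L = "Poly_Mapping.lookup"
  define w where "w m = (\<Sum>v\<in>Poly_Mapping.keys m. ?L m v)" for m :: "'v \<Rightarrow>\<^sub>0 nat"
  have scale: "mono_eval m (\<lambda>v. 2 * a v) = 2 ^ w m * mono_eval m a" for m :: "'v \<Rightarrow>\<^sub>0 nat" and a
    unfolding mono_eval_keys[symmetric] w_def by (simp add: power_mult_distrib prod.distrib power_sum)
  define q where "q = (\<Sum>m\<in>?K. Poly_Mapping.single m ((2 ^ w m - 2 ^ k) * ?L p m))"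
  have "mpoly_eval q a = 0" for a
  proof -
    have "mpoly_eval q a = (\<Sum>m\<in>?K. ?L p m * mono_eval m (\<lambda>v. 2 * a v)) - 2 ^ k * (\<Sum>m\<in>?K. ?L p m * mono_eval m a)"
      unfolding scale q_def mpoly_eval_sum mpoly_eval_single sum_distrib_left sum_subtractf[symmetric]
      by (rule sum.cong) (auto simp: algebra_simps)
    then show ?thesis using h[of 2 a] unfolding mpoly_eval_def[of p] mono_eval_keys by simp
  qed
  then have "q = 0" by (rule mpoly_eval_inject_0)
  have wk: "w m = k" if m: "m \<in> ?K" for m
  proof -
    have "?L q m = (\<Sum>n\<in>?K. if n = m then (2 ^ w m - 2 ^ k) * ?L p m else 0)"
      unfolding q_def Poly_Mapping.lookup_sum
      by (rule sum.cong) (auto simp: Poly_Mapping.lookup_single when_def)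
    then have "(2 ^ w m - 2 ^ k) * ?L p m = 0" using m \<open>q = 0\<close> by simp
    then have "(2::complex) ^ w m = 2 ^ k" using m by (simp add: Poly_Mapping.in_keys_iff)
    then have "norm ((2::complex) ^ w m) = norm ((2::complex) ^ k)" by simp
    then have "(2::real) ^ w m = 2 ^ k" by (simp add: norm_power)
    then show ?thesis by simp
  qed
  obtain m0 where "m0 \<in> ?K" using assms(2) keys_eq_empty by blast
  then have "w ` ?K = {k}" using wk by (auto simp: image_iff intro!: bexI[of _ m0])
  then show ?thesis by (simp add: mpoly_total_degree_def w_def[symmetric])
qed

definition polyfun :: "(('v::finite \<Rightarrow> complex) \<Rightarrow> complex) \<Rightarrow> bool" where
  "polyfun F \<longleftrightarrow> (\<exists>P. \<forall>a. mpoly_eval P a = F a)"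

lemma polyfun_const: "polyfun (\<lambda>a. c)"
  unfolding polyfun_def using mpoly_eval_const by blast

lemma polyfun_var: "polyfun (\<lambda>a. a v)"
  unfolding polyfun_def
  by (rule exI[of _ "Poly_Mapping.single (Poly_Mapping.single v 1) 1"])
     (simp add: mpoly_eval_def)

lemma polyfun_add: "polyfun F \<Longrightarrow> polyfun G \<Longrightarrow> polyfun (\<lambda>a. F a + G a)"
  unfolding polyfun_def using mpoly_eval_add by metis

lemma polyfun_mult: "polyfun F \<Longrightarrow> polyfun G \<Longrightarrow> polyfun (\<lambda>a. F a * G a)"
  unfolding polyfun_def using mpoly_eval_mult by metis

lemma polyfun_uminus: "polyfun F \<Longrightarrow> polyfun (\<lambda>a. - F a)"
  unfolding polyfun_def using mpoly_eval_uminus by metis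

lemma polyfun_diff: "polyfun F \<Longrightarrow> polyfun G \<Longrightarrow> polyfun (\<lambda>a. F a - G a)"
  unfolding polyfun_def using mpoly_eval_diff by metis

lemma polyfun_sum: "(\<And>i. i \<in> I \<Longrightarrow> polyfun (F i)) \<Longrightarrow> polyfun (\<lambda>a. \<Sum>i\<in>I. F i a)"
  by (induction I rule: infinite_finite_induct) (auto intro: polyfun_const polyfun_add)

lemma polyfun_prod: "(\<And>i. i \<in> I \<Longrightarrow> polyfun (F i)) \<Longrightarrow> polyfun (\<lambda>a. \<Prod>i\<in>I. F i a)"
  by (induction I rule: infinite_finite_induct) (auto intro: polyfun_const polyfun_mult)

lemma polyfun_power: "polyfun F \<Longrightarrow> polyfun (\<lambda>a. F a ^ k)"
  by (induction k) (auto intro: polyfun_const polyfun_mult)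

lemmas polyfun_intros = polyfun_const polyfun_var polyfun_add polyfun_mult polyfun_uminus polyfun_diff
  polyfun_sum polyfun_prod polyfun_power

section \<open>Polynomial curves: one-parameter tests for polynomial identities\<close>

definition polycurve :: "(complex \<Rightarrow> complex) \<Rightarrow> bool" where
  "polycurve g \<longleftrightarrow> (\<exists>q. \<forall>t. g t = poly q t)"

lemma polycurve_const: "polycurve (\<lambda>t. c)"
  unfolding polycurve_def by (rule exI[of _ "[:c:]"]) simp

lemma polycurve_id: "polycurve (\<lambda>t. t)"
  unfolding polycurve_def by (rule exI[of _ "[:0, 1:]"]) simp

lemma polycurve_add: "polycurve f \<Longrightarrow> polycurve g \<Longrightarrow> polycurve (\<lambda>t. f t + g t)"
  unfolding polycurve_def using poly_add by metis

lemma polycurve_diff: "polycurve f \<Longrightarrow> polycurve g \<Longrightarrow> polycurve (\<lambda>t. f t - g t)"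
  unfolding polycurve_def using poly_diff by metis

lemma polycurve_uminus: "polycurve f \<Longrightarrow> polycurve (\<lambda>t. - f t)"
  unfolding polycurve_def using poly_minus by metis

lemma polycurve_mult: "polycurve f \<Longrightarrow> polycurve g \<Longrightarrow> polycurve (\<lambda>t. f t * g t)"
  unfolding polycurve_def using poly_mult by metis

lemma polycurve_sum: "(\<And>i. i \<in> I \<Longrightarrow> polycurve (F i)) \<Longrightarrow> polycurve (\<lambda>a. \<Sum>i\<in>I. F i a)"
  by (induction I rule: infinite_finite_induct) (auto intro: polycurve_const polycurve_add)

lemma polycurve_prod: "(\<And>i. i \<in> I \<Longrightarrow> polycurve (F i)) \<Longrightarrow> polycurve (\<lambda>a. \<Prod>i\<in>I. F i a)"
  by (induction I rule: infinite_finite_induct) (auto intro: polycurve_const polycurve_mult)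

lemma polycurve_power: "polycurve F \<Longrightarrow> polycurve (\<lambda>a. F a ^ k)"
  by (induction k) (auto intro: polycurve_const polycurve_mult)

lemmas polycurve_intros = polycurve_const polycurve_id polycurve_add polycurve_mult polycurve_uminus
  polycurve_diff polycurve_sum polycurve_prod polycurve_power

lemma polycurve_mpoly_eval:
  fixes P :: "'v::finite mpoly"
  assumes "\<And>v. polycurve (\<lambda>t. c t v)" shows "polycurve (\<lambda>t. mpoly_eval P (c t))"
  unfolding mpoly_eval_def by (intro polycurve_intros assms)

lemma polycurve_zero:
  assumes "polycurve g" "infinite {t. g t = 0}" shows "g t = 0"
proof -
  obtain q where q: "\<And>t. g t = poly q t" using assms(1) unfolding polycurve_def by blast
  then have "infinite {t. poly q t = 0}" using assms(2) by simp
  then have "q = 0" using poly_roots_finite by blast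
  then show ?thesis by (simp add: q)
qed

text \<open>The two zero sets cover the plane, so one of them is infinite. This is the rigidity by
  which one factor of f vanishes along an entire curve.\<close>

lemma polycurve_mult_zero:
  assumes "polycurve f" "polycurve g" "\<And>t. f t * g t = 0"
  shows "(\<forall>t. f t = 0) \<or> (\<forall>t. g t = 0)"
proof -
  have "UNIV = {t. f t = 0} \<union> {t. g t = 0}" using assms(3) by auto
  then have "infinite {t. f t = 0} \<or> infinite {t. g t = 0}"
    using infinite_UNIV_char_0[where 'a = complex] by (metis finite_UnI)
  then show ?thesis using polycurve_zero assms by blast
qed

lemma polycurve_nowhere_zero:
  assumes "polycurve g" "\<And>t. g t \<noteq> 0" shows "g s = g t"
proof -
  obtain q where q: "\<And>t. g t = poly q t" using assms(1) unfolding polycurve_def by blast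
  then have "constant (poly q)" using fundamental_theorem_of_algebra[of q] assms(2) by auto
  then show ?thesis by (simp add: q constant_def)
qed

section \<open>The root system of type \<open>G\<^sub>2\<close>\<close>

text \<open>\<open>g2_orbit s t\<close> is the orbit of \<open>s \<alpha>1 + t \<alpha>2\<close> in coordinates with respect to the base.\<close>

definition g2_orbit :: "int \<Rightarrow> int \<Rightarrow> (int \<times> int) set" where
  "g2_orbit s t = {(s, t), (3*t - s, t), (s, s - t), (3*t - s, 2*t - s), (2 * s - 3*t, s - t), (2 * s - 3*t, s - 2*t),
     (- s, - t), (s - 3*t, - t), (- s, t - s), (s - 3*t, s - 2*t), (3*t - 2 * s, t - s), (3*t - 2 * s, 2*t - s)}"

definition g2_pos_roots :: "(int \<times> int) set" where
  "g2_pos_roots = {(1,0), (0,1), (1,1), (2,1), (3,1), (3,2)}"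

text \<open>\<open>2*u - 3 * v\<close> and \<open>2 * v - u\<close> are the values at the two simple
  coroots, with \<alpha>1 the short simple root.\<close>

lemma g2_orbit_dominant_ex: "\<exists>(u,v)\<in>g2_orbit s t. 2*u - 3 * v \<ge> 0 \<and> 2 * v - u \<ge> 0"
  unfolding g2_orbit_def by simp (smt (verit))

lemma g2_orbit_dominant_unique:
  assumes "2 * s - 3*t \<ge> 0" "2*t - s \<ge> 0" "(u,v) \<in> g2_orbit s t" "2*u - 3 * v \<ge> 0" "2 * v - u \<ge> 0"
  shows "u = s \<and> v = t"
proof -
  have "u = s \<and> v = t \<or> u = 3*t - s \<and> v = t \<or> u = s \<and> v = s - t \<or> u = 3*t - s \<and> v = 2*t - s
    \<or> u = 2 * s - 3*t \<and> v = s - t \<or> u = 2 * s - 3*t \<and> v = s - 2*t \<or> u = - s \<and> v = - t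
    \<or> u = s - 3*t \<and> v = - t \<or> u = - s \<and> v = t - s \<or> u = s - 3*t \<and> v = s - 2*t
    \<or> u = 3*t - 2 * s \<and> v = t - s \<or> u = 3*t - 2 * s \<and> v = 2*t - s"
    using assms(3) unfolding g2_orbit_def by (simp only: insert_iff empty_iff prod.inject simp_thms)
  then show ?thesis using assms(1,2,4,5) by (elim disjE conjE; intro conjI; linarith)
qed

text \<open>The six maps are the reflections in the positive roots, in the order of
  \<open>g2_pos_roots\<close>.\<close>

lemma g2_orbit_refl_closed:
  assumes "(u,v) \<in> g2_orbit s t"
  shows "(3 * v - u, v) \<in> g2_orbit s t" "(u, u - v) \<in> g2_orbit s t" "(2*u - 3 * v, u - 2 * v) \<in> g2_orbit s t"
    "(- u, v - u) \<in> g2_orbit s t" "(3 * v - 2*u, 2 * v - u) \<in> g2_orbit s t" "(u - 3 * v, - v) \<in> g2_orbit s t"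
  using assms unfolding g2_orbit_def by (elim insertE emptyE; simp)+

lemma (in cartan) \<kappa>_nondegenerate_H:
  assumes h: "h \<in> H" and z: "\<And>h'. h' \<in> H \<Longrightarrow> \<kappa> h h' = 0"
  shows "h = 0"
proof (rule \<kappa>_nondegenerate)
  fix y
  have "\<kappa> h (Pr f y) = 0" if f: "f \<in> \<Lambda>" for f
  proof (cases "\<forall>h\<in>H. f h = 0")
    case True
    then have "Pr f y \<in> H" using Pr_in[OF f, of y] G_zero ad.gws_cong[of f "\<lambda>_. 0"] by auto
    then show ?thesis by (rule z)
  next
    case False
    then obtain h' where "h' \<in> H" "f h' \<noteq> 0" by blast
    then show ?thesis using \<kappa>_orthogonal[of h "\<lambda>_. 0" "Pr f y" f h'] h G_zero Pr_in[OF f] by auto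
  qed
  then have "(\<Sum>f\<in>\<Lambda>. \<kappa> h (Pr f y)) = 0" by simp
  then show "\<kappa> h y = 0" by (simp add: \<kappa>_sum2[symmetric] Pr_sum)
qed

lemma (in cartan) reflection_root:
  assumes "\<alpha> \<in> roots br H" "\<beta> \<in> roots br H" "\<exists>h\<in>H. reflection br H \<alpha> \<beta> h \<noteq> 0"
  shows "reflection br H \<alpha> \<beta> \<in> roots br H"
  using adjw.reflection_weight(1)[OF assms(1), of \<beta>] assms roots_adm_weights adm_weights by fastforce

locale g2 = cartan br H for br :: "complex^'n \<Rightarrow> complex^'n \<Rightarrow> complex^'n" and H +
  fixes \<alpha>1 \<alpha>2 :: "complex^'n \<Rightarrow> complex"
  assumes base: "g2_base br H \<alpha>1 \<alpha>2"
begin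

abbreviation "h1 \<equiv> coroot br H \<alpha>1"
abbreviation "h2 \<equiv> coroot br H \<alpha>2"

lemma \<alpha>1_root: "\<alpha>1 \<in> roots br H" and \<alpha>2_root: "\<alpha>2 \<in> roots br H"
  using base by (auto simp: g2_base_def)

lemmas simple_wt = root_wt[OF \<alpha>1_root] root_wt[OF \<alpha>2_root]

lemma h1H: "h1 \<in> H" and h2H: "h2 \<in> H"
  using sl2_triple(2) \<alpha>1_root \<alpha>2_root by blast+

lemma cartan_matrix: "\<alpha>1 h1 = 2" "\<alpha>2 h2 = 2" "\<alpha>1 h2 = -1" "\<alpha>2 h1 = -3"
  using base sl2_triple(3)[OF \<alpha>1_root] sl2_triple(3)[OF \<alpha>2_root] by (simp_all add: g2_base_def)

lemma hfun_simple: "hfun H \<alpha>1" "hfun H \<alpha>2"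
  using \<alpha>1_root \<alpha>2_root by (auto simp: roots_def)

definition lam :: "complex \<Rightarrow> complex \<Rightarrow> complex^'n \<Rightarrow> complex" where
  "lam s t x = s * \<alpha>1 x + t * \<alpha>2 x"

text \<open>The coefficients come from inverting the Cartan matrix, so that \<alpha>1 and \<alpha>2
  take the values a and b at this point.\<close>

definition hpt :: "complex \<Rightarrow> complex \<Rightarrow> complex^'n" where
  "hpt a b = (2*a + b) *s h1 + (3*a + 2*b) *s h2"

lemma hpt_H: "hpt a b \<in> H"
  unfolding hpt_def by (intro vec.subspace_add vec.subspace_scale subspace_H h1H h2H)

lemma lin_on_H_hpt:
  assumes "\<And>x y. x \<in> H \<Longrightarrow> y \<in> H \<Longrightarrow> f (x + y) = f x + f y" "\<And>c x. x \<in> H \<Longrightarrow> f (c *s x) = c * f x"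
  shows "f (hpt a b) = (2*a + b) * f h1 + (3*a + 2*b) * f h2"
  unfolding hpt_def using h1H h2H
  by (simp only: assms vec.subspace_scale[OF subspace_H])

lemma \<alpha>_hpt: "\<alpha>1 (hpt a b) = a" "\<alpha>2 (hpt a b) = b"
  using lin_on_H_hpt[of \<alpha>1 a b] lin_on_H_hpt[of \<alpha>2 a b] simple_wt
  by (auto simp: wt_add wt_scale cartan_matrix)

lemma lam_hpt: "lam s t (hpt a b) = s * a + t * b"
  by (simp add: lam_def \<alpha>_hpt)

lemma lam_h: "lam s t h1 = 2 * s - 3*t" "lam s t h2 = 2*t - s"
  by (simp_all add: lam_def cartan_matrix)

lemma hfun_lam: "hfun H (lam s t)"
  using hfun_simple by (auto simp: hfun_def lam_def)

lemma lam_inj: "lam s t = lam s' t' \<longleftrightarrow> s = s' \<and> t = t'"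
  by (metis lam_hpt add_cancel_left_right add_cancel_right_left mult.right_neutral mult_zero_right)

lemma root_lam: "\<beta> \<in> roots br H \<Longrightarrow>
    \<exists>c1 c2::int. \<beta> = lam (of_int c1) (of_int c2) \<and> ((c1 \<ge> 0 \<and> c2 \<ge> 0) \<or> (c1 \<le> 0 \<and> c2 \<le> 0))"
proof -
  assume \<beta>: "\<beta> \<in> roots br H"
  then obtain c1 c2 :: int where c: "\<forall>h\<in>H. \<beta> h = of_int c1 * \<alpha>1 h + of_int c2 * \<alpha>2 h"
      "(c1 \<ge> 0 \<and> c2 \<ge> 0) \<or> (c1 \<le> 0 \<and> c2 \<le> 0)"
    using base unfolding g2_base_def by blast
  have "\<beta> = lam (of_int c1) (of_int c2)"
  proof
    fix x show "\<beta> x = lam (of_int c1) (of_int c2) x"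
    proof (cases "x \<in> H")
      case False
      then show ?thesis using \<beta> hfun_lam by (auto simp: roots_def hfun_def)
    qed (use c in \<open>simp add: lam_def\<close>)
  qed
  then show ?thesis using c(2) by blast
qed

lemma root_coherent:
  "lam (of_int c1) (of_int c2) \<in> roots br H \<Longrightarrow> (c1 \<ge> 0 \<and> c2 \<ge> 0) \<or> (c1 \<le> 0 \<and> c2 \<le> 0)"
  using root_lam[of "lam (of_int c1) (of_int c2)"] by (auto simp: lam_inj)

lemma lam_add: "x \<in> H \<Longrightarrow> y \<in> H \<Longrightarrow> lam s t (x + y) = lam s t x + lam s t y"
  and lam_scale: "x \<in> H \<Longrightarrow> lam s t (c *s x) = c * lam s t x"
  using simple_wt by (auto simp: lam_def wt_add wt_scale algebra_simps)

text \<open>Roots are integral combinations of \<alpha>1 and \<alpha>2 and separate H, so the two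
  simple values determine a point of H.\<close>

lemma H_hpt: "h \<in> H \<Longrightarrow> h = hpt (\<alpha>1 h) (\<alpha>2 h)"
proof -
  assume h: "h \<in> H"
  let ?k = "h + (- 1) *s hpt (\<alpha>1 h) (\<alpha>2 h)"
  have kH: "?k \<in> H" using h hpt_H by (intro vec.subspace_add vec.subspace_scale subspace_H)
  have "\<beta> ?k = 0" if \<beta>: "\<beta> \<in> roots br H" for \<beta>
  proof -
    obtain c1 c2 :: int where c: "\<beta> = lam (of_int c1) (of_int c2)" using root_lam[OF \<beta>] by blast
    have "(-1) *s hpt (\<alpha>1 h) (\<alpha>2 h) \<in> H" using hpt_H by (intro vec.subspace_scale subspace_H)
    then have "lam s t ?k = lam s t h - lam s t (hpt (\<alpha>1 h) (\<alpha>2 h))" for s t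
      using lam_add[OF h, of "(-1) *s hpt (\<alpha>1 h) (\<alpha>2 h)" s t] lam_scale[OF hpt_H, of s t "-1" "\<alpha>1 h" "\<alpha>2 h"] by simp
    then show ?thesis unfolding c by (simp add: lam_hpt) (simp add: lam_def)
  qed
  then have "?k = 0" by (rule roots_separate_H[OF kH])
  then show ?thesis by simp
qed

text \<open>The multipliers of f h1 and f h2 are the fundamental weights 2 \<alpha>1 + \<alpha>2 and
  3 \<alpha>1 + 2 \<alpha>2.\<close>

lemma functional_lam:
  assumes "hfun H f" "\<And>x y. x \<in> H \<Longrightarrow> y \<in> H \<Longrightarrow> f (x + y) = f x + f y" "\<And>c x. x \<in> H \<Longrightarrow> f (c *s x) = c * f x"
  shows "f = lam (2 * f h1 + 3 * f h2) (f h1 + 2 * f h2)"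
proof
  fix x
  show "f x = lam (2 * f h1 + 3 * f h2) (f h1 + 2 * f h2) x"
  proof (cases "x \<in> H")
    case True
    have "f (hpt (\<alpha>1 x) (\<alpha>2 x)) = lam (2 * f h1 + 3 * f h2) (f h1 + 2 * f h2) (hpt (\<alpha>1 x) (\<alpha>2 x))"
      by (simp only: lin_on_H_hpt[of f, OF assms(2,3)] lam_hpt) (simp add: algebra_simps)
    then show ?thesis using H_hpt[OF True] by simp
  next
    case False
    then show ?thesis using assms(1) hfun_lam by (simp add: hfun_def)
  qed
qed

text \<open>Coroots are Killing duals up to scale. Symmetry of \<open>\<kappa> h1 h2\<close> forces
  k1 = 3 k2, so the dual of c1 \<alpha>1 + c2 \<alpha>2 is proportional to c1 h1 + 3 c2 h2. The
  quadratic form is the squared length normalized to 1 at \<alpha>1; it fixes the scale, as a root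
  takes the value 2 at its coroot.\<close>

lemma coroot_lam:
  assumes \<beta>: "lam c1 c2 \<in> roots br H"
  shows "c1\<^sup>2 - 3*c1*c2 + 3*c2\<^sup>2 \<noteq> 0"
    "(c1\<^sup>2 - 3*c1*c2 + 3*c2\<^sup>2) *s coroot br H (lam c1 c2) = c1 *s h1 + (3*c2) *s h2"
proof -
  let ?t = "coroot br H (lam c1 c2)"
  note tH = sl2_triple(2)[OF \<beta>]
  obtain k where k: "\<And>h. h \<in> H \<Longrightarrow> \<kappa> ?t h = k * lam c1 c2 h" using sl2_triple(4)[OF \<beta>] by blast
  obtain k1 where k1: "\<And>h. h \<in> H \<Longrightarrow> \<kappa> h1 h = k1 * \<alpha>1 h" using sl2_triple(4)[OF \<alpha>1_root] by blast
  obtain k2 where k2: "\<And>h. h \<in> H \<Longrightarrow> \<kappa> h2 h = k2 * \<alpha>2 h" using sl2_triple(4)[OF \<alpha>2_root] by blast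
  have k12: "k1 = 3 * k2" using k1[OF h2H] k2[OF h1H] \<kappa>_commute[of h1 h2] by (simp add: cartan_matrix mult.commute)
  have "h2 \<noteq> 0" using cartan_matrix(2) wt_0[OF simple_wt(2)] by auto
  then have k20: "k2 \<noteq> 0" using \<kappa>_nondegenerate_H[OF h2H] k2 by auto
  let ?u = "k1 *s ?t + (- k) *s (c1 *s h1 + (3*c2) *s h2)"
  have uH: "?u \<in> H" using tH h1H h2H by (intro vec.subspace_add vec.subspace_scale subspace_H)
  have "\<kappa> ?u h = 0" if h: "h \<in> H" for h
    by (simp only: \<kappa>_add1 \<kappa>_scale1 k[OF h] k1[OF h] k2[OF h] lam_def k12) (simp add: algebra_simps)
  then have "?u = 0" by (rule \<kappa>_nondegenerate_H[OF uH])
  moreover have "k1 *s ?t - k *s (c1 *s h1 + (3*c2) *s h2) = ?u" by simp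
  ultimately have "k1 *s ?t - k *s (c1 *s h1 + (3*c2) *s h2) = 0" by metis
  then have e: "k1 *s ?t = k *s (c1 *s h1 + (3*c2) *s h2)" by (simp only: right_minus_eq)
  have "lam c1 c2 (k1 *s ?t) = k1 * 2" using lam_scale[OF tH] sl2_triple(3)[OF \<beta>] by simp
  moreover have "lam c1 c2 (k *s (c1 *s h1 + (3*c2) *s h2)) = k * (c1 * (2*c1 - 3*c2) + 3*c2 * (2*c2 - c1))"
    using h1H h2H by (simp add: lam_scale lam_add lam_h vec.subspace_add vec.subspace_scale subspace_H algebra_simps)
  ultimately have "k1 * 2 = k * (c1 * (2*c1 - 3*c2) + 3*c2 * (2*c2 - c1))" using e by simp
  then have "2 * k1 = 2 * (k * (c1\<^sup>2 - 3*c1*c2 + 3*c2\<^sup>2))" by (simp add: power2_eq_square algebra_simps)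
  then have n: "k1 = k * (c1\<^sup>2 - 3*c1*c2 + 3*c2\<^sup>2)" by (simp only: mult_cancel_left) simp
  then show "c1\<^sup>2 - 3*c1*c2 + 3*c2\<^sup>2 \<noteq> 0" using k20 k12 by auto
  have k0: "k \<noteq> 0" using n k20 k12 by auto
  have "k *s ((c1\<^sup>2 - 3*c1*c2 + 3*c2\<^sup>2) *s ?t) = k *s (c1 *s h1 + (3*c2) *s h2)"
    using e unfolding n by (simp only: vec.scale_scale)
  then show "(c1\<^sup>2 - 3*c1*c2 + 3*c2\<^sup>2) *s ?t = c1 *s h1 + (3*c2) *s h2"
    using k0 by (simp only: vec.scale_cancel_left) simp
qed

text \<open>q is the value of the weight at the coroot, specified without division so that an
  integral q can be supplied.\<close>

lemma reflection_lam:
  assumes \<beta>: "lam c1 c2 \<in> roots br H"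
    and q: "q * (c1\<^sup>2 - 3*c1*c2 + 3*c2\<^sup>2) = c1 * (2 * s - 3*t) + 3*c2 * (2*t - s)"
  shows "reflection br H (lam c1 c2) (lam s t) = lam (s - q * c1) (t - q * c2)"
proof -
  let ?N = "c1\<^sup>2 - 3*c1*c2 + 3*c2\<^sup>2" let ?t = "coroot br H (lam c1 c2)"
  note tH = sl2_triple(2)[OF \<beta>]
  have "?N * lam s t ?t = lam s t (c1 *s h1 + (3*c2) *s h2)"
    unfolding coroot_lam(2)[OF \<beta>, symmetric] by (rule lam_scale[OF tH, symmetric])
  also have "\<dots> = c1 * (2 * s - 3*t) + 3*c2 * (2*t - s)"
    using h1H h2H by (simp add: lam_scale lam_add lam_h vec.subspace_scale subspace_H)
  also have "\<dots> = ?N * q" using q by (simp add: mult.commute)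
  finally have "lam s t ?t = q" using coroot_lam(1)[OF \<beta>] by simp
  then show ?thesis by (auto simp: reflection_def lam_def algebra_simps fun_eq_iff)
qed

abbreviation lamZ :: "int \<times> int \<Rightarrow> complex^'n \<Rightarrow> complex" where
  "lamZ p \<equiv> lam (of_int (fst p)) (of_int (snd p))"

lemma inj_lamZ: "inj lamZ"
  by (rule injI) (auto simp: lam_inj prod_eq_iff)

lemma lam_simple [simp]: "lam 1 0 = \<alpha>1" "lam 0 1 = \<alpha>2"
  by (auto simp: lam_def)

lemma lamZ_nonzero: "lamZ (c1, c2) \<in> roots br H \<Longrightarrow> \<not> (c1 = 0 \<and> c2 = 0)"
  using root_nonzero[of "lamZ (c1,c2)"] by (auto simp: lam_def)

lemma reflection_simple:
  "reflection br H \<alpha>1 (lamZ (s, t)) = lamZ (3*t - s, t)"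
  "reflection br H \<alpha>2 (lamZ (s, t)) = lamZ (s, s - t)"
proof -
  show "reflection br H \<alpha>1 (lamZ (s, t)) = lamZ (3*t - s, t)"
    using reflection_lam[of 1 0 "of_int (2 * s - 3*t)" "of_int s" "of_int t"] \<alpha>1_root
    by simp
  show "reflection br H \<alpha>2 (lamZ (s, t)) = lamZ (s, s - t)"
    using reflection_lam[of 0 1 "of_int (2*t - s)" "of_int s" "of_int t"] \<alpha>2_root
    by simp
qed

lemma lamZ_nontrivial: "\<not> (s = 0 \<and> t = 0) \<Longrightarrow> \<exists>h\<in>H. lamZ (s, t) h \<noteq> 0"
  using lam_hpt[of "of_int s" "of_int t" 1 0] lam_hpt[of "of_int s" "of_int t" 0 1] hpt_H
  by (metis add_cancel_left_right add_cancel_right_left fst_conv mult.right_neutral mult_zero_right of_int_eq_0_iff snd_conv)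

lemma simple_reflection_root:
  assumes "lamZ (s, t) \<in> roots br H"
  shows "lamZ (3*t - s, t) \<in> roots br H" "lamZ (s, s - t) \<in> roots br H"
proof -
  have nz: "\<not> (s = 0 \<and> t = 0)" using lamZ_nonzero assms by blast
  show "lamZ (3*t - s, t) \<in> roots br H"
    using reflection_root[OF \<alpha>1_root assms] lamZ_nontrivial[of "3*t - s" t] nz unfolding reflection_simple by auto
  show "lamZ (s, s - t) \<in> roots br H"
    using reflection_root[OF \<alpha>2_root assms] lamZ_nontrivial[of s "s - t"] nz unfolding reflection_simple by auto
qed

lemma pos_roots: "g2_pos_roots \<subseteq> {p. lamZ p \<in> roots br H}"
proof -
  have 1: "lamZ (1,0) \<in> roots br H" "lamZ (0,1) \<in> roots br H"
    using \<alpha>1_root \<alpha>2_root by simp_all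
  have 2: "lamZ (3,1) \<in> roots br H" using simple_reflection_root(1)[OF 1(2)] by simp
  have 3: "lamZ (1,1) \<in> roots br H" using simple_reflection_root(2)[OF 1(1)] by simp
  have 4: "lamZ (2,1) \<in> roots br H" using simple_reflection_root(1)[OF 3] by simp
  have 5: "lamZ (3,2) \<in> roots br H" using simple_reflection_root(2)[OF 2] by simp
  show ?thesis using 1 2 3 4 5 by (simp add: g2_pos_roots_def)
qed

text \<open>Induction on the height. A positive root that is not a multiple of a simple one stays
  positive under both simple reflections by sign coherence, and one of them lowers the height.
  Proper multiples of simple roots are excluded by \<open>root_multiple\<close>.\<close>

lemma pos_root_cases:
  assumes "lamZ (c1, c2) \<in> roots br H" "c1 \<ge> 0" "c2 \<ge> 0"
  shows "(c1, c2) \<in> g2_pos_roots"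
  using assms
proof (induction "nat (c1 + c2)" arbitrary: c1 c2 rule: less_induct)
  case less
  note r = less.prems(1)
  have mult: "False" if c: "c \<ge> 2" "lamZ (x, y) \<in> roots br H" "lamZ (c * x, c * y) \<in> roots br H" for c x y :: int
  proof -
    have "\<forall>h\<in>H. lamZ (c * x, c * y) h = of_nat (nat c) * lamZ (x, y) h"
      using c(1) by (simp add: lam_def algebra_simps)
    moreover have "2 \<le> nat c" using c(1) by linarith
    ultimately show False using root_multiple[OF c(2,3), of "nat c"] by blast
  qed
  have simple: "lamZ (1,0) \<in> roots br H" "lamZ (0,1) \<in> roots br H"
    using \<alpha>1_root \<alpha>2_root by simp_all
  consider "c2 = 0" | "c1 = 0" | "c1 > 0" "c2 > 0" using less.prems by linarith
  then show ?case
  proof cases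
    case 1
    have "c1 \<noteq> 0" using lamZ_nonzero[OF r] 1 by blast
    moreover have "\<not> c1 \<ge> 2" using mult[of c1 1 0] simple(1) r 1 by auto
    ultimately have "c1 = 1" using less.prems by linarith
    then show ?thesis using 1 by (simp add: g2_pos_roots_def)
  next
    case 2
    have "c2 \<noteq> 0" using lamZ_nonzero[OF r] 2 by blast
    moreover have "\<not> c2 \<ge> 2" using mult[of c2 0 1] simple(2) r 2 by auto
    ultimately have "c2 = 1" using less.prems by linarith
    then show ?thesis using 2 by (simp add: g2_pos_roots_def)
  next
    case 3
    note s = simple_reflection_root[OF r]
    have s1: "3*c2 - c1 \<ge> 0" using root_coherent[of "3*c2 - c1" c2] s(1) 3 by auto
    have s2: "c1 - c2 \<ge> 0" using root_coherent[of c1 "c1 - c2"] s(2) 3 by auto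
    show ?thesis
    proof (cases "3*c2 - c1 < c1")
      case True
      then have "(3*c2 - c1, c2) \<in> g2_pos_roots"
        by (intro less.hyps) (use s(1) s1 3 in auto)
      then show ?thesis using 3 by (auto simp: g2_pos_roots_def)
    next
      case False
      \<comment> \<open>Here 2 c1 <= 3 c2 < 4 c2, so the second reflection lowers the
        height.\<close>
      then have "c1 - c2 < c2" using 3 by linarith
      then have "(c1, c1 - c2) \<in> g2_pos_roots"
        by (intro less.hyps) (use s(2) s2 3 in auto)
      then show ?thesis using 3 by (auto simp: g2_pos_roots_def)
    qed
  qed
qed

definition g2_roots :: "(int \<times> int) set" where
  "g2_roots = {(1,0), (0,1), (1,1), (2,1), (3,1), (3,2), (-1,0), (0,-1), (-1,-1), (-2,-1), (-3,-1), (-3,-2)}"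

lemma roots_g2: "roots br H = lamZ ` g2_roots"
proof (intro set_eqI iffI)
  fix \<beta> assume \<beta>: "\<beta> \<in> roots br H"
  obtain c1 c2 :: int where c: "\<beta> = lamZ (c1, c2)" "(c1 \<ge> 0 \<and> c2 \<ge> 0) \<or> (c1 \<le> 0 \<and> c2 \<le> 0)"
    using root_lam[OF \<beta>] by auto
  from c(2) have "(c1, c2) \<in> g2_roots"
  proof
    assume "c1 \<ge> 0 \<and> c2 \<ge> 0"
    then show ?thesis using pos_root_cases[of c1 c2] \<beta> c(1) by (auto simp: g2_pos_roots_def g2_roots_def)
  next
    assume n: "c1 \<le> 0 \<and> c2 \<le> 0"
    have "(\<lambda>t. - \<beta> t) = lamZ (- c1, - c2)" by (auto simp: c(1) lam_def)
    then have "lamZ (- c1, - c2) \<in> roots br H" using root_neg[OF \<beta>] by simp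
    then have "(- c1, - c2) \<in> g2_pos_roots" using n by (intro pos_root_cases) auto
    then show ?thesis unfolding g2_pos_roots_def g2_roots_def insert_iff empty_iff prod.inject by presburger
  qed
  then show "\<beta> \<in> lamZ ` g2_roots" using c(1) by blast
next
  fix \<beta> assume "\<beta> \<in> lamZ ` g2_roots"
  then obtain p where p: "p \<in> g2_roots" "\<beta> = lamZ p" by blast
  show "\<beta> \<in> roots br H"
  proof (cases "p \<in> g2_pos_roots")
    case True then show ?thesis using pos_roots p by blast
  next
    case False
    moreover obtain a b where ab: "p = (a, b)" by (cases p)
    ultimately have "(- fst p, - snd p) \<in> g2_pos_roots" using p(1)
      unfolding ab fst_conv snd_conv g2_pos_roots_def g2_roots_def insert_iff empty_iff prod.inject by presburger
    then have "lamZ (- fst p, - snd p) \<in> roots br H" using pos_roots by blast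
    from root_neg[OF this] have "(\<lambda>t. - lamZ (- fst p, - snd p) t) \<in> roots br H" .
    moreover have "(\<lambda>t. - lamZ (- fst p, - snd p) t) = lamZ p" by (auto simp: lam_def)
    ultimately show ?thesis using p(2) by simp
  qed
qed

lemma reflection_g2:
  assumes "p \<in> g2_roots"
  shows "reflection br H (lamZ p) (lamZ (u, v)) \<in>
    lamZ ` {(3 * v - u, v), (u, u - v), (2*u - 3 * v, u - 2 * v), (- u, v - u), (3 * v - 2*u, 2 * v - u), (u - 3 * v, - v)}"
proof -
  have r: "lamZ p \<in> roots br H" using assms roots_g2 by blast
  note R = reflection_lam[of "of_int (fst p)" "of_int (snd p)" _ "of_int u" "of_int v", OF r]
  have "\<exists>q::int. q * ((fst p)\<^sup>2 - 3 * fst p * snd p + 3 * (snd p)\<^sup>2) = fst p * (2*u - 3 * v) + 3 * snd p * (2 * v - u)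
     \<and> (u - q * fst p, v - q * snd p) \<in>
     {(3 * v - u, v), (u, u - v), (2*u - 3 * v, u - 2 * v), (- u, v - u), (3 * v - 2*u, 2 * v - u), (u - 3 * v, - v)}"
    (is "\<exists>q. ?P q")
  proof -
    let ?n = "(fst p)\<^sup>2 - 3 * fst p * snd p + 3 * (snd p)\<^sup>2"
    let ?m = "fst p * (2*u - 3 * v) + 3 * snd p * (2 * v - u)"
    consider "p \<in> {(1,0), (-1,0)}" | "p \<in> {(0,1), (0,-1)}" | "p \<in> {(1,1), (-1,-1)}"
      | "p \<in> {(2,1), (-2,-1)}" | "p \<in> {(3,1), (-3,-1)}" | "p \<in> {(3,2), (-3,-2)}"
      using assms unfolding g2_roots_def by blast
    then show ?thesis
    proof cases
      case 1 then show ?thesis by (intro exI[of _ "fst p * (2*u - 3 * v)"]) auto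
    next
      case 2 then show ?thesis by (intro exI[of _ "snd p * (2 * v - u)"]) auto
    next
      case 3 then show ?thesis by (intro exI[of _ "snd p * (3 * v - u)"]) auto
    next
      case 4 then show ?thesis by (intro exI[of _ "snd p * u"]) auto
    next
      case 5 then show ?thesis by (intro exI[of _ "snd p * (u - v)"]) auto
    next
      case 6
      then show ?thesis
      proof (elim insertE emptyE)
        assume "p = (3, 2)" then show ?thesis by (intro exI[of _ v]) simp
      next
        assume "p = (-3, -2)" then show ?thesis by (intro exI[of _ "- v"]) simp
      qed
    qed
  qed
  then obtain q where q: "?P q" by blast
  have "reflection br H (lamZ p) (lamZ (u, v)) = lamZ (u - q * fst p, v - q * snd p)"
  proof -
    have "of_int q * ((of_int (fst p))\<^sup>2 - 3 * of_int (fst p) * of_int (snd p) + 3 * (of_int (snd p))\<^sup>2)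
       = of_int (fst p) * (2 * of_int u - 3 * of_int v) + 3 * of_int (snd p) * (2 * of_int v - of_int u :: complex)"
      using arg_cong[OF conjunct1[OF q], of "of_int :: int \<Rightarrow> complex"] by simp
    from R[OF this] show ?thesis by simp
  qed
  then show ?thesis using q by blast
qed

text \<open>The twelve points are closed under all six reflections, and two chains of alternating
  simple reflections from (s, t) reach all of them.\<close>

lemma weyl_orbit_g2: "weyl_orbit br H (lamZ (s, t)) = lamZ ` g2_orbit s t"
proof (intro equalityI subsetI)
  fix \<nu> assume "\<nu> \<in> weyl_orbit br H (lamZ (s, t))"
  then show "\<nu> \<in> lamZ ` g2_orbit s t"
  proof induction
    case self
    then show ?case by (simp add: g2_orbit_def)
  next
    case (refl \<nu> \<alpha>)
    obtain u v where uv: "\<nu> = lamZ (u, v)" "(u, v) \<in> g2_orbit s t" using refl.IH by auto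
    obtain p where p: "p \<in> g2_roots" "\<alpha> = lamZ p" using refl.hyps(2) roots_g2 by blast
    have "{(3 * v - u, v), (u, u - v), (2*u - 3 * v, u - 2 * v), (- u, v - u), (3 * v - 2*u, 2 * v - u), (u - 3 * v, - v)}
        \<subseteq> g2_orbit s t" using g2_orbit_refl_closed[OF uv(2)] by simp
    then have "lamZ ` {(3 * v - u, v), (u, u - v), (2*u - 3 * v, u - 2 * v), (- u, v - u), (3 * v - 2*u, 2 * v - u), (u - 3 * v, - v)}
        \<subseteq> lamZ ` g2_orbit s t" by (rule image_mono)
    then show ?case using reflection_g2[OF p(1), of u v] unfolding p(2) uv(1) by (rule subsetD)
  qed
next
  let ?O = "weyl_orbit br H (lamZ (s, t))"
  have s: "lamZ (3 * v - u, v) \<in> ?O" "lamZ (u, u - v) \<in> ?O" if "lamZ (u, v) \<in> ?O" for u v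
    using weyl_orbit.refl[OF that \<alpha>1_root] weyl_orbit.refl[OF that \<alpha>2_root] unfolding reflection_simple by blast+
  have s1: "lamZ (u', v) \<in> ?O" if "lamZ (u, v) \<in> ?O" "u' = 3 * v - u" for u v u' using s(1)[OF that(1)] that(2) by simp
  have s2: "lamZ (u, v') \<in> ?O" if "lamZ (u, v) \<in> ?O" "v' = u - v" for u v v' using s(2)[OF that(1)] that(2) by simp
  have 0: "lamZ (s, t) \<in> ?O" by (rule weyl_orbit.self)
  have a1: "lamZ (3*t - s, t) \<in> ?O" by (rule s1[OF 0]) simp
  have a2: "lamZ (3*t - s, 2*t - s) \<in> ?O" by (rule s2[OF a1]) simp
  have a3: "lamZ (3*t - 2 * s, 2*t - s) \<in> ?O" by (rule s1[OF a2]) simp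
  have a4: "lamZ (3*t - 2 * s, t - s) \<in> ?O" by (rule s2[OF a3]) simp
  have a5: "lamZ (- s, t - s) \<in> ?O" by (rule s1[OF a4]) simp
  have a6: "lamZ (- s, - t) \<in> ?O" by (rule s2[OF a5]) simp
  have b1: "lamZ (s, s - t) \<in> ?O" by (rule s2[OF 0]) simp
  have b2: "lamZ (2 * s - 3*t, s - t) \<in> ?O" by (rule s1[OF b1]) simp
  have b3: "lamZ (2 * s - 3*t, s - 2*t) \<in> ?O" by (rule s2[OF b2]) simp
  have b4: "lamZ (s - 3*t, s - 2*t) \<in> ?O" by (rule s1[OF b3]) simp
  have b5: "lamZ (s - 3*t, - t) \<in> ?O" by (rule s2[OF b4]) simp
  fix \<nu> assume "\<nu> \<in> lamZ ` g2_orbit s t"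
  then show "\<nu> \<in> ?O"
    unfolding g2_orbit_def using 0 a1 a2 a3 a4 a5 a6 b1 b2 b3 b4 b5 by blast
qed

lemma dominant_lamZ: "dominant br H \<alpha>1 \<alpha>2 (lamZ (s, t)) \<longleftrightarrow> 2 * s - 3*t \<ge> 0 \<and> 2*t - s \<ge> 0"
proof -
  have nat: "(of_int i :: complex) \<in> \<nat> \<longleftrightarrow> i \<ge> 0" for i :: int
  proof
    assume "(of_int i :: complex) \<in> \<nat>"
    then obtain n where "(of_int i :: complex) = of_nat n" by (auto elim: Nats_cases)
    then have "(of_int i :: complex) = of_int (int n)" by simp
    then have "i = int n" unfolding of_int_eq_iff .
    then show "i \<ge> 0" by simp
  next
    assume "i \<ge> 0"
    then obtain n where "i = int n" by (rule nonneg_int_cases)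
    then show "(of_int i :: complex) \<in> \<nat>" by simp
  qed
  show ?thesis using nat[of "2 * s - 3*t"] nat[of "2*t - s"] by (simp add: dominant_def lam_h)
qed

text \<open>The Cartan matrix of G2 has determinant 1, so the weight and root lattices coincide:
  integral values at h1 and h2 give integral coordinates.\<close>

lemma weight_lamZ:
  assumes "weight_rep br H \<phi>" "\<nu> \<in> rep_weights H \<phi>"
  shows "\<exists>p. \<nu> = lamZ p"
proof -
  interpret weight_rep br H \<phi> by (rule assms)
  obtain m n where mn: "\<nu> h1 = of_int m" "\<nu> h2 = of_int n"
    using weight_integral[OF \<alpha>1_root assms(2)] weight_integral[OF \<alpha>2_root assms(2)] by (auto elim!: Ints_cases)
  have "\<nu> = lam (2 * \<nu> h1 + 3 * \<nu> h2) (\<nu> h1 + 2 * \<nu> h2)"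
  proof (rule functional_lam)
    show "hfun H \<nu>" using assms(2) by (simp add: rep_weights_def)
  qed (simp_all add: W_add[OF assms(2)] W_scale[OF assms(2)])
  then have "\<nu> = lamZ (2 * m + 3 * n, m + 2 * n)" by (simp add: mn)
  then show ?thesis by blast
qed

end

text \<open>The exponent is positive so that the space of weight 0 contributes nothing.\<close>

lemma (in cartan) trace_ad_power:
  assumes h: "h \<in> H"
  shows "ftr (br h ^^ Suc k) = (\<Sum>\<beta>\<in>roots br H. \<beta> h ^ Suc k)"
proof -
  let ?T = "br h ^^ Suc k"
  have lT: "lin ?T" by (rule lin_funpow[OF lin_br2])
  have root: "ftr (\<lambda>v. ?T (Pr f v)) = f h ^ Suc k" if f: "f \<in> roots br H" for f
  proof -
    note fL = root_wt[OF f]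
    have e: "(br h ^^ j) u = f h ^ j *s u" if "u \<in> G f" for u j
      using that h unfolding root_space_eq_G[OF f, symmetric] root_space_def
      by (induction j) (auto simp: br_scale2)
    have "d f = 1" using nonzero_wt_root(1) f by (auto simp: roots_eq)
    moreover have "ftr (\<lambda>v. ?T (Pr f v)) = f h ^ Suc k * of_nat (vec.dim (G f))"
    proof (rule ftr_gen_eigenspace[OF Pr_proj[OF fL] ad.subspace_gws lT])
      show "?T ` G f \<subseteq> G f" using e[of _ "Suc k"] vec.subspace_scale[OF ad.subspace_gws] by (metis image_subsetI)
      show "evnil (shift ?T (f h ^ Suc k)) u" if "u \<in> G f" for u
        using e[OF that, of "Suc k"] by (rule evnil_shift_eigen)
    qed
    ultimately show ?thesis by (simp add: d_def)
  qed
  have zero: "ftr (\<lambda>v. ?T (Pr f v)) = 0" if f: "f \<in> \<Lambda> - roots br H" for f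
  proof -
    have "G f = H" using f G_zero ad.gws_cong[of f "\<lambda>_. 0"] by (auto simp: roots_eq)
    then have "br h (Pr f v) = 0" for v using Pr_in[of f v] f H_abelian[OF h] by auto
    then have "?T (Pr f v) = 0" for v
      using vec.linear_0[OF lin_funpow[OF lin_br2], of k h] by (simp add: funpow_swap1)
    then show ?thesis by (simp only: ftr_zero)
  qed
  have "ftr ?T = (\<Sum>f\<in>\<Lambda>. ftr (\<lambda>v. ?T (Pr f v)))" by (rule ftr_decompose[OF lT])
  also have "\<dots> = (\<Sum>f\<in>roots br H. ftr (\<lambda>v. ?T (Pr f v)))"
    by (rule sum.mono_neutral_right) (use ad.finite_wts zero root_wt in auto)
  also have "\<dots> = (\<Sum>f\<in>roots br H. f h ^ Suc k)" using root by (intro sum.cong) auto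
  finally show ?thesis .
qed

section \<open>Bases of weight vectors and the determinant on H\<close>

lemma indep_fam_basis:
  assumes ind: "indep_fam I U" and sp: "vec.span (\<Union>i\<in>I. U i) = UNIV"
    and B: "\<And>i. i \<in> I \<Longrightarrow> B i \<subseteq> U i \<and> vec.independent (B i) \<and> U i \<subseteq> vec.span (B i)"
  shows "vec.independent (\<Union>i\<in>I. B i)" "vec.span (\<Union>i\<in>I. B i) = UNIV"
    "\<And>i j. i \<in> I \<Longrightarrow> j \<in> I \<Longrightarrow> i \<noteq> j \<Longrightarrow> B i \<inter> B j = {}"
proof -
  have fin: "finite (B i)" if "i \<in> I" for i using B[OF that] vec.finiteI_independent by blast
  have finI: "finite I" using ind by (simp add: indep_fam_def)
  have sub: "vec.subspace (U i)" if "i \<in> I" for i using ind that by (simp add: indep_fam_def)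
  have zero: "\<forall>i\<in>I. v i = 0" if "\<forall>i\<in>I. v i \<in> U i" "(\<Sum>i\<in>I. v i) = 0" for v
    using ind that unfolding indep_fam_def by blast
  show disj: "B i \<inter> B j = {}" if ij: "i \<in> I" "j \<in> I" "i \<noteq> j" for i j
  proof (rule ccontr)
    assume "B i \<inter> B j \<noteq> {}"
    then obtain b where b: "b \<in> B i" "b \<in> B j" by blast
    let ?v = "\<lambda>k. if k = i then b else if k = j then - b else 0"
    have "(\<Sum>k\<in>I. ?v k) = (\<Sum>k\<in>{i,j}. ?v k)"
      using finI ij by (intro sum.mono_neutral_right) auto
    also have "\<dots> = 0" using ij by simp
    finally have s: "(\<Sum>k\<in>I. ?v k) = 0" .
    have "\<forall>k\<in>I. ?v k \<in> U k"
      using b B ij sub by (auto simp: vec.subspace_0 intro!: vec.subspace_neg)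
    from zero[OF this s] ij have "b = 0" by auto
    then show False using b(1) B[OF ij(1)] vec.dependent_zero by blast
  qed
  show "vec.independent (\<Union>i\<in>I. B i)"
  proof (rule vec.independent_if_scalars_zero)
    show "finite (\<Union>i\<in>I. B i)" using finI fin by blast
    fix c x assume c: "(\<Sum>x\<in>(\<Union>i\<in>I. B i). c x *s x) = 0" and x: "x \<in> (\<Union>i\<in>I. B i)"
    have "(\<Sum>x\<in>(\<Union>i\<in>I. B i). c x *s x) = (\<Sum>i\<in>I. \<Sum>x\<in>B i. c x *s x)"
      by (rule sum.UNION_disjoint) (use finI fin disj in auto)
    then have s: "(\<Sum>i\<in>I. \<Sum>x\<in>B i. c x *s x) = 0" using c by simp
    have "\<forall>i\<in>I. (\<Sum>x\<in>B i. c x *s x) \<in> U i"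
      using B sub by (auto intro!: vec.subspace_sum vec.subspace_scale)
    from zero[OF this s] have z: "(\<Sum>x\<in>B i. c x *s x) = 0" if "i \<in> I" for i using that by blast
    obtain i where i: "i \<in> I" "x \<in> B i" using x by blast
    show "c x = 0"
      using vec.independentD[OF _ fin[OF i(1)] subset_refl z[OF i(1)] i(2)] B[OF i(1)] by blast
  qed
  have "(\<Union>i\<in>I. U i) \<subseteq> vec.span (\<Union>i\<in>I. B i)"
  proof clarify
    fix i x assume i: "i \<in> I" "x \<in> U i"
    then have "x \<in> vec.span (B i)" using B by blast
    also have "\<dots> \<subseteq> vec.span (\<Union>i\<in>I. B i)" using i by (intro vec.span_mono) blast
    finally show "x \<in> vec.span (\<Union>i\<in>I. B i)" .
  qed
  then show "vec.span (\<Union>i\<in>I. B i) = UNIV" using sp vec.span_minimal[OF _ vec.subspace_span] by blast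
qed

lemma matrix_vector_mult_axis: "((A :: complex^'n^'m) *v axis j 1) $ i = A $ i $ j"
  by (simp add: matrix_vector_mult_def axis_def if_distrib[of "\<lambda>x. _ * x"] cong: if_cong)

lemma (in weight_rep) det_on_H:
  assumes h: "h \<in> H"
  shows "det (mat z + \<phi> h) = (\<Prod>\<nu>\<in>W. (z + \<nu> h) ^ weight_mult H \<phi> \<nu>)"
proof -
  have "\<forall>\<nu>. \<exists>B. B \<subseteq> ws \<nu> \<and> vec.independent B \<and> ws \<nu> \<subseteq> vec.span B \<and> card B = vec.dim (ws \<nu>)"
    using vec.basis_exists by metis
  then obtain B where B: "\<And>\<nu>. B \<nu> \<subseteq> ws \<nu> \<and> vec.independent (B \<nu>) \<and> ws \<nu> \<subseteq> vec.span (B \<nu>)"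
      "\<And>\<nu>. card (B \<nu>) = vec.dim (ws \<nu>)" by metis
  note basis = indep_fam_basis[OF indep_ws wspan, of B, OF B(1)]
  let ?B = "\<Union>\<nu>\<in>W. B \<nu>"
  have finB: "finite ?B" using vec.finiteI_independent[OF basis(1)] .
  have finBn: "finite (B \<nu>)" for \<nu> using B(1) vec.finiteI_independent by blast
  have "card ?B = CARD('d)"
    using vec.dim_eq_card_independent[OF basis(1)] vec.dim_span[of ?B] unfolding basis(2) vec_dim_card by simp
  then obtain f where f: "bij_betw f (UNIV :: 'd set) ?B"
    using finite_same_card_bij[of "UNIV :: 'd set" ?B] finB by auto
  have "\<forall>b\<in>?B. \<exists>\<nu>. \<nu> \<in> W \<and> b \<in> B \<nu>" by blast
  then obtain wt where wt: "\<And>b. b \<in> ?B \<Longrightarrow> wt b \<in> W \<and> b \<in> B (wt b)" by metis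
  have wt_eq: "wt b = \<nu>" if "\<nu> \<in> W" "b \<in> B \<nu>" for b \<nu>
  proof -
    have "b \<in> ?B" using that by blast
    then show ?thesis using wt[of b] basis(3)[of "wt b" \<nu>] that by blast
  qed
  define P :: "complex^'d^'d" where "P = (\<chi> i j. f j $ i)"
  define D :: "complex^'d^'d" where "D = (\<chi> i j. if i = j then z + wt (f j) h else 0)"
  have col: "P *v axis j 1 = f j" for j
    by (simp add: P_def vec_eq_iff matrix_vector_mult_axis)
  have fB: "f j \<in> ?B" for j using f by (auto simp: bij_betw_def)
  have ev: "(mat z + \<phi> h) *v f j = (z + wt (f j) h) *s f j" for j
  proof -
    have "f j \<in> ws (wt (f j))" using wt[OF fB] B(1) by blast
    then show ?thesis
      using h by (simp add: matrix_vector_mult_add_rdistrib mat_scalar_vec weight_space_def vec.scale_left_distrib)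
  qed
  have "(mat z + \<phi> h) ** P = P ** D"
  proof (rule matrix_eq[THEN iffD2], rule allI)
    fix v :: "complex^'d"
    let ?L = "\<lambda>v. ((mat z + \<phi> h) ** P) *v v" and ?R = "\<lambda>v. (P ** D) *v v"
    have "?L (axis j 1) = ?R (axis j 1)" for j
    proof -
      have "D *v axis j 1 = (z + wt (f j) h) *s axis j 1"
        by (simp add: vec_eq_iff matrix_vector_mult_axis) (simp add: D_def axis_def)
      then show ?thesis
        by (simp only: matrix_vector_mul_assoc[symmetric] col ev vec.linear_scale[OF matrix_vector_mul_linear_gen])
    qed
    moreover have "v = (\<Sum>j\<in>UNIV. v $ j *s axis j 1)" by (simp add: basis_expansion)
    ultimately show "?L v = ?R v"
      by (metis (mono_tags, lifting) sum.cong vec.linear_scale[OF matrix_vector_mul_linear_gen]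
          vec.linear_sum[OF matrix_vector_mul_linear_gen])
  qed
  then have "det (mat z + \<phi> h) * det P = det P * det D" by (metis det_mul)
  moreover have "det P \<noteq> 0"
  proof -
    have "surj ((*v) P)"
    proof -
      have "?B \<subseteq> range ((*v) P)" 
      proof
        fix b assume "b \<in> ?B"
        then have "b \<in> range f" using f by (simp add: bij_betw_def)
        then obtain j where "b = P *v axis j 1" using col by auto
        then show "b \<in> range ((*v) P)" by blast
      qed
      then have "vec.span ?B \<subseteq> range ((*v) P)"
        by (rule vec.span_minimal) (intro vec.linear_subspace_image[OF matrix_vector_mul_linear_gen] vec.subspace_UNIV)
      then show ?thesis using basis(2) by blast
    qed
    then have "\<exists>Q. P ** Q = mat 1" using matrix_right_invertible_surjective by blast
    then have "invertible P" by (simp add: invertible_right_inverse)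
    then show ?thesis by (simp add: invertible_det_nz)
  qed
  ultimately have "det (mat z + \<phi> h) = det D" by simp
  also have "det D = (\<Prod>j\<in>UNIV. z + wt (f j) h)"
    by (subst det_diagonal) (simp_all add: D_def)
  also have "\<dots> = (\<Prod>b\<in>?B. z + wt b h)" using prod.reindex_bij_betw[OF f, of "\<lambda>b. z + wt b h"] .
  also have "\<dots> = (\<Prod>\<nu>\<in>W. \<Prod>b\<in>B \<nu>. z + wt b h)"
    by (rule prod.UNION_disjoint) (use finite_W finBn basis(3) in auto)
  also have "\<dots> = (\<Prod>\<nu>\<in>W. (z + \<nu> h) ^ weight_mult H \<phi> \<nu>)"
  proof (rule prod.cong[OF HOL.refl])
    fix \<nu> assume \<nu>: "\<nu> \<in> W"
    have "(\<Prod>b\<in>B \<nu>. z + wt b h) = (\<Prod>b\<in>B \<nu>. z + \<nu> h)"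
      by (rule prod.cong[OF HOL.refl]) (simp add: wt_eq[OF \<nu>])
    then show "(\<Prod>b\<in>B \<nu>. z + wt b h) = (z + \<nu> h) ^ weight_mult H \<phi> \<nu>"
      by (simp add: B(2) weight_mult_def)
  qed
  finally show ?thesis .
qed

section \<open>Density of the conjugates of \<open>H\<close>\<close>

lemma scaleR_eq_scale: "r *\<^sub>R (x :: complex^'n) = of_real r *s x"
  by (simp add: vec_eq_iff scaleR_conv_of_real[where 'a = complex])

lemma lin_bounded_linear: "lin T \<Longrightarrow> bounded_linear (T :: complex^'n \<Rightarrow> complex^'m)"
  unfolding linear_conv_bounded_linear[symmetric]
  by (rule linearI) (simp_all add: vec.linear_add vec.linear_scale scaleR_eq_scale)

text \<open>A polynomial restriction to every complex line is enough for the identity theorem below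
  and easy to check for evaluations of polynomials in L.\<close>

definition line_poly :: "(complex^'n \<Rightarrow> complex) \<Rightarrow> bool" where
  "line_poly F \<longleftrightarrow> (\<forall>x v. polycurve (\<lambda>t. F (x + t *s v)))"

text \<open>On the line through x0 and x the parameters \<epsilon> / (N (n + 1)) give infinitely
  many zeros inside the ball.\<close>

lemma line_poly_zero_ball:
  fixes F :: "complex^'a \<Rightarrow> complex"
  assumes F: "line_poly F" and z: "\<And>x. dist x0 x < \<epsilon> \<Longrightarrow> F x = 0" "\<epsilon> > 0"
  shows "F x = 0"
proof -
  let ?g = "\<lambda>t. F (x0 + t *s (x - x0))"
  have pc: "polycurve ?g" using F unfolding line_poly_def by blast
  define N where "N = norm (x - x0) + 1"
  have N: "N > 0" by (simp add: N_def add_nonneg_pos)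
  have sub: "(\<lambda>n. of_real (\<epsilon> / (N * of_nat (Suc n)))) ` (UNIV :: nat set) \<subseteq> {t. ?g t = 0}"
  proof clarify
    fix n :: nat
    let ?r = "\<epsilon> / (N * of_nat (Suc n))"
    have r: "?r > 0" using N z(2) by simp
    have "dist x0 (x0 + w) = norm w" for w :: "complex^'a"
      by (simp add: dist_norm norm_minus_commute)
    then have "dist x0 (x0 + of_real ?r *s (x - x0)) = norm (?r *\<^sub>R (x - x0))"
      unfolding scaleR_eq_scale .
    also have "\<dots> = ?r * norm (x - x0)" by (simp only: norm_scaleR abs_of_pos[OF r])
    also have "\<dots> < ?r * N" by (rule mult_strict_left_mono[OF _ r]) (simp add: N_def)
    also have "\<dots> = \<epsilon> / of_nat (Suc n)" using N by simp
    also have "\<dots> \<le> \<epsilon> / 1" using z(2) by (intro divide_left_mono) auto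
    also have "\<dots> = \<epsilon>" by simp
    finally show "?g (of_real ?r) = 0" by (rule z(1))
  qed
  have "inj (\<lambda>n. of_real (\<epsilon> / (N * of_nat (Suc n))) :: complex)"
  proof (rule injI)
    fix m n :: nat assume "(of_real (\<epsilon> / (N * of_nat (Suc m))) :: complex) = of_real (\<epsilon> / (N * of_nat (Suc n)))"
    then have "\<epsilon> / (N * of_nat (Suc m)) = \<epsilon> / (N * of_nat (Suc n))" unfolding of_real_eq_iff .
    then show "m = n" using N z(2) by (simp add: field_simps)
  qed
  then have "infinite {t. ?g t = 0}" using sub range_inj_infinite infinite_super by blast
  from polycurve_zero[OF pc this, of 1] show ?thesis by simp
qed

context simple_lie begin

lemma bounded_bilinear_br: "bounded_bilinear br"
proof -
  have "bilinear br"
    unfolding bilinear_def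
    using lin_bounded_linear[OF lin_br1] lin_bounded_linear[OF lin_br2]
    by (simp add: linear_conv_bounded_linear)
  then show ?thesis by (simp add: bilinear_conv_bounded_bilinear)
qed

text \<open>Summands with k >= 2 contain at least two factors that vanish at x0, so only k = 0 and k
  = 1 contribute to the derivative.\<close>

lemma exp_ad_has_derivative:
  assumes A: "lin A" "A x0 = 0" and \<Psi>: "(\<Psi> has_derivative \<Psi>') (at x0)"
  shows "((\<lambda>x. exp_ad br (A x) (\<Psi> x)) has_derivative (\<lambda>x. \<Psi>' x + br (A x) (\<Psi> x0))) (at x0)"
proof -
  let ?g = "\<lambda>k x. (br (A x) ^^ k) (\<Psi> x)"
  define g' where "g' k x = (if k = 0 then \<Psi>' x else if k = 1 then br (A x) (\<Psi> x0) else 0)" for k :: nat and x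
  have dA: "(A has_derivative A) (at x0)" by (rule bounded_linear_imp_has_derivative[OF lin_bounded_linear[OF A(1)]])
  have g: "(?g k has_derivative g' k) (at x0)" for k
  proof (induction k)
    case 0
    then show ?case using \<Psi> by (simp add: g'_def[abs_def])
  next
    case (Suc k)
    have "((\<lambda>x. br (A x) (?g k x)) has_derivative (\<lambda>x. br (A x0) (g' k x) + br (A x) (?g k x0))) (at x0)"
      by (rule bounded_bilinear.FDERIV[OF bounded_bilinear_br dA Suc])
    moreover have "(\<lambda>x. br (A x0) (g' k x) + br (A x) (?g k x0)) = g' (Suc k)"
      by (cases k) (auto simp: g'_def A(2))
    ultimately show ?case by simp
  qed
  have "((\<lambda>x. \<Sum>k\<le>CARD('n). inverse (fact k) *\<^sub>R ?g k x) has_derivative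
      (\<lambda>x. \<Sum>k\<le>CARD('n). inverse (fact k) *\<^sub>R g' k x)) (at x0)"
    by (intro has_derivative_sum has_derivative_scaleR_right g)
  moreover have "(\<Sum>k\<le>CARD('n). inverse (fact k) *\<^sub>R g' k x) = \<Psi>' x + br (A x) (\<Psi> x0)" for x
  proof -
    have c: "1 \<le> CARD('n)" by (simp add: Suc_leI)
    have "(\<Sum>k\<le>CARD('n). inverse (fact k) *\<^sub>R g' k x) = (\<Sum>k\<in>{0,1}. inverse (fact k) *\<^sub>R g' k x)"
      by (rule sum.mono_neutral_right) (use c in \<open>auto simp: g'_def\<close>)
    then show ?thesis by (simp add: g'_def)
  qed
  moreover have "exp_ad br (A x) (\<Psi> x) = (\<Sum>k\<le>CARD('n). inverse (fact k) *\<^sub>R ?g k x)" for x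
    by (simp add: exp_ad_def scaleR_eq_scale)
  ultimately show ?thesis by simp
qed

lemma exp_ad_continuous:
  assumes A: "lin A" and \<Psi>: "continuous_on UNIV \<Psi>"
  shows "continuous_on UNIV (\<lambda>x. exp_ad br (A x) (\<Psi> x))"
proof -
  have cA: "continuous_on UNIV A" using lin_bounded_linear[OF A] by (rule linear_continuous_on)
  have g: "continuous_on UNIV (\<lambda>x. (br (A x) ^^ k) (\<Psi> x))" for k
    by (induction k) (auto intro: \<Psi> bounded_bilinear.continuous_on[OF bounded_bilinear_br cA])
  have "exp_ad br (A x) (\<Psi> x) = (\<Sum>k\<le>CARD('n). inverse (fact k) *\<^sub>R (br (A x) ^^ k) (\<Psi> x))" for x
    by (simp add: exp_ad_def scaleR_eq_scale)
  then show ?thesis by (simp only:) (intro continuous_intros g)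
qed

end

context cartan begin

text \<open>The map \<open>L \<mapsto> exp (ad L\<^sub>\<beta>\<^sub>1) \<dots> exp (ad L\<^sub>\<beta>\<^sub>m) L\<^sub>0\<close>, built from the components of \<open>L\<close> in the
  root spaces and in \<open>H\<close>, is open at a regular element of \<open>H\<close>.\<close>

definition Pr0 :: "complex^'n \<Rightarrow> complex^'n" where
  "Pr0 L = (\<Sum>f\<in>\<Lambda> - roots br H. Pr f L)"

lemma Pr0_H: "Pr0 L \<in> H"
  unfolding Pr0_def
proof (rule vec.subspace_sum[OF subspace_H])
  fix f assume f: "f \<in> \<Lambda> - roots br H"
  then have "G f = H" using G_zero ad.gws_cong[of f "\<lambda>_. 0"] by (auto simp: roots_eq)
  then show "Pr f L \<in> H" using Pr_in f by blast
qed

lemma lin_Pr0: "lin Pr0"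
proof (rule linI)
  have L: "f \<in> \<Lambda> - roots br H \<Longrightarrow> lin (Pr f)" for f using Pr_lin by blast
  show "Pr0 (x + y) = Pr0 x + Pr0 y" for x y
    unfolding Pr0_def sum.distrib[symmetric] by (rule sum.cong) (auto simp: vec.linear_add[OF L])
  show "Pr0 (c *s x) = c *s Pr0 x" for c x
    unfolding Pr0_def vec.scale_sum_right by (rule sum.cong) (auto simp: vec.linear_scale[OF L])
qed

lemma Pr_H: "f \<in> roots br H \<Longrightarrow> h \<in> H \<Longrightarrow> Pr f h = 0"
  using Pr_other[OF root_wt, of f h "\<lambda>_. 0"] root_nonzero[of f] G_zero by auto

lemma Pr0_id: "h \<in> H \<Longrightarrow> Pr0 h = h"
proof -
  assume h: "h \<in> H"
  have "(\<Sum>f\<in>\<Lambda> - roots br H. Pr f h) = (\<Sum>f\<in>\<Lambda>. Pr f h)"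
    using ad.finite_wts Pr_H[OF _ h] by (intro sum.mono_neutral_left) auto
  then show ?thesis by (simp add: Pr0_def Pr_sum)
qed

lemma Pr_Pr: "f \<in> roots br H \<Longrightarrow> g \<in> roots br H \<Longrightarrow> Pr f (Pr g L) = (if f = g then Pr f L else 0)"
  using Pr_props Pr_id Pr_in root_wt by (metis (no_types, lifting))

lemma Pr_decompose: "L = Pr0 L + (\<Sum>\<beta>\<in>roots br H. Pr \<beta> L)"
proof -
  have "roots br H \<subseteq> \<Lambda>" using root_wt by blast
  then show ?thesis
    unfolding Pr0_def using sum.subset_diff[of "roots br H" \<Lambda> "\<lambda>f. Pr f L"] ad.finite_wts Pr_sum[of L] by simp
qed

text \<open>S is left abstract because it is used with all conjugates of H and also with those
  conjugates for which invariance of det (z + \<open>\<phi>\<close> L) is recorded.\<close>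

lemma conjugates_of_H_dense:
  assumes HS: "H \<subseteq> S" and cl: "\<And>\<beta> x L. \<beta> \<in> roots br H \<Longrightarrow> x \<in> root_space br H \<beta> \<Longrightarrow> L \<in> S \<Longrightarrow> exp_ad br x L \<in> S"
    and h0: "h0 \<in> H" "\<And>\<beta>. \<beta> \<in> roots br H \<Longrightarrow> \<beta> h0 \<noteq> 0"
    and F: "line_poly F" "\<And>L. L \<in> S \<Longrightarrow> F L = 0"
  shows "F L = 0"
proof -
  define \<Phi> where "\<Phi> bs = foldr (\<lambda>\<beta> \<Psi> L. exp_ad br (Pr \<beta> L) (\<Psi> L)) bs Pr0" for bs
  have \<Phi>0: "\<Phi> [] = Pr0" and \<Phi>S: "\<Phi> (\<beta> # bs) = (\<lambda>L. exp_ad br (Pr \<beta> L) (\<Phi> bs L))" for \<beta> bs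
    by (simp_all add: \<Phi>_def)
  have Phi_prop: "continuous_on UNIV (\<Phi> bs) \<and> \<Phi> bs h0 = h0 \<and> (\<forall>L. \<Phi> bs L \<in> S) \<and>
     (\<Phi> bs has_derivative (\<lambda>L. Pr0 L + (\<Sum>\<beta>\<leftarrow>bs. br (Pr \<beta> L) h0))) (at h0)"
    if "set bs \<subseteq> roots br H" for bs
    using that
  proof (induction bs)
    case Nil
    have "continuous_on UNIV Pr0" using lin_bounded_linear[OF lin_Pr0] by (rule linear_continuous_on)
    moreover have "(Pr0 has_derivative Pr0) (at h0)"
      by (rule bounded_linear_imp_has_derivative[OF lin_bounded_linear[OF lin_Pr0]])
    ultimately show ?case using Pr0_H HS Pr0_id[OF h0(1)] by (auto simp: \<Phi>0)
  next
    case (Cons \<beta> bs)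
    then have \<beta>: "\<beta> \<in> roots br H" and IH: "continuous_on UNIV (\<Phi> bs)" "\<Phi> bs h0 = h0" "\<forall>L. \<Phi> bs L \<in> S"
      "(\<Phi> bs has_derivative (\<lambda>L. Pr0 L + (\<Sum>\<beta>\<leftarrow>bs. br (Pr \<beta> L) h0))) (at h0)" by auto
    note l = Pr_lin[OF root_wt[OF \<beta>]]
    have p0: "Pr \<beta> h0 = 0" by (rule Pr_H[OF \<beta> h0(1)])
    have e0: "exp_ad br 0 h0 = h0"
    proof -
      have "(br 0 ^^ k) h0 = (if k = 0 then h0 else 0)" for k by (cases k) auto
      then have "exp_ad br 0 h0 = (\<Sum>k\<le>CARD('n). if k = 0 then h0 else 0)"
        unfolding exp_ad_def by (intro sum.cong) auto
      then show ?thesis by simp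
    qed
    have "Pr \<beta> L \<in> root_space br H \<beta>" for L using Pr_in[OF root_wt[OF \<beta>]] root_space_eq_G[OF \<beta>] by simp
    then have "\<forall>L. \<Phi> (\<beta> # bs) L \<in> S" unfolding \<Phi>S using IH(3) cl[OF \<beta>] by blast
    moreover have "continuous_on UNIV (\<Phi> (\<beta> # bs))" unfolding \<Phi>S by (rule exp_ad_continuous[OF l IH(1)])
    moreover have "(\<Phi> (\<beta> # bs) has_derivative (\<lambda>L. Pr0 L + (\<Sum>\<beta>\<leftarrow>\<beta> # bs. br (Pr \<beta> L) h0))) (at h0)"
      using exp_ad_has_derivative[OF l p0 IH(4)] unfolding \<Phi>S IH(2) by (simp add: add.commute add.left_commute)
    ultimately show ?case using p0 e0 IH(2) by (simp add: \<Phi>S)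
  qed
  obtain bs where bs: "set bs = roots br H" "distinct bs" using finite_distinct_list[OF finite_roots] by blast
  note p = Phi_prop[of bs, unfolded bs(1), OF subset_refl]
  let ?D = "\<lambda>L. Pr0 L + (\<Sum>\<beta>\<in>roots br H. br (Pr \<beta> L) h0)"
  have D: "(\<Phi> bs has_derivative ?D) (at h0)"
    using p bs by (simp add: sum_list_distinct_conv_sum_set)
  \<comment> \<open>The derivative multiplies the \<beta>-component by -\<beta> h0, which is nonzero
    at a regular h0; dividing by it gives a right inverse.\<close>
  let ?g = "\<lambda>L. Pr0 L + (\<Sum>\<beta>\<in>roots br H. (- (1 / \<beta> h0)) *s Pr \<beta> L)"
  note PL = Pr_lin[OF root_wt]
  have lg: "lin ?g"
    by (rule linI) (simp_all add: vec.linear_add[OF lin_Pr0] vec.linear_scale[OF lin_Pr0] vec.linear_add[OF PL]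
        vec.linear_scale[OF PL] sum.distrib vec.scale_sum_right vec.scale_right_distrib mult.commute
        sum_subtractf sum_negf cong: sum.cong)
  have "?D (?g L) = L" for L
  proof -
    have P0: "Pr0 (Pr \<beta> L) = 0" if "\<beta> \<in> roots br H" for \<beta> L
      unfolding Pr0_def
    proof (rule sum.neutral, rule ballI)
      fix f assume f: "f \<in> \<Lambda> - roots br H"
      then have "f \<in> \<Lambda>" "\<beta> \<noteq> f" using that by auto
      then show "Pr f (Pr \<beta> L) = 0"
        using Pr_props[THEN conjunct1, THEN bspec, of f, THEN conjunct2, THEN bspec, of \<beta>]
          Pr_in[OF root_wt[OF that]] root_wt[OF that] by blast
    qed
    have "Pr0 (?g L) = Pr0 (Pr0 L) + (\<Sum>\<beta>\<in>roots br H. (- (1 / \<beta> h0)) *s Pr0 (Pr \<beta> L))"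
      by (simp only: vec.linear_add[OF lin_Pr0] vec.linear_sum[OF lin_Pr0] vec.linear_scale[OF lin_Pr0])
    then have 0: "Pr0 (?g L) = Pr0 L" using P0 Pr0_id[OF Pr0_H] by simp
    have 1: "br (Pr \<beta> (?g L)) h0 = Pr \<beta> L" if \<beta>: "\<beta> \<in> roots br H" for \<beta>
    proof -
      have "Pr \<beta> (?g L) = Pr \<beta> (Pr0 L) + (\<Sum>\<gamma>\<in>roots br H. (- (1 / \<gamma> h0)) *s Pr \<beta> (Pr \<gamma> L))"
        by (simp only: vec.linear_add[OF PL[OF \<beta>]] vec.linear_sum[OF PL[OF \<beta>]] vec.linear_scale[OF PL[OF \<beta>]])
      also have "\<dots> = (\<Sum>\<gamma>\<in>roots br H. if \<gamma> = \<beta> then (- (1 / \<beta> h0)) *s Pr \<beta> L else 0)"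
        unfolding Pr_H[OF \<beta> Pr0_H] add_0 by (rule sum.cong[OF HOL.refl]) (simp add: Pr_Pr[OF \<beta>])
      also have "\<dots> = (- (1 / \<beta> h0)) *s Pr \<beta> L" using finite_roots \<beta> by simp
      finally have e: "Pr \<beta> (?g L) = (- (1 / \<beta> h0)) *s Pr \<beta> L" .
      have "Pr \<beta> L \<in> root_space br H \<beta>" using Pr_in[OF root_wt[OF \<beta>]] root_space_eq_G[OF \<beta>] by simp
      then have "br (Pr \<beta> L) h0 = - \<beta> h0 *s Pr \<beta> L"
        using h0(1) br_anti[of "Pr \<beta> L" h0] by (simp add: root_space_def)
      then have "br ((- (1 / \<beta> h0)) *s Pr \<beta> L) h0 = ((- (1 / \<beta> h0)) * (- \<beta> h0)) *s Pr \<beta> L"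
        unfolding br_scale1 by (simp only: vec.scale_scale)
      then show ?thesis unfolding e using h0(2)[OF \<beta>] by simp
    qed
    have "?D (?g L) = Pr0 L + (\<Sum>\<beta>\<in>roots br H. Pr \<beta> L)"
      unfolding 0 by (rule arg_cong2[where f = "(+)"]) (use 1 in \<open>auto intro: sum.cong\<close>)
    then show ?thesis using Pr_decompose[of L] by simp
  qed
  then have "?D \<circ> ?g = id" by (simp add: fun_eq_iff)
  \<comment> \<open>Continuity, and a derivative at h0 with a right inverse, make the image a
    neighbourhood of h0.\<close>
  then have "\<Phi> bs h0 \<in> interior (\<Phi> bs ` UNIV)"
    using p by (intro sussmann_open_mapping[OF open_UNIV _ UNIV_I D lin_bounded_linear[OF lg]]) auto
  then obtain \<epsilon> where \<epsilon>: "\<epsilon> > 0" "ball h0 \<epsilon> \<subseteq> \<Phi> bs ` UNIV" using p by (auto simp: mem_interior)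
  then have "F x = 0" if "dist h0 x < \<epsilon>" for x using p F(2) that by (force simp: ball_def)
  then show ?thesis by (rule line_poly_zero_ball[OF F(1) _ \<epsilon>(1)])
qed

end

section \<open>Invariant polynomials\<close>

definition coords :: "('n::finite option \<Rightarrow> complex) \<Rightarrow> complex^'n" where
  "coords a = (\<chi> i. a (Some i))"

lemma pt_simps [simp]: "pt z L None = z" "pt z L (Some i) = L $ i"
  by (simp_all add: pt_def)

lemma coords_pt [simp]: "coords (pt z L) = L"
  by (simp add: coords_def)

lemma pt_coords: "pt (a None) (coords a) = a"
  by (rule ext) (simp add: pt_def coords_def split: option.split)

lemma mpoly_eqI_pt:
  fixes P Q :: "'n::finite option mpoly"
  assumes "\<And>z L. mpoly_eval P (pt z L) = mpoly_eval Q (pt z L)"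
  shows "P = Q"
  by (rule mpoly_eval_inject) (metis assms pt_coords)

lemma polycurve_pt:
  fixes P :: "'n::finite option mpoly"
  assumes "polycurve z" "\<And>i. polycurve (\<lambda>t. L t $ i)"
  shows "polycurve (\<lambda>t. mpoly_eval P (pt (z t) (L t)))"
proof (rule polycurve_mpoly_eval)
  show "polycurve (\<lambda>t. pt (z t) (L t) v)" for v by (cases v) (simp_all add: assms)
qed

lemma polycurve_pt_line:
  fixes P :: "'n::finite option mpoly"
  assumes "polycurve z" shows "polycurve (\<lambda>t. mpoly_eval P (pt (z t) (x + t *s v)))"
  by (rule polycurve_pt[OF assms]) (simp add: polycurve_add polycurve_mult polycurve_const polycurve_id)

lemma line_poly_eval: "line_poly (\<lambda>L. mpoly_eval P (pt z L))"
  unfolding line_poly_def by (intro allI polycurve_pt_line polycurve_const)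

lemma line_poly_diff: "line_poly F \<Longrightarrow> line_poly G \<Longrightarrow> line_poly (\<lambda>L. F L - G L)"
  unfolding line_poly_def by (simp add: polycurve_diff)

context simple_lie begin

lemma br_coords: "br L v = (\<Sum>i\<in>UNIV. L $ i *s br (axis i 1) v)"
proof -
  have "br (\<Sum>i\<in>UNIV. L $ i *s axis i 1) v = (\<Sum>i\<in>UNIV. L $ i *s br (axis i 1) v)"
    by (simp add: br_sum1 br_scale1)
  then show ?thesis by (simp only: basis_expansion)
qed

lemma polyfun_trace_ad: "polyfun (\<lambda>a. ftr (br (coords a) ^^ k))"
proof -
  have 1: "polyfun (\<lambda>a. (br (coords a) v) $ p)" for v p
    by (subst br_coords) (simp add: coords_def polyfun_intros)
  have "polyfun (\<lambda>a. ((br (coords a) ^^ k) v) $ p)" for v p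
  proof (induction k arbitrary: p)
    case 0
    show ?case by (simp add: polyfun_const)
  next
    case (Suc k)
    have e: "br x w $ p = (\<Sum>q\<in>UNIV. w $ q * br x (axis q 1) $ p)" for x w
    proof -
      have "br x (\<Sum>q\<in>UNIV. w $ q *s axis q 1) = (\<Sum>q\<in>UNIV. w $ q *s br x (axis q 1))"
        by (simp add: br_sum2 br_scale2)
      then show ?thesis by (simp only: basis_expansion) simp
    qed
    have "((br (coords a) ^^ Suc k) v) $ p
        = (\<Sum>q\<in>UNIV. ((br (coords a) ^^ k) v) $ q * br (coords a) (axis q 1) $ p)" for a
      using e[of "coords a" "(br (coords a) ^^ k) v"] by simp
    then show ?case by (simp only:) (intro polyfun_sum polyfun_mult Suc 1)
  qed
  then show ?thesis by (simp add: ftr_def trace_def matrix_def polyfun_sum)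
qed

lemma lin_exp_ad: "lin (exp_ad br x)"
  using lin_truncexp[OF lin_br2, of "CARD('n)" x] by (simp add: exp_ad_def[abs_def] truncexp_def[abs_def])

lemma lin_adjoint_group: "\<sigma> \<in> adjoint_group br \<Longrightarrow> lin \<sigma>"
proof (induction rule: adjoint_group.induct)
  case id
  show ?case by (rule linI) simp_all
next
  case (step \<sigma> x)
  then show ?case using lin_comp[OF lin_exp_ad, of \<sigma> x] by (simp add: comp_def)
qed

lemma trace_adjoint_group: "\<sigma> \<in> adjoint_group br \<Longrightarrow> ftr (br (\<sigma> L) ^^ k) = ftr (br L ^^ k)"
proof (induction rule: adjoint_group.induct)
  case (step \<sigma> x)
  have nil: "evnil (adj.act x) v" for v using step.hyps(2) by (auto simp: ad_nilpotent_def evnil_def)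
  show ?case using adj.trace_power_exp_ad[OF step.hyps(2) nil, where L = "\<sigma> L" and k = k] step.IH by simp
qed simp

lemma br_scaled_funpow: "(br (t *s x) ^^ k) y = t ^ k *s (br x ^^ k) y"
  by (induction k) (simp_all add: br_scale1 br_scale2 mult.commute)

lemma ad_nilpotent_scale: "ad_nilpotent br x \<Longrightarrow> ad_nilpotent br (t *s x)"
  unfolding ad_nilpotent_def br_scaled_funpow by fastforce

lemma polycurve_exp_ad: "polycurve (\<lambda>t. exp_ad br (t *s x) y $ i)"
  unfolding exp_ad_def br_scaled_funpow by (simp add: polycurve_intros)

lemma exp_ad_0: "exp_ad br 0 y = y"
proof -
  have "(br 0 ^^ k) y = (if k = 0 then y else 0)" for k by (cases k) auto
  then have "exp_ad br 0 y = (\<Sum>k\<le>CARD('n). if k = 0 then y else 0)"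
    unfolding exp_ad_def by (intro sum.cong) auto
  then show ?thesis by simp
qed

end

section \<open>Weyl orbits and weight multiplicities\<close>

lemma weyl_orbit_trans:
  "c \<in> weyl_orbit br H b \<Longrightarrow> b \<in> weyl_orbit br H a \<Longrightarrow> c \<in> weyl_orbit br H a"
  by (induction rule: weyl_orbit.induct) (auto intro: weyl_orbit.refl)

lemma (in cartan) reflection_involution:
  assumes "\<alpha> \<in> roots br H" shows "reflection br H \<alpha> (reflection br H \<alpha> \<nu>) = \<nu>"
  using sl2_triple(3)[OF assms] by (auto simp: reflection_def algebra_simps)

lemma (in cartan) weyl_orbit_sym: "b \<in> weyl_orbit br H a \<Longrightarrow> a \<in> weyl_orbit br H b"
proof (induction rule: weyl_orbit.induct)
  case self
  show ?case by (rule weyl_orbit.self)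
next
  case (refl \<nu> \<alpha>)
  have "reflection br H \<alpha> (reflection br H \<alpha> \<nu>) \<in> weyl_orbit br H (reflection br H \<alpha> \<nu>)"
    by (intro weyl_orbit.refl weyl_orbit.self refl.hyps)
  then have "\<nu> \<in> weyl_orbit br H (reflection br H \<alpha> \<nu>)"
    using reflection_involution[OF refl.hyps(2)] by simp
  then show ?case by (rule weyl_orbit_trans[OF refl.IH])
qed

lemma (in weight_rep) orbit_weights:
  assumes "\<mu> \<in> W" "\<nu> \<in> weyl_orbit br H \<mu>"
  shows "\<nu> \<in> W \<and> weight_mult H \<phi> \<nu> = weight_mult H \<phi> \<mu>"
  using assms(2)
proof (induction rule: weyl_orbit.induct)
  case (refl \<nu> \<alpha>)
  note inv = reflection_involution[OF refl.hyps(2)]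
  have \<nu>: "\<nu> \<in> W" using refl.IH by blast
  note r = reflection_weight[OF refl.hyps(2) \<nu>]
  show ?case using r reflection_weight(2)[OF refl.hyps(2) r(1)] refl.IH unfolding inv by simp
qed (use assms in simp)

text \<open>For \<open>x + y + w = 0\<close>, the sums over the roots of second and sixth powers determine the elementary
  symmetric function \<open>e\<^sub>2\<close> and the square of \<open>e\<^sub>3\<close>; these generate the invariants.\<close>

context g2 begin

definition e2 :: "complex^'n \<Rightarrow> complex" where
  "e2 L = - ftr (br L ^^ 2) / 16"

definition e3sq :: "complex^'n \<Rightarrow> complex" where
  "e3sq L = - (ftr (br L ^^ 6) / 2 + 68 * e2 L ^ 3) / 78"

lemma polyfun_e2: "polyfun (\<lambda>a. e2 (coords a))"
  using polyfun_mult[OF polyfun_const[of "- 1 / 16"] polyfun_trace_ad[of 2]] by (simp add: e2_def)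

lemma polyfun_e3sq: "polyfun (\<lambda>a. e3sq (coords a))"
proof -
  have "e3sq L = (- 1 / 156) * ftr (br L ^^ 6) + (- 68 / 78) * e2 L ^ 3" for L
    by (simp add: e3sq_def field_simps)
  then show ?thesis
    by (simp only:) (intro polyfun_add polyfun_mult polyfun_const polyfun_trace_ad polyfun_power polyfun_e2)
qed

lemma sum_roots_power:
  assumes "h \<in> H"
  shows "ftr (br h ^^ Suc k) = (\<Sum>p\<in>g2_roots. (of_int (fst p) * \<alpha>1 h + of_int (snd p) * \<alpha>2 h) ^ Suc k)"
  unfolding trace_ad_power[OF assms] roots_g2
  by (subst sum.reindex) (use inj_lamZ in \<open>auto simp: lam_def intro: inj_on_subset\<close>)

text \<open>The numbers x, y, w are the short roots \<alpha>1, \<alpha>1 + \<alpha>2 and -(2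
  \<alpha>1 + \<alpha>2) at h. The squares of the twelve roots add up to -16 times xy + yw + wx,
  hence the divisor in \<open>e2\<close>.\<close>

lemma e2_H:
  assumes "h \<in> H" shows "e2 h = - (3 * (\<alpha>1 h)\<^sup>2 + 3 * \<alpha>1 h * \<alpha>2 h + (\<alpha>2 h)\<^sup>2)"
proof -
  have "ftr (br h ^^ 2) = 16 * (3 * (\<alpha>1 h)\<^sup>2 + 3 * \<alpha>1 h * \<alpha>2 h + (\<alpha>2 h)\<^sup>2)"
    using sum_roots_power[OF assms, of 1] by (simp add: g2_roots_def numeral_2_eq_2[symmetric] power2_eq_square algebra_simps)
  then show ?thesis by (simp add: e2_def)
qed

lemma e3sq_H:
  assumes "h \<in> H" shows "e3sq h = (\<alpha>1 h * (\<alpha>1 h + \<alpha>2 h) * (2 * \<alpha>1 h + \<alpha>2 h))\<^sup>2"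
proof -
  define a b where "a = \<alpha>1 h" and "b = \<alpha>2 h"
  have s: "ftr (br h ^^ 6) = 2 * (a^6 + b^6 + (a+b)^6 + (2*a+b)^6 + (3*a+b)^6 + (3*a+2*b)^6)"
  proof -
    have n: "(- x - y)^6 = (x + y)^6" for x y :: complex
      using power_minus_even[of 6 "x + y"] by simp
    have "ftr (br h ^^ 6) = (\<Sum>p\<in>g2_roots. (of_int (fst p) * a + of_int (snd p) * b) ^ 6)"
      using sum_roots_power[OF assms, of 5] by (simp add: a_def b_def)
    also have "\<dots> = 2 * (a^6 + b^6 + (a+b)^6 + (2*a+b)^6 + (3*a+b)^6 + (3*a+2*b)^6)"
      by (simp add: g2_roots_def n[of "2*a" b, simplified] n[of "3*a" b, simplified] n[of "3*a" "2*b", simplified] n[of a b])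
    finally show ?thesis .
  qed
  \<comment> \<open>Half the sum of sixth powers over the roots is -68 e2^3 - 78 e3^2; these are the
    constants in \<open>e3sq\<close>.\<close>
  have i: "a^6 + b^6 + (a+b)^6 + (2*a+b)^6 + (3*a+b)^6 + (3*a+2*b)^6
      = 68 * (3*a\<^sup>2 + 3*a*b + b\<^sup>2)^3 - 78 * (a * (a+b) * (2*a+b))\<^sup>2"
    by algebra
  have "e2 h ^ 3 = - ((3*a\<^sup>2 + 3*a*b + b\<^sup>2)^3)" unfolding e2_H[OF assms] a_def b_def by (rule power_minus_odd) simp
  then have "e3sq h = (a * (a+b) * (2*a+b))\<^sup>2" unfolding e3sq_def s i by (simp add: field_simps)
  then show ?thesis by (simp add: a_def b_def)
qed

lemma e2_adjoint: "\<sigma> \<in> adjoint_group br \<Longrightarrow> e2 (\<sigma> L) = e2 L"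
  and e3sq_adjoint: "\<sigma> \<in> adjoint_group br \<Longrightarrow> e3sq (\<sigma> L) = e3sq L"
  by (simp_all add: e2_def e3sq_def trace_adjoint_group)

end

text \<open>As the sum is 0, the product of the z + n_i is z^3 + k z + c and that of the z - n_i is
  z^3 + k z - c, with k and c the elementary symmetric functions of degree 2 and 3.\<close>

lemma triple_product_identity:
  fixes z :: complex
  assumes "n1 + n2 + n3 = 0"
  shows "(z + n1) * (z - n1) * ((z + n2) * (z - n2)) * ((z + n3) * (z - n3))
    = (z ^ 3 + (n1*n2 + n2*n3 + n3*n1) * z)\<^sup>2 - (n1*n2*n3)\<^sup>2"
proof -
  have "n3 = - n1 - n2" using assms by (simp add: algebra_simps eq_neg_iff_add_eq_0)
  then show ?thesis by algebra
qed

text \<open>The two hexagons have the products W^2 - (A e3 - B \<delta>)^2 and W^2 - (A e3 + B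
  \<delta>)^2, where \<delta> is the product of the differences of x, y, w. Multiplying them leaves
  only E = e3^2 and the discriminant D = \<delta>^2.\<close>

definition orbit_poly :: "complex \<Rightarrow> complex \<Rightarrow> complex \<Rightarrow> complex \<Rightarrow> complex \<Rightarrow> complex" where
  "orbit_poly p q z e E = (let W = z ^ 3 + (p\<^sup>2 - p*q + q\<^sup>2) * e * z; A = p^3 + q^3 - 3/2 * (p\<^sup>2 * q + p * q\<^sup>2);
     B = (p\<^sup>2 * q - p * q\<^sup>2) / 2; D = - 4 * e^3 - 27 * E in
     W^4 - 2 * (A\<^sup>2 * E + B\<^sup>2 * D) * W\<^sup>2 + (A\<^sup>2 * E - B\<^sup>2 * D)\<^sup>2)"

text \<open>A single hexagon, for weights on a wall: there A B = 0 removes the mixed term 2 A B e3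
  \<delta>, which is not a polynomial in e and E.\<close>

definition half_orbit_poly :: "complex \<Rightarrow> complex \<Rightarrow> complex \<Rightarrow> complex \<Rightarrow> complex \<Rightarrow> complex" where
  "half_orbit_poly p q z e E = (let W = z ^ 3 + (p\<^sup>2 - p*q + q\<^sup>2) * e * z; A = p^3 + q^3 - 3/2 * (p\<^sup>2 * q + p * q\<^sup>2);
     B = (p\<^sup>2 * q - p * q\<^sup>2) / 2; D = - 4 * e^3 - 27 * E in W\<^sup>2 - (A\<^sup>2 * E + B\<^sup>2 * D))"

text \<open>With x, y, w the short roots above, the first hexagon consists of p x + q y, its cyclic
  shifts and their negatives; exchanging p and q gives the second. A is symmetric and B
  antisymmetric in p and q, so only the sign of B \<delta> changes.\<close>

lemma orbit_identities:
  fixes a b s t z :: complex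
  assumes p_def: "p = s - t" and q_def: "q = t"
    and e_def: "e = - (3 * a\<^sup>2 + 3 * a * b + b\<^sup>2)" and e3_def: "e3 = - (a * (a + b) * (2 * a + b))"
    and dl_def: "dl = b * (3 * a + 2 * b) * (3 * a + b)"
    and A_def: "A = p^3 + q^3 - 3/2 * (p\<^sup>2 * q + p * q\<^sup>2)" and B_def: "B = (p\<^sup>2 * q - p * q\<^sup>2) / 2"
    and W_def: "W = z ^ 3 + (p\<^sup>2 - p*q + q\<^sup>2) * e * z"
  shows "(z + (s*a + t*b)) * (z - (s*a + t*b)) * ((z + ((s - 3*t)*a + (s - 2*t)*b)) * (z - ((s - 3*t)*a + (s - 2*t)*b)))
     * ((z + ((3*t - 2 * s)*a + (t - s)*b)) * (z - ((3*t - 2 * s)*a + (t - s)*b))) = W\<^sup>2 - (A * e3 - B * dl)\<^sup>2" (is "?one")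
   and "(z + (s*a + (s - t)*b)) * (z - (s*a + (s - t)*b)) * ((z + ((s - 3*t)*a - t*b)) * (z - ((s - 3*t)*a - t*b)))
     * ((z + ((3*t - 2 * s)*a + (2*t - s)*b)) * (z - ((3*t - 2 * s)*a + (2*t - s)*b))) = W\<^sup>2 - (A * e3 + B * dl)\<^sup>2" (is "?two")
   and "dl\<^sup>2 = - 4 * e^3 - 27 * e3\<^sup>2"
proof -
  show "dl\<^sup>2 = - 4 * e^3 - 27 * e3\<^sup>2" unfolding dl_def e_def e3_def by algebra
  let ?n1 = "s*a + t*b" and ?n2 = "(s - 3*t)*a + (s - 2*t)*b" and ?n3 = "(3*t - 2 * s)*a + (t - s)*b"
  have s0: "?n1 + ?n2 + ?n3 = 0" by (simp add: algebra_simps)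
  have k: "?n1*?n2 + ?n2*?n3 + ?n3*?n1 = (p\<^sup>2 - p*q + q\<^sup>2) * e" unfolding p_def q_def e_def by algebra
  have "2 * (?n1*?n2*?n3) = 2 * (A * e3 - B * dl)"
    unfolding A_def B_def p_def q_def e3_def dl_def by (simp add: field_simps) algebra
  then have c: "?n1*?n2*?n3 = A * e3 - B * dl" by (simp only: mult_cancel_left) simp
  show ?one using triple_product_identity[OF s0, of z] unfolding k c W_def .
  let ?m1 = "s*a + (s - t)*b" and ?m2 = "(s - 3*t)*a - t*b" and ?m3 = "(3*t - 2 * s)*a + (2*t - s)*b"
  have s0: "?m1 + ?m2 + ?m3 = 0" by (simp add: algebra_simps)
  have k: "?m1*?m2 + ?m2*?m3 + ?m3*?m1 = (p\<^sup>2 - p*q + q\<^sup>2) * e" unfolding p_def q_def e_def by algebra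
  have "2 * (?m1*?m2*?m3) = 2 * (A * e3 + B * dl)"
    unfolding A_def B_def p_def q_def e3_def dl_def by (simp add: field_simps) algebra
  then have c: "?m1*?m2*?m3 = A * e3 + B * dl" by (simp only: mult_cancel_left) simp
  show ?two using triple_product_identity[OF s0, of z] unfolding k c W_def .
qed

text \<open>The twelve (not necessarily distinct) points of an orbit form two hexagons, each consisting of
  \<open>\<plusminus>\<nu>\<^sub>1, \<plusminus>\<nu>\<^sub>2, \<plusminus>\<nu>\<^sub>3\<close> with \<open>\<nu>\<^sub>1 + \<nu>\<^sub>2 + \<nu>\<^sub>3 = 0\<close>; for a weight on a wall the two hexagons coincide.\<close>

definition half_orbit_list :: "int \<Rightarrow> int \<Rightarrow> (int \<times> int) list" where
  "half_orbit_list s t = [(s, t), (- s, - t), (s - 3*t, s - 2*t), (3*t - s, 2*t - s), (3*t - 2 * s, t - s), (2 * s - 3*t, s - t)]"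

definition half_orbit_list' :: "int \<Rightarrow> int \<Rightarrow> (int \<times> int) list" where
  "half_orbit_list' s t = [(s, s - t), (- s, t - s), (s - 3*t, - t), (3*t - s, t), (3*t - 2 * s, 2*t - s), (2 * s - 3*t, s - 2*t)]"

lemma g2_orbit_lists: "g2_orbit s t = set (half_orbit_list s t) \<union> set (half_orbit_list' s t)"
  unfolding g2_orbit_def half_orbit_list_def half_orbit_list'_def list.set by blast

lemma distinct_orbit:
  assumes "2 * s - 3*t > 0" "2*t - s > 0"
  shows "distinct (half_orbit_list s t @ half_orbit_list' s t)"
  unfolding half_orbit_list_def half_orbit_list'_def append.simps distinct.simps list.set insert_iff empty_iff prod.inject
  using assms by (intro conjI notI TrueI; (elim disjE conjE FalseE)?; linarith)

lemma distinct_half_orbit: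
  assumes "2 * s - 3*t \<ge> 0" "2*t - s \<ge> 0" "s \<noteq> 0 \<or> t \<noteq> 0"
  shows "distinct (half_orbit_list s t)"
  unfolding half_orbit_list_def distinct.simps list.set insert_iff empty_iff prod.inject
  using assms by (intro conjI notI TrueI; (elim disjE conjE FalseE)?; linarith)

section \<open>Orbit products as values of invariant polynomials\<close>

context g2 begin

definition conj_H :: "(complex^'n) set" where
  "conj_H = {\<sigma> h |\<sigma> h. \<sigma> \<in> adjoint_group br \<and> h \<in> H}"

text \<open>1 and the imaginary unit are independent over the integers, so distinct integral weights
  take distinct values at this one point, and no root vanishes there.\<close>

definition hreg :: "complex^'n" where
  "hreg = hpt 1 \<i>"

lemma hreg_H: "hreg \<in> H"
  by (simp add: hreg_def hpt_H)

lemma lamZ_hreg: "lamZ p hreg = of_int (fst p) + of_int (snd p) * \<i>"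
  by (simp add: hreg_def lam_hpt)

lemma lamZ_hreg_inj: "lamZ p hreg = lamZ q hreg \<Longrightarrow> p = q"
  unfolding lamZ_hreg by (simp add: complex_eq_iff prod_eq_iff)

lemma root_hreg: "\<beta> \<in> roots br H \<Longrightarrow> \<beta> hreg \<noteq> 0"
proof -
  assume "\<beta> \<in> roots br H"
  then obtain p where p: "p \<in> g2_roots" "\<beta> = lamZ p" unfolding roots_g2 by blast
  have "fst p \<noteq> 0 \<or> snd p \<noteq> 0" using p(1) by (auto simp: g2_roots_def)
  then show ?thesis unfolding p(2) lamZ_hreg by (simp add: complex_eq_iff)
qed

lemma root_vector_nil: "\<beta> \<in> roots br H \<Longrightarrow> x \<in> root_space br H \<beta> \<Longrightarrow> ad_nilpotent br x"
  using root_vector_ad_nilpotent root_nonzero by blast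

lemma conj_H_dense:
  assumes "line_poly F" "\<And>\<sigma> h. \<sigma> \<in> adjoint_group br \<Longrightarrow> h \<in> H \<Longrightarrow> F (\<sigma> h) = 0"
  shows "F L = 0"
proof (rule conjugates_of_H_dense[where S = conj_H and F = F and ?h0.0 = hreg])
  show "H \<subseteq> conj_H" unfolding conj_H_def by (auto intro!: exI[of _ id] adjoint_group.id)
  show "exp_ad br x L \<in> conj_H" if "\<beta> \<in> roots br H" "x \<in> root_space br H \<beta>" "L \<in> conj_H" for \<beta> x L
  proof -
    obtain \<sigma> h where "L = \<sigma> h" "\<sigma> \<in> adjoint_group br" "h \<in> H" using \<open>L \<in> conj_H\<close> by (auto simp: conj_H_def)
    then have "exp_ad br x L = (exp_ad br x \<circ> \<sigma>) h" "exp_ad br x \<circ> \<sigma> \<in> adjoint_group br"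
      using adjoint_group.step[OF _ root_vector_nil[OF that(1,2)]] by auto
    then show ?thesis using \<open>h \<in> H\<close> unfolding conj_H_def by blast
  qed
  show "F L = 0" if "L \<in> conj_H" for L using that assms(2) by (auto simp: conj_H_def)
qed (use assms(1) hreg_H root_hreg in auto)

abbreviation orb :: "(complex^'n \<Rightarrow> complex) \<Rightarrow> (complex^'n \<Rightarrow> complex) set" where
  "orb \<equiv> weyl_orbit br H"

lemma orbit_prod:
  "(\<Prod>\<nu>\<in>orb (lamZ (s, t)). z + \<nu> h) = (\<Prod>p\<in>g2_orbit s t. z + (of_int (fst p) * \<alpha>1 h + of_int (snd p) * \<alpha>2 h))"
  unfolding weyl_orbit_g2
  by (subst prod.reindex) (use inj_lamZ in \<open>auto simp: lam_def intro: inj_on_subset\<close>)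

lemma half_orbit_prod:
  fixes z :: complex and s t :: int and h :: "complex^'n"
  defines "p \<equiv> complex_of_int s - of_int t" and "q \<equiv> complex_of_int t"
  assumes h: "h \<in> H"
  defines "W \<equiv> z ^ 3 + (p\<^sup>2 - p*q + q\<^sup>2) * e2 h * z"
    and "A \<equiv> p^3 + q^3 - 3/2 * (p\<^sup>2 * q + p * q\<^sup>2)" and "B \<equiv> (p\<^sup>2 * q - p * q\<^sup>2) / 2"
    and "f \<equiv> \<lambda>u. z + (of_int (fst u) * \<alpha>1 h + of_int (snd u) * \<alpha>2 h)"
  shows "\<exists>e d. e\<^sup>2 = e3sq h \<and> d\<^sup>2 = - 4 * e2 h ^ 3 - 27 * e3sq h \<and>
    prod_list (map f (half_orbit_list s t)) = W\<^sup>2 - (A * e - B * d)\<^sup>2 \<and>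
    prod_list (map f (half_orbit_list' s t)) = W\<^sup>2 - (A * e + B * d)\<^sup>2"
proof -
  let ?a = "\<alpha>1 h" and ?b = "\<alpha>2 h"
  let ?e = "- (?a * (?a + ?b) * (2 * ?a + ?b))" and ?d = "?b * (3 * ?a + 2 * ?b) * (3 * ?a + ?b)"
  have e: "?e\<^sup>2 = e3sq h" unfolding e3sq_H[OF h] power2_minus ..
  note I = orbit_identities[OF p_def[THEN meta_eq_to_obj_eq] q_def[THEN meta_eq_to_obj_eq] e2_H[OF h] HOL.refl[of ?e] HOL.refl[of ?d]
      A_def[THEN meta_eq_to_obj_eq] B_def[THEN meta_eq_to_obj_eq] W_def[THEN meta_eq_to_obj_eq]]
  have u0: "f (s, t) = z + (of_int s*?a + of_int t*?b)" by (simp add: f_def algebra_simps)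
  have u1: "f (- s, - t) = z - (of_int s*?a + of_int t*?b)" by (simp add: f_def algebra_simps)
  have u2: "f (s - 3*t, s - 2*t) = z + ((of_int s - 3 * of_int t)*?a + (of_int s - 2 * of_int t)*?b)" by (simp add: f_def algebra_simps)
  have u3: "f (3*t - s, 2*t - s) = z - ((of_int s - 3 * of_int t)*?a + (of_int s - 2 * of_int t)*?b)" by (simp add: f_def algebra_simps)
  have u4: "f (3*t - 2 * s, t - s) = z + ((3 * of_int t - 2 * of_int s)*?a + (of_int t - of_int s)*?b)" by (simp add: f_def algebra_simps)
  have u5: "f (2 * s - 3*t, s - t) = z - ((3 * of_int t - 2 * of_int s)*?a + (of_int t - of_int s)*?b)" by (simp add: f_def algebra_simps)
  have v0: "f (s, s - t) = z + (of_int s*?a + (of_int s - of_int t)*?b)" by (simp add: f_def algebra_simps)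
  have v1: "f (- s, t - s) = z - (of_int s*?a + (of_int s - of_int t)*?b)" by (simp add: f_def algebra_simps)
  have v2: "f (s - 3*t, - t) = z + ((of_int s - 3 * of_int t)*?a - of_int t*?b)" by (simp add: f_def algebra_simps)
  have v3: "f (3*t - s, t) = z - ((of_int s - 3 * of_int t)*?a - of_int t*?b)" by (simp add: f_def algebra_simps)
  have v4: "f (3*t - 2 * s, 2*t - s) = z + ((3 * of_int t - 2 * of_int s)*?a + (2 * of_int t - of_int s)*?b)" by (simp add: f_def algebra_simps)
  have v5: "f (2 * s - 3*t, s - 2*t) = z - ((3 * of_int t - 2 * of_int s)*?a + (2 * of_int t - of_int s)*?b)" by (simp add: f_def algebra_simps)
  have "prod_list (map f (half_orbit_list s t)) = W\<^sup>2 - (A * ?e - B * ?d)\<^sup>2"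
    unfolding I(1)[symmetric] half_orbit_list_def
    by (simp only: list.map prod_list.Cons prod_list.Nil u0 u1 u2 u3 u4 u5 mult_1_right mult.assoc)
  moreover have "prod_list (map f (half_orbit_list' s t)) = W\<^sup>2 - (A * ?e + B * ?d)\<^sup>2"
    unfolding I(2)[symmetric] half_orbit_list'_def
    by (simp only: list.map prod_list.Cons prod_list.Nil v0 v1 v2 v3 v4 v5 mult_1_right mult.assoc)
  ultimately show ?thesis using e I(3) by metis
qed

text \<open>Strictly inside the chamber the orbit consists of two hexagons, on a wall of one, and
  for the zero weight of one point; each case has its own polynomial.\<close>

lemma orbit_invariant_exists:
  assumes dom: "2 * s - 3*t \<ge> 0" "2*t - s \<ge> 0"
  shows "\<exists>F. (\<forall>h\<in>H. \<forall>z. F z (e2 h) (e3sq h) = (\<Prod>\<nu>\<in>orb (lamZ (s, t)). z + \<nu> h)) \<and>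
     polyfun (\<lambda>a. F (a None) (e2 (coords a)) (e3sq (coords a)))"
proof -
  let ?p = "complex_of_int s - of_int t" and ?q = "complex_of_int t"
  note pf = polyfun_e2 polyfun_e3sq polyfun_intros
  consider (gen) "2 * s - 3*t > 0" "2*t - s > 0" | (half) "s \<noteq> 0 \<or> t \<noteq> 0" "2 * s = 3*t \<or> 2*t = s" | (zero) "s = 0" "t = 0"
    using dom by linarith
  then show ?thesis
  proof cases
    case gen
    have "orbit_poly ?p ?q z (e2 h) (e3sq h) = (\<Prod>\<nu>\<in>orb (lamZ (s, t)). z + \<nu> h)" if h: "h \<in> H" for h z
    proof -
      let ?f = "\<lambda>u. z + (of_int (fst u) * \<alpha>1 h + of_int (snd u) * \<alpha>2 h)"
      obtain e d where ed: "e\<^sup>2 = e3sq h" "d\<^sup>2 = - 4 * e2 h ^ 3 - 27 * e3sq h"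
        "prod_list (map ?f (half_orbit_list s t)) = (z ^ 3 + (?p\<^sup>2 - ?p*?q + ?q\<^sup>2) * e2 h * z)\<^sup>2
           - ((?p^3 + ?q^3 - 3/2 * (?p\<^sup>2 * ?q + ?p * ?q\<^sup>2)) * e - (?p\<^sup>2 * ?q - ?p * ?q\<^sup>2) / 2 * d)\<^sup>2"
        "prod_list (map ?f (half_orbit_list' s t)) = (z ^ 3 + (?p\<^sup>2 - ?p*?q + ?q\<^sup>2) * e2 h * z)\<^sup>2
           - ((?p^3 + ?q^3 - 3/2 * (?p\<^sup>2 * ?q + ?p * ?q\<^sup>2)) * e + (?p\<^sup>2 * ?q - ?p * ?q\<^sup>2) / 2 * d)\<^sup>2"
        using half_orbit_prod[OF h, of z s t] by blast
      have "(\<Prod>\<nu>\<in>orb (lamZ (s, t)). z + \<nu> h) = prod ?f (set (half_orbit_list s t @ half_orbit_list' s t))"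
        unfolding orbit_prod g2_orbit_lists set_append ..
      also have "\<dots> = prod_list (map ?f (half_orbit_list s t)) * prod_list (map ?f (half_orbit_list' s t))"
        using prod.distinct_set_conv_list[OF distinct_orbit[OF gen], of ?f] by (simp only: map_append prod_list.append)
      also have "\<dots> = orbit_poly ?p ?q z (e2 h) (e3sq h)"
      proof -
        have id: "(W\<^sup>2 - (A * e - B * d)\<^sup>2) * (W\<^sup>2 - (A * e + B * d)\<^sup>2)
          = W^4 - 2 * (A\<^sup>2 * e\<^sup>2 + B\<^sup>2 * d\<^sup>2) * W\<^sup>2 + (A\<^sup>2 * e\<^sup>2 - B\<^sup>2 * d\<^sup>2)\<^sup>2" for W A B :: complex
          by algebra
        show ?thesis unfolding ed(3,4) id unfolding ed(1,2) orbit_poly_def Let_def ..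
      qed
      finally show ?thesis by (rule sym)
    qed
    moreover have "polyfun (\<lambda>a :: 'n option \<Rightarrow> complex. orbit_poly ?p ?q (a None) (e2 (coords a)) (e3sq (coords a)))"
      unfolding orbit_poly_def Let_def by (intro pf)
    ultimately show ?thesis by blast
  next
    case half
    have "half_orbit_poly ?p ?q z (e2 h) (e3sq h) = (\<Prod>\<nu>\<in>orb (lamZ (s, t)). z + \<nu> h)" if h: "h \<in> H" for h z
    proof -
      let ?f = "\<lambda>u. z + (of_int (fst u) * \<alpha>1 h + of_int (snd u) * \<alpha>2 h)"
      let ?A = "?p^3 + ?q^3 - 3/2 * (?p\<^sup>2 * ?q + ?p * ?q\<^sup>2)" and ?B = "(?p\<^sup>2 * ?q - ?p * ?q\<^sup>2) / 2"
      obtain e d where ed: "e\<^sup>2 = e3sq h" "d\<^sup>2 = - 4 * e2 h ^ 3 - 27 * e3sq h"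
        "prod_list (map ?f (half_orbit_list s t)) = (z ^ 3 + (?p\<^sup>2 - ?p*?q + ?q\<^sup>2) * e2 h * z)\<^sup>2 - (?A * e - ?B * d)\<^sup>2"
        using half_orbit_prod[OF h, of z s t] by blast
      \<comment> \<open>The wall 2 t = s means p = q, so B = 0; the wall 2 s = 3 t means q = 2 p, so
        A = 0.\<close>
      have AB: "?A * ?B = 0"
        using half(2)
      proof
        assume "2*t = s"
        then have "?p = ?q" by auto
        then show ?thesis by (simp add: power2_eq_square)
      next
        assume "2 * s = 3*t"
        then have "2 * complex_of_int s = 3 * of_int t" by (metis of_int_mult of_int_numeral)
        then have pq: "?q = 2 * ?p" by (simp add: algebra_simps)
        have "x^3 + y^3 - 3/2 * (x\<^sup>2 * y + x * y\<^sup>2) = 0" if "y = 2 * x" for x y :: complex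
          unfolding that by (simp add: power2_eq_square power3_eq_cube)
        from this[OF pq] have "?A = 0" .
        then show ?thesis by simp
      qed
      have "set (half_orbit_list' s t) \<subseteq> set (half_orbit_list s t)"
        using half(2)
      proof
        assume "2*t = s"
        then have "s = 2*t" by simp
        then show ?thesis by (simp add: half_orbit_list_def half_orbit_list'_def)
      next
        assume a: "2 * s = 3*t"
        define n where "n = s - t"
        have "t = 2*n" "s = 3*n" using a by (simp_all add: n_def)
        then show ?thesis by (simp add: half_orbit_list_def half_orbit_list'_def)
      qed
      then have "(\<Prod>\<nu>\<in>orb (lamZ (s, t)). z + \<nu> h) = prod ?f (set (half_orbit_list s t))"
        unfolding orbit_prod g2_orbit_lists by (simp add: Un_absorb2)
      also have "\<dots> = prod_list (map ?f (half_orbit_list s t))"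
        by (rule prod.distinct_set_conv_list[OF distinct_half_orbit[OF dom half(1)]])
      also have "\<dots> = half_orbit_poly ?p ?q z (e2 h) (e3sq h)"
      proof -
        have id: "(A * e - B * d)\<^sup>2 = A\<^sup>2 * e\<^sup>2 + B\<^sup>2 * d\<^sup>2 - 2 * (A * B) * e * d" for A B :: complex by algebra
        show ?thesis unfolding ed(3) id unfolding AB ed(1,2) half_orbit_poly_def Let_def by simp
      qed
      finally show ?thesis by (rule sym)
    qed
    moreover have "polyfun (\<lambda>a :: 'n option \<Rightarrow> complex. half_orbit_poly ?p ?q (a None) (e2 (coords a)) (e3sq (coords a)))"
      unfolding half_orbit_poly_def Let_def by (intro pf)
    ultimately show ?thesis by blast
  next
    case zero
    have "(\<Prod>\<nu>\<in>orb (lamZ (s, t)). z + \<nu> h) = z" for z h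
      unfolding orbit_prod by (simp add: zero g2_orbit_def)
    then show ?thesis by (intro exI[of _ "\<lambda>z e E. z"]) (simp add: polyfun_var)
  qed
qed

lemma mpoly_eqI_conj:
  fixes P Q :: "'n option mpoly"
  assumes "\<And>z \<sigma> h. \<sigma> \<in> adjoint_group br \<Longrightarrow> h \<in> H \<Longrightarrow> mpoly_eval P (pt z (\<sigma> h)) = mpoly_eval Q (pt z (\<sigma> h))"
  shows "P = Q"
proof (rule mpoly_eqI_pt)
  fix z L
  have "mpoly_eval P (pt z L) - mpoly_eval Q (pt z L) = 0"
    by (rule conj_H_dense[where F = "\<lambda>L. mpoly_eval P (pt z L) - mpoly_eval Q (pt z L)"])
       (auto intro: line_poly_diff line_poly_eval simp: assms)
  then show "mpoly_eval P (pt z L) = mpoly_eval Q (pt z L)" by simp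
qed

text \<open>The invariants agree at h and \<open>\<sigma> h\<close>, which gives existence for the
  definite description; density of the conjugates gives uniqueness.\<close>

lemma orbital_factor_eval:
  assumes dom: "2 * s - 3*t \<ge> 0" "2*t - s \<ge> 0" and "h \<in> H" "\<sigma> \<in> adjoint_group br"
  shows "mpoly_eval (orbital_factor br H (lamZ (s, t))) (pt z (\<sigma> h)) = (\<Prod>\<nu>\<in>orb (lamZ (s, t)). z + \<nu> h)"
proof -
  let ?Q = "\<lambda>P :: 'n option mpoly. \<forall>z0 h \<sigma>. h \<in> H \<longrightarrow> \<sigma> \<in> adjoint_group br \<longrightarrow>
      mpoly_eval P (pt z0 (\<sigma> h)) = (\<Prod>\<nu>\<in>orb (lamZ (s, t)). z0 + \<nu> h)"
  obtain F where F: "\<And>h z. h \<in> H \<Longrightarrow> F z (e2 h) (e3sq h) = (\<Prod>\<nu>\<in>orb (lamZ (s, t)). z + \<nu> h)"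
      "polyfun (\<lambda>a. F (a None) (e2 (coords a)) (e3sq (coords a)))"
    using orbit_invariant_exists[OF dom] by blast
  obtain P where P: "\<And>a. mpoly_eval P a = F (a None) (e2 (coords a)) (e3sq (coords a))"
    using F(2) unfolding polyfun_def by blast
  have "?Q P" by (simp add: P F(1) e2_adjoint e3sq_adjoint)
  moreover have "P' = P" if "?Q P'" for P' by (rule mpoly_eqI_conj) (use that \<open>?Q P\<close> in simp)
  ultimately have "\<exists>!P. ?Q P" by blast
  then have "?Q (orbital_factor br H (lamZ (s, t)))" unfolding orbital_factor_def by (rule theI')
  then show ?thesis using assms by blast
qed

end

section \<open>Irreducibility\<close>

locale g2_orbital = g2 br H \<alpha>1 \<alpha>2 for br :: "complex^'n \<Rightarrow> complex^'n \<Rightarrow> complex^'n" and H \<alpha>1 \<alpha>2 +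
  fixes s t :: int
  assumes dom: "2 * s - 3*t \<ge> 0" "2*t - s \<ge> 0"
begin

definition f :: "'n option mpoly" where
  "f = orbital_factor br H (lamZ (s, t))"

definition Orb :: "(complex^'n \<Rightarrow> complex) set" where
  "Orb = orb (lamZ (s, t))"

lemma f_eval: "h \<in> H \<Longrightarrow> \<sigma> \<in> adjoint_group br \<Longrightarrow> mpoly_eval f (pt z (\<sigma> h)) = (\<Prod>\<nu>\<in>Orb. z + \<nu> h)"
  unfolding f_def Orb_def using orbital_factor_eval[OF dom] .

lemma f_eval_H: "h \<in> H \<Longrightarrow> mpoly_eval f (pt z h) = (\<Prod>\<nu>\<in>Orb. z + \<nu> h)"
  using f_eval[OF _ adjoint_group.id, of h z] by simp

lemma finite_Orb: "finite Orb"
  unfolding Orb_def weyl_orbit_g2 by (simp add: g2_orbit_def)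

lemma Orb_lamZ: "\<nu> \<in> Orb \<Longrightarrow> \<exists>p. \<nu> = lamZ p"
  unfolding Orb_def weyl_orbit_g2 by blast

lemma Orb_linear: "\<nu> \<in> Orb \<Longrightarrow> x \<in> H \<Longrightarrow> y \<in> H \<Longrightarrow> \<nu> (x + y) = \<nu> x + \<nu> y"
    "\<nu> \<in> Orb \<Longrightarrow> x \<in> H \<Longrightarrow> \<nu> (c *s x) = c * \<nu> x"
  using Orb_lamZ lam_add lam_scale by blast+

definition regular :: "complex^'n \<Rightarrow> bool" where
  "regular h \<longleftrightarrow> h \<in> H \<and> inj_on (\<lambda>\<nu>. \<nu> h) Orb"

lemma hreg_regular: "regular hreg"
  unfolding regular_def inj_on_def using hreg_H Orb_lamZ lamZ_hreg_inj by blast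

lemma scaleH: "h \<in> H \<Longrightarrow> c *s h \<in> H"
  by (rule vec.subspace_scale[OF subspace_H])

lemma f_homogeneous: "mpoly_eval f (pt (c * z) (c *s L)) = c ^ card Orb * mpoly_eval f (pt z L)"
proof -
  let ?F = "\<lambda>L. mpoly_eval f (pt (c * z) (c *s L)) - c ^ card Orb * mpoly_eval f (pt z L)"
  have "line_poly ?F"
    unfolding line_poly_def
  proof (intro allI polycurve_diff polycurve_mult polycurve_const)
    fix x v :: "complex^'n"
    have eq: "c *s (x + u *s v) = c *s x + u *s (c *s v)" for u
      by (simp add: vec.scale_right_distrib vec.scale_left_commute mult.commute)
    show "polycurve (\<lambda>u. mpoly_eval f (pt (c * z) (c *s (x + u *s v))))"
      unfolding eq by (rule polycurve_pt_line[OF polycurve_const])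
  qed (rule polycurve_pt_line[OF polycurve_const])
  moreover have "?F (\<sigma> h) = 0" if "\<sigma> \<in> adjoint_group br" "h \<in> H" for \<sigma> h
  proof -
    have "c *s \<sigma> h = \<sigma> (c *s h)" by (simp add: vec.linear_scale[OF lin_adjoint_group[OF that(1)]])
    then have "mpoly_eval f (pt (c * z) (c *s \<sigma> h)) = (\<Prod>\<nu>\<in>Orb. c * z + \<nu> (c *s h))"
      using f_eval[OF scaleH[OF that(2)] that(1), of "c * z" c] by simp
    also have "\<dots> = (\<Prod>\<nu>\<in>Orb. c * (z + \<nu> h))"
      by (rule prod.cong) (auto simp: Orb_linear that algebra_simps)
    also have "\<dots> = c ^ card Orb * mpoly_eval f (pt z (\<sigma> h))"
      by (simp add: prod.distrib f_eval that)
    finally show ?thesis by simp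
  qed
  ultimately have "?F L = 0" by (rule conj_H_dense)
  then show ?thesis by simp
qed

text \<open>If f vanished on the whole fibre over L, homogeneity would make f(1, c L) zero for all c
  \<noteq> 0, hence for c = 0, where its value is 1.\<close>

lemma f_nonzero_fibre: "\<exists>z. mpoly_eval f (pt z L) \<noteq> 0"
proof (rule ccontr)
  assume "\<not> ?thesis"
  then have z: "mpoly_eval f (pt z L) = 0" for z by blast
  let ?g = "\<lambda>c. mpoly_eval f (pt 1 (0 + c *s L))"
  have "?g c = 0" if "c \<noteq> 0" for c
    using f_homogeneous[of c "1 / c" L] z that by simp
  then have "UNIV - {0} \<subseteq> {c. ?g c = 0}" by auto
  moreover have "infinite (UNIV - {0 :: complex})" using infinite_UNIV_char_0 by (simp add: infinite_remove)
  ultimately have "infinite {c. ?g c = 0}" using finite_subset by blast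
  then have "?g 0 = 0" by (rule polycurve_zero[OF polycurve_pt_line[OF polycurve_const]])
  moreover have "mpoly_eval f (pt 1 0) = 1"
    unfolding f_eval_H[OF H_0] using Orb_linear(2)[OF _ H_0, of _ 0] by (intro prod.neutral) simp
  ultimately show False by simp
qed

lemma f_nonzero: "f \<noteq> 0"
  using f_nonzero_fibre by (metis mpoly_eval_0)

lemma f_total_degree: "mpoly_total_degree f = card Orb"
proof (rule mpoly_total_degree_homogeneous[OF _ f_nonzero])
  fix c and a :: "'n option \<Rightarrow> complex"
  have e: "(\<lambda>v. c * a v) = pt (c * a None) (c *s coords a)"
    by (rule ext) (simp add: pt_def coords_def split: option.split)
  show "mpoly_eval f (\<lambda>v. c * a v) = c ^ card Orb * mpoly_eval f a"
    unfolding e f_homogeneous pt_coords ..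
qed

text \<open>A common zero would make (z + \<nu> h)^2 divide f on this fibre, but at a regular h the
  root is simple.\<close>

lemma no_common_zero:
  assumes PQ: "P * Q = f" and h: "regular h" and \<sigma>: "\<sigma> \<in> adjoint_group br" and \<nu>: "\<nu> \<in> Orb"
  shows "\<not> (mpoly_eval P (pt (- \<nu> h) (\<sigma> h)) = 0 \<and> mpoly_eval Q (pt (- \<nu> h) (\<sigma> h)) = 0)"
proof
  assume z: "mpoly_eval P (pt (- \<nu> h) (\<sigma> h)) = 0 \<and> mpoly_eval Q (pt (- \<nu> h) (\<sigma> h)) = 0"
  have hH: "h \<in> H" using h by (simp add: regular_def)
  have curve: "polycurve (\<lambda>z. mpoly_eval R (pt z (\<sigma> h)))" for R :: "'n option mpoly"
    by (rule polycurve_pt[OF polycurve_id polycurve_const])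
  obtain p where p: "\<And>z. mpoly_eval P (pt z (\<sigma> h)) = poly p z" using curve unfolding polycurve_def by blast
  obtain q where q: "\<And>z. mpoly_eval Q (pt z (\<sigma> h)) = poly q z" using curve unfolding polycurve_def by blast
  let ?l = "[:\<nu> h, 1:]" and ?R = "\<Prod>\<nu>'\<in>Orb - {\<nu>}. [:\<nu>' h, 1:]"
  have "poly (p * q) z = poly (?l * ?R) z" for z
  proof -
    have "poly (p * q) z = mpoly_eval f (pt z (\<sigma> h))" by (simp add: PQ[symmetric] mpoly_eval_mult p q)
    also have "\<dots> = (z + \<nu> h) * (\<Prod>\<nu>'\<in>Orb - {\<nu>}. z + \<nu>' h)"
      unfolding f_eval[OF hH \<sigma>] using prod.remove[OF finite_Orb \<nu>] by simp
    finally show ?thesis by (simp add: poly_prod add.commute distrib_right)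
  qed
  then have pq: "p * q = ?l * ?R" by (intro poly_eq_poly_eq_iff[THEN iffD1] ext)
  have "[:- (- \<nu> h), 1:] dvd p" "[:- (- \<nu> h), 1:] dvd q" using z p q by (simp_all only: poly_eq_0_iff_dvd[symmetric])
  then have "?l * ?l dvd ?l * ?R" unfolding pq[symmetric] by (intro mult_dvd_mono) simp_all
  then have "?l dvd ?R" by (subst (asm) dvd_mult_cancel_left) auto
  then have "poly ?R (- \<nu> h) = 0" using poly_eq_0_iff_dvd[of ?R "- \<nu> h"] by simp
  then obtain \<nu>' where "\<nu>' \<in> Orb" "\<nu>' \<noteq> \<nu>" "\<nu>' h = \<nu> h"
    using finite_Orb by (auto simp: poly_prod)
  then show False using h \<nu> unfolding regular_def inj_on_def by blast
qed

text \<open>Along exp (t ad x) the number -\<nu> h remains a zero of f, so P or Q vanishes on the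
  whole curve, and by \<open>no_common_zero\<close> they never vanish together.\<close>

lemma zero_exp_ad:
  assumes PQ: "P * Q = f" and h: "regular h" and \<sigma>: "\<sigma> \<in> adjoint_group br" and \<nu>: "\<nu> \<in> Orb" and x: "ad_nilpotent br x"
  shows "mpoly_eval P (pt (- \<nu> h) (exp_ad br x (\<sigma> h))) = 0 \<longleftrightarrow> mpoly_eval P (pt (- \<nu> h) (\<sigma> h)) = 0"
proof -
  have hH: "h \<in> H" using h by (simp add: regular_def)
  let ?c = "\<lambda>R t. mpoly_eval R (pt (- \<nu> h) (exp_ad br (t *s x) (\<sigma> h)))"
  have curve: "polycurve (?c R)" for R :: "'n option mpoly"
    by (rule polycurve_pt[OF polycurve_const polycurve_exp_ad])
  have \<sigma>t: "exp_ad br (t *s x) \<circ> \<sigma> \<in> adjoint_group br" for t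
    using adjoint_group.step[OF \<sigma> ad_nilpotent_scale[OF x]] .
  have "?c P t * ?c Q t = 0" for t
  proof -
    have "?c P t * ?c Q t = mpoly_eval f (pt (- \<nu> h) ((exp_ad br (t *s x) \<circ> \<sigma>) h))"
      by (simp add: PQ[symmetric] mpoly_eval_mult)
    also have "\<dots> = 0" unfolding f_eval[OF hH \<sigma>t] using finite_Orb \<nu> by auto
    finally show ?thesis .
  qed
  then consider "\<forall>t. ?c P t = 0" | "\<forall>t. ?c Q t = 0" using polycurve_mult_zero[OF curve curve] by blast
  then show ?thesis
  proof cases
    case 1
    from 1[THEN spec, of 0] 1[THEN spec, of 1] show ?thesis by (simp add: exp_ad_0)
  next
    case 2
    then have "?c P t \<noteq> 0" for t using no_common_zero[OF PQ h \<sigma>t[of t] \<nu>] by auto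
    from this[of 0] this[of 1] show ?thesis by (simp add: exp_ad_0)
  qed
qed

lemma zero_conj:
  assumes PQ: "P * Q = f" and h: "regular h" and \<sigma>: "\<sigma> \<in> adjoint_group br" and \<nu>: "\<nu> \<in> Orb"
  shows "mpoly_eval P (pt (- \<nu> h) (\<sigma> h)) = 0 \<longleftrightarrow> mpoly_eval P (pt (- \<nu> h) h) = 0"
  using \<sigma>
proof (induction rule: adjoint_group.induct)
  case (step \<sigma> x)
  then show ?case using zero_exp_ad[OF PQ h step.hyps(1) \<nu> step.hyps(2)] by simp
qed simp

text \<open>The line from h to h' in H may pass through non-regular points; the curve argument
  tolerates them, since simplicity of the root is invoked only at h.\<close>

lemma zero_regular:
  assumes PQ: "P * Q = f" and h: "regular h" "regular h'" and \<nu>: "\<nu> \<in> Orb"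
    and z: "mpoly_eval P (pt (- \<nu> h) h) = 0"
  shows "mpoly_eval P (pt (- \<nu> h') h') = 0"
proof -
  have hH: "h \<in> H" "h' \<in> H" using h by (simp_all add: regular_def)
  let ?h = "\<lambda>t. h + t *s (h' - h)"
  have htH: "?h t \<in> H" for t using hH by (intro vec.subspace_add vec.subspace_scale vec.subspace_diff subspace_H)
  have dH: "h' - h \<in> H" using hH by (intro vec.subspace_diff subspace_H)
  have nu: "\<nu> (?h t) = \<nu> h + t * \<nu> (h' - h)" for t
    unfolding Orb_linear(1)[OF \<nu> hH(1) scaleH[OF dH]] Orb_linear(2)[OF \<nu> dH] ..
  let ?c = "\<lambda>R t. mpoly_eval R (pt (- \<nu> (?h t)) (?h t))"
  have curve: "polycurve (?c R)" for R :: "'n option mpoly"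
    unfolding nu by (rule polycurve_pt_line) (intro polycurve_intros)
  have "?c P t * ?c Q t = 0" for t
    using f_eval_H[OF htH[of t], of "- \<nu> (?h t)"] finite_Orb \<nu> by (auto simp: PQ[symmetric] mpoly_eval_mult)
  then consider "\<forall>t. ?c P t = 0" | "\<forall>t. ?c Q t = 0" using polycurve_mult_zero[OF curve curve] by blast
  then show ?thesis
  proof cases
    case 1
    from 1[THEN spec, of 1] show ?thesis by simp
  next
    case 2
    from 2[THEN spec, of 0] show ?thesis using no_common_zero[OF PQ h(1) adjoint_group.id \<nu>] z by simp
  qed
qed

lemma Orb_reflection: "\<nu> \<in> Orb \<Longrightarrow> \<alpha> \<in> roots br H \<Longrightarrow> reflection br H \<alpha> \<nu> \<in> Orb"
  unfolding Orb_def by (rule weyl_orbit.refl)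

text \<open>Conjugation moves \<open>hreg\<close> to its reflection h while z = -\<nu>(hreg) stays
  fixed; over h this is the zero labelled by the reflected weight. Returning to \<open>hreg\<close>
  along H keeps that label.\<close>

lemma zero_reflection:
  assumes PQ: "P * Q = f" and \<nu>: "\<nu> \<in> Orb" and \<alpha>: "\<alpha> \<in> roots br H"
    and z: "mpoly_eval P (pt (- \<nu> hreg) hreg) = 0"
  shows "mpoly_eval P (pt (- reflection br H \<alpha> \<nu> hreg) hreg) = 0"
proof -
  let ?t = "coroot br H \<alpha>" and ?r = "reflection br H \<alpha>"
  let ?h = "hreg - \<alpha> hreg *s ?t"
  note tH = sl2_triple(2)[OF \<alpha>]
  obtain e f where ef: "root_space br H \<alpha> = vec.span {e}" "root_space br H (\<lambda>t. - \<alpha> t) = vec.span {f}" "br e f = ?t"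
    using sl2_triple(1)[OF \<alpha>] by blast
  have e: "e \<in> root_space br H \<alpha>" and f: "f \<in> root_space br H (\<lambda>t. - \<alpha> t)"
    unfolding ef by (simp_all add: vec.span_base)
  have f': "- f \<in> root_space br H (\<lambda>t. - \<alpha> t)" using f by (simp add: root_space_def br_neg2)
  have ne: "ad_nilpotent br e" by (rule root_vector_nil[OF \<alpha> e])
  have nf: "ad_nilpotent br (- f)" by (rule root_vector_nil[OF root_neg[OF \<alpha>] f'])
  let ?\<sigma> = "exp_ad br e \<circ> (exp_ad br (- f) \<circ> (exp_ad br e \<circ> id))"
  have \<sigma>: "?\<sigma> \<in> adjoint_group br" by (intro adjoint_group.intros ne nf)
  have \<sigma>h: "?\<sigma> hreg = ?h" using exp_reflection[OF \<alpha> e f ef(3) hreg_H] by simp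
  have hH: "?h \<in> H" using hreg_H tH by (intro vec.subspace_diff vec.subspace_scale subspace_H)
  have val: "\<nu>' ?h = ?r \<nu>' hreg" if "\<nu>' \<in> Orb" for \<nu>'
  proof -
    have "?h = hreg + (- \<alpha> hreg) *s ?t" by simp
    then have "\<nu>' ?h = \<nu>' hreg + \<nu>' ((- \<alpha> hreg) *s ?t)"
      using Orb_linear(1)[OF that hreg_H scaleH[OF tH, of "- \<alpha> hreg"]] by simp
    then show ?thesis using Orb_linear(2)[OF that tH, of "- \<alpha> hreg"] by (simp add: reflection_def mult.commute)
  qed
  have inv: "?r (?r \<nu>') = \<nu>'" for \<nu>' by (rule reflection_involution[OF \<alpha>])
  have "regular ?h"
    unfolding regular_def
  proof (intro conjI hH inj_onI)
    fix \<nu>1 \<nu>2 assume a: "\<nu>1 \<in> Orb" "\<nu>2 \<in> Orb" "\<nu>1 ?h = \<nu>2 ?h"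
    then have "?r \<nu>1 hreg = ?r \<nu>2 hreg" by (simp add: val)
    then have "?r \<nu>1 = ?r \<nu>2"
      using hreg_regular Orb_reflection[OF _ \<alpha>] a unfolding regular_def inj_on_def by blast
    then show "\<nu>1 = \<nu>2" using inv by metis
  qed
  moreover have r\<nu>: "?r \<nu> \<in> Orb" by (rule Orb_reflection[OF \<nu> \<alpha>])
  moreover have "mpoly_eval P (pt (- ?r \<nu> ?h) ?h) = 0"
    using zero_conj[OF PQ hreg_regular \<sigma> \<nu>] z unfolding \<sigma>h val[OF r\<nu>] inv by simp
  ultimately show ?thesis using zero_regular[OF PQ _ hreg_regular] by blast
qed

lemma zero_set_trivial:
  assumes PQ: "P * Q = f" and \<nu>: "\<nu> \<in> Orb" "mpoly_eval P (pt (- \<nu> hreg) hreg) = 0" and \<nu>': "\<nu>' \<in> Orb"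
  shows "mpoly_eval P (pt (- \<nu>' hreg) hreg) = 0"
proof -
  have "\<nu>' \<in> orb \<nu>"
    using \<nu>(1) \<nu>' weyl_orbit_sym weyl_orbit_trans unfolding Orb_def by blast
  then have "\<nu>' \<in> Orb \<and> mpoly_eval P (pt (- \<nu>' hreg) hreg) = 0"
  proof (induction rule: weyl_orbit.induct)
    case (refl \<nu>' \<alpha>)
    then show ?case using zero_reflection[OF PQ _ refl.hyps(2)] Orb_reflection by blast
  qed (use \<nu> in simp)
  then show ?thesis by blast
qed

text \<open>Without zeros over regular conjugates, P does not depend on z there, hence nowhere. A
  zero of P at (0, L) would then make f vanish on the fibre over L, so P has no zeros at all and is
  constant on every line through 0.\<close>

lemma no_zero_unit:
  assumes PQ: "P * Q = f" and nz: "\<And>\<nu>. \<nu> \<in> Orb \<Longrightarrow> mpoly_eval P (pt (- \<nu> hreg) hreg) \<noteq> 0"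
  shows "P dvd 1"
proof -
  have nzr: "mpoly_eval P (pt z (\<sigma> h)) \<noteq> 0" if h: "regular h" and \<sigma>: "\<sigma> \<in> adjoint_group br" for z h \<sigma>
  proof
    assume 0: "mpoly_eval P (pt z (\<sigma> h)) = 0"
    have hH: "h \<in> H" using h by (simp add: regular_def)
    have "(\<Prod>\<nu>\<in>Orb. z + \<nu> h) = 0"
      unfolding f_eval[OF hH \<sigma>, symmetric] PQ[symmetric] mpoly_eval_mult using 0 by simp
    then obtain \<nu> where \<nu>: "\<nu> \<in> Orb" "z = - \<nu> h" using finite_Orb by (auto simp: add_eq_0_iff2)
    then have "mpoly_eval P (pt (- \<nu> h) h) = 0" using zero_conj[OF PQ h \<sigma> \<nu>(1)] 0 by simp
    then show False using zero_regular[OF PQ h hreg_regular \<nu>(1)] nz[OF \<nu>(1)] by blast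
  qed
  have const: "mpoly_eval P (pt z L) = mpoly_eval P (pt 0 L)" for z L
  proof -
    let ?F = "\<lambda>L. mpoly_eval P (pt z L) - mpoly_eval P (pt 0 L)"
    have F: "line_poly ?F" by (intro line_poly_diff line_poly_eval)
    have reg: "?F (\<sigma> h) = 0" if h: "regular h" and \<sigma>: "\<sigma> \<in> adjoint_group br" for h \<sigma>
      using polycurve_nowhere_zero[of "\<lambda>z. mpoly_eval P (pt z (\<sigma> h))" z 0]
        polycurve_pt[OF polycurve_id polycurve_const, of P "\<sigma> h"] nzr[OF h \<sigma>] by simp
    have "?F (\<sigma> h) = 0" if \<sigma>: "\<sigma> \<in> adjoint_group br" and h: "h \<in> H" for \<sigma> h
    proof -
      let ?h = "\<lambda>u. hreg + u *s (h - hreg)"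
      have dH: "h - hreg \<in> H" using h hreg_H by (intro vec.subspace_diff subspace_H)
      have hu: "?h u \<in> H" for u by (intro vec.subspace_add vec.subspace_scale subspace_H hreg_H dH)
      have \<sigma>u: "\<sigma> (?h u) = \<sigma> hreg + u *s \<sigma> (h - hreg)" for u
        by (simp only: vec.linear_add[OF lin_adjoint_group[OF \<sigma>]] vec.linear_scale[OF lin_adjoint_group[OF \<sigma>]])
      let ?g = "\<lambda>u. ?F (\<sigma> (?h u))"
      have curve: "polycurve ?g" using F unfolding \<sigma>u line_poly_def by blast
      have nu: "\<nu> (?h u) = \<nu> hreg + u * \<nu> (h - hreg)" if "\<nu> \<in> Orb" for \<nu> u
        using Orb_linear(1)[OF that hreg_H scaleH[OF dH, of u]] Orb_linear(2)[OF that dH, of u] by simp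
      let ?bad = "\<lambda>\<nu> \<nu>'. {u. \<nu> (?h u) = \<nu>' (?h u)}"
      have "finite (?bad \<nu> \<nu>')" if \<nu>: "\<nu> \<in> Orb" "\<nu>' \<in> Orb" "\<nu> \<noteq> \<nu>'" for \<nu> \<nu>'
      proof (cases "\<nu> (h - hreg) = \<nu>' (h - hreg)")
        case True
        have "\<nu> hreg \<noteq> \<nu>' hreg" using hreg_regular \<nu> unfolding regular_def inj_on_def by blast
        then have "?bad \<nu> \<nu>' = {}" unfolding nu[OF \<nu>(1)] nu[OF \<nu>(2)] True by simp
        then show ?thesis by (simp only: finite.emptyI)
      next
        case False
        have "?bad \<nu> \<nu>' \<subseteq> {(\<nu>' hreg - \<nu> hreg) / (\<nu> (h - hreg) - \<nu>' (h - hreg))}"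
          unfolding nu[OF \<nu>(1)] nu[OF \<nu>(2)] using False by (auto simp: field_simps)
        then show ?thesis by (rule finite_subset) simp
      qed
      \<comment> \<open>On the line from \<open>hreg\<close> to h two distinct weights agree for at
        most one parameter, so all but finitely many parameters give regular points.\<close>
      then have "finite (\<Union>\<nu>\<in>Orb. \<Union>\<nu>'\<in>Orb - {\<nu>}. ?bad \<nu> \<nu>')" using finite_Orb by auto
      moreover have "UNIV - (\<Union>\<nu>\<in>Orb. \<Union>\<nu>'\<in>Orb - {\<nu>}. ?bad \<nu> \<nu>') \<subseteq> {u. ?g u = 0}"
      proof
        fix u assume u: "u \<in> UNIV - (\<Union>\<nu>\<in>Orb. \<Union>\<nu>'\<in>Orb - {\<nu>}. ?bad \<nu> \<nu>')"
        have "regular (?h u)" unfolding regular_def inj_on_def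
        proof (intro conjI ballI impI hu)
          fix \<nu> \<nu>' assume "\<nu> \<in> Orb" "\<nu>' \<in> Orb" "\<nu> (?h u) = \<nu>' (?h u)"
          then show "\<nu> = \<nu>'" using u by blast
        qed
        then show "u \<in> {u. ?g u = 0}" using reg[OF _ \<sigma>] by blast
      qed
      ultimately have "infinite {u. ?g u = 0}"
        using Diff_infinite_finite[OF _ infinite_UNIV_char_0[where 'a = complex]] infinite_super by blast
      then have "?g 1 = 0" by (rule polycurve_zero[OF curve])
      then show ?thesis by simp
    qed
    then have "?F L = 0" by (rule conj_H_dense[OF F])
    then show ?thesis by simp
  qed
  have nz0: "mpoly_eval P (pt 0 L) \<noteq> 0" for L
  proof
    assume "mpoly_eval P (pt 0 L) = 0"
    then have "mpoly_eval f (pt z L) = 0" for z by (simp add: PQ[symmetric] mpoly_eval_mult const[of z])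
    then show False using f_nonzero_fibre by blast
  qed
  let ?c = "mpoly_eval P (pt 0 0)"
  have "mpoly_eval P (pt z L) = ?c" for z L
    using polycurve_nowhere_zero[OF polycurve_pt_line[OF polycurve_const, of P 0 0 L] nz0, of 1 0] const[of z L] by simp
  then have "P * Poly_Mapping.single 0 (1 / ?c) = 1"
    by (intro mpoly_eqI_pt) (simp add: mpoly_eval_mult mpoly_eval_const nz0)
  then show ?thesis by (metis dvd_triv_left)
qed

lemma f_irreducible: "irreducible f"
proof (rule irreducibleI)
  show "f \<noteq> 0" by (rule f_nonzero)
  have base: "lamZ (s, t) \<in> Orb" by (simp add: Orb_def weyl_orbit.self)
  show "\<not> f dvd 1"
  proof
    assume "f dvd 1"
    then obtain g where "1 = f * g" by (rule dvdE)
    then have "mpoly_eval f a * mpoly_eval g a = 1" for a by (metis mpoly_eval_mult mpoly_eval_1)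
    moreover have "mpoly_eval f (pt (- lamZ (s, t) hreg) hreg) = 0"
      unfolding f_eval_H[OF hreg_H] using finite_Orb base by (auto intro!: bexI[of _ "lamZ (s, t)"])
    ultimately show False by (metis mult_zero_left zero_neq_one)
  qed
  fix P Q assume "f = P * Q"
  then have PQ: "P * Q = f" and QP: "Q * P = f" by (simp_all add: mult.commute)
  show "P dvd 1 \<or> Q dvd 1"
  proof (cases "\<exists>\<nu>\<in>Orb. mpoly_eval P (pt (- \<nu> hreg) hreg) = 0")
    case False
    then have "P dvd 1" using no_zero_unit[OF PQ] by blast
    then show ?thesis ..
  next
    case True
    then have "mpoly_eval Q (pt (- \<nu> hreg) hreg) \<noteq> 0" if "\<nu> \<in> Orb" for \<nu>
      using zero_set_trivial[OF PQ _ _ that] no_common_zero[OF PQ hreg_regular adjoint_group.id that] by auto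
    then have "Q dvd 1" using no_zero_unit[OF QP] by blast
    then show ?thesis ..
  qed
qed

end

section \<open>The factorization\<close>

lemma f_phi_eval:
  fixes \<phi> :: "complex^'n \<Rightarrow> complex^'d^'d"
  assumes rep: "lie_rep br \<phi>"
  shows "mpoly_eval (f_phi \<phi>) (pt z L) = det (mat z + \<phi> L)"
proof -
  have add: "\<phi> (x + y) = \<phi> x + \<phi> y" and scale: "\<phi> (c *s x) = mat c ** \<phi> x" for x y c
    using rep by (auto simp: lie_rep_def)
  have scale': "\<phi> (c *s x) $ i $ j = c * \<phi> x $ i $ j" for c x i j
    by (simp add: scale matrix_matrix_mult_def mat_def if_distrib[of "\<lambda>x. x * _"] cong: if_cong)
  have zero: "\<phi> 0 = 0" using add[of 0 0] by simp
  have "\<phi> (\<Sum>k\<in>I. x k) = (\<Sum>k\<in>I. \<phi> (x k))" for x and I :: "'n set"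
    by (induction I rule: infinite_finite_induct) (auto simp: add zero)
  note sum = this
  have entry: "\<phi> L $ i $ j = (\<Sum>k\<in>UNIV. L $ k * \<phi> (axis k 1) $ i $ j)" for L i j
  proof -
    have "\<phi> L $ i $ j = \<phi> (\<Sum>k\<in>UNIV. L $ k *s axis k 1) $ i $ j" by (simp only: basis_expansion)
    also have "\<dots> = (\<Sum>k\<in>UNIV. L $ k * \<phi> (axis k 1) $ i $ j)" unfolding sum sum_component scale' ..
    finally show ?thesis .
  qed
  have pe: "polyfun (\<lambda>a :: 'n option \<Rightarrow> complex. (mat (a None) + \<phi> (coords a)) $ i $ j)" for i j
  proof -
    have "polyfun (\<lambda>a :: 'n option \<Rightarrow> complex. mat (a None) $ i $ j :: complex)"
      by (cases "i = j") (simp_all add: mat_def polyfun_var polyfun_const)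
    moreover have "polyfun (\<lambda>a :: 'n option \<Rightarrow> complex. \<phi> (coords a) $ i $ j)"
    proof -
      have "\<phi> (coords a) $ i $ j = (\<Sum>k\<in>UNIV. a (Some k) * \<phi> (axis k 1) $ i $ j)" for a :: "'n option \<Rightarrow> complex"
        using entry[of "coords a" i j] by (simp add: coords_def)
      then show ?thesis by (simp only:) (intro polyfun_sum polyfun_mult polyfun_var polyfun_const)
    qed
    ultimately show ?thesis by (simp add: polyfun_add)
  qed
  have "polyfun (\<lambda>a :: 'n option \<Rightarrow> complex. det (mat (a None) + \<phi> (coords a)))"
    unfolding det_def by (intro polyfun_sum polyfun_mult polyfun_const polyfun_prod pe)
  then obtain P where P: "\<And>a. mpoly_eval P a = det (mat (a None) + \<phi> (coords a))"
    unfolding polyfun_def by blast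
  have "f_phi \<phi> = P"
    unfolding f_phi_def
  proof (rule the_equality)
    show "\<forall>z0 L. mpoly_eval P (pt z0 L) = det (mat z0 + \<phi> L)" by (simp add: P)
    fix Q assume "\<forall>z0 L. mpoly_eval Q (pt z0 L) = det (mat z0 + \<phi> L)"
    then show "Q = P" by (intro mpoly_eqI_pt) (simp add: P)
  qed
  then show ?thesis by (simp add: P)
qed

context g2 begin

lemma f_phi_factorization:
  fixes \<phi> :: "complex^'n \<Rightarrow> complex^'d^'d"
  assumes rep: "lie_rep br \<phi>" and wr: "weight_rep br H \<phi>"
  defines "DW \<equiv> {\<mu> \<in> rep_weights H \<phi>. dominant br H \<alpha>1 \<alpha>2 \<mu>}"
  shows "f_phi \<phi> = (\<Prod>\<mu>\<in>DW. (orbital_factor br H \<mu>) ^ weight_mult H \<phi> \<mu>)"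
proof -
  interpret weight_rep br H \<phi> by (rule wr)
  have coord: "\<exists>s t. \<mu> = lamZ (s, t) \<and> 2 * s - 3*t \<ge> 0 \<and> 2*t - s \<ge> 0" if "\<mu> \<in> DW" for \<mu>
  proof -
    have "\<mu> \<in> rep_weights H \<phi>" using \<open>\<mu> \<in> DW\<close> by (simp add: DW_def)
    then obtain p where "\<mu> = lamZ p" using weight_lamZ[OF wr] by blast
    moreover have "dominant br H \<alpha>1 \<alpha>2 \<mu>" using \<open>\<mu> \<in> DW\<close> by (simp add: DW_def)
    ultimately show ?thesis using dominant_lamZ by (metis surj_pair)
  qed
  have eval: "mpoly_eval (orbital_factor br H \<mu>) (pt z (\<sigma> h)) = (\<Prod>\<nu>\<in>orb \<mu>. z + \<nu> h)"
    if "\<mu> \<in> DW" "\<sigma> \<in> adjoint_group br" "h \<in> H" for \<mu> z \<sigma> h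
    using coord[OF that(1)] orbital_factor_eval that by metis
  have finDW: "finite DW" unfolding DW_def using finite_W by simp
  have finorb: "finite (orb \<mu>)" if \<mu>: "\<mu> \<in> DW" for \<mu>
  proof -
    obtain s t where st: "\<mu> = lamZ (s, t)" using coord[OF \<mu>] by blast
    show ?thesis unfolding st weyl_orbit_g2 by (simp add: g2_orbit_def)
  qed
  have disj: "orb \<mu> \<inter> orb \<mu>' = {}" if \<mu>: "\<mu> \<in> DW" "\<mu>' \<in> DW" "\<mu> \<noteq> \<mu>'" for \<mu> \<mu>'
  proof (rule ccontr)
    assume "orb \<mu> \<inter> orb \<mu>' \<noteq> {}"
    then have "\<mu>' \<in> orb \<mu>" using weyl_orbit_sym weyl_orbit_trans by blast
    moreover obtain s t where st: "\<mu> = lamZ (s, t)" "2 * s - 3*t \<ge> 0" "2*t - s \<ge> 0" using coord[OF \<mu>(1)] by blast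
    moreover obtain u v where uv: "\<mu>' = lamZ (u, v)" "2*u - 3 * v \<ge> 0" "2 * v - u \<ge> 0" using coord[OF \<mu>(2)] by blast
    ultimately have "lamZ (u, v) \<in> lamZ ` g2_orbit s t" using weyl_orbit_g2[of s t] by metis
    then have "(u, v) \<in> g2_orbit s t" unfolding inj_image_mem_iff[OF inj_lamZ] .
    then show False using g2_orbit_dominant_unique[OF st(2,3) _ uv(2,3)] st(1) uv(1) \<mu>(3) by blast
  qed
  \<comment> \<open>Every Weyl orbit of weights meets the dominant chamber, so the product over all
    weights can be grouped by dominant ones.\<close>
  have W_eq: "W = (\<Union>\<mu>\<in>DW. orb \<mu>)"
  proof (intro equalityI subsetI)
    fix \<nu> assume \<nu>: "\<nu> \<in> W"
    obtain s t where st: "\<nu> = lamZ (s, t)" using weight_lamZ[OF wr \<nu>] by (metis surj_pair)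
    obtain u v where uv: "(u, v) \<in> g2_orbit s t" "2*u - 3 * v \<ge> 0" "2 * v - u \<ge> 0"
      using g2_orbit_dominant_ex[of s t] by blast
    have o: "lamZ (u, v) \<in> orb \<nu>" unfolding st weyl_orbit_g2 using uv(1) by blast
    then have "lamZ (u, v) \<in> DW" using orbit_weights[OF \<nu> o] uv dominant_lamZ by (simp add: DW_def)
    then show "\<nu> \<in> (\<Union>\<mu>\<in>DW. orb \<mu>)" using weyl_orbit_sym[OF o] by blast
  next
    fix \<nu> assume "\<nu> \<in> (\<Union>\<mu>\<in>DW. orb \<mu>)"
    then show "\<nu> \<in> W" using orbit_weights by (auto simp: DW_def)
  qed
  let ?R = "\<Prod>\<mu>\<in>DW. (orbital_factor br H \<mu>) ^ weight_mult H \<phi> \<mu>"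
  \<comment> \<open>Invariance of the determinant is recorded in S itself and passed on by
    exponentials of root vectors, for which \<open>det_exp_ad\<close> applies.\<close>
  define S where "S = {\<sigma> h |\<sigma> h. \<sigma> \<in> adjoint_group br \<and> h \<in> H \<and> (\<forall>z. det (mat z + \<phi> (\<sigma> h)) = det (mat z + \<phi> h))}"
  have on_S: "mpoly_eval (f_phi \<phi>) (pt z L) = mpoly_eval ?R (pt z L)" if L: "L \<in> S" for z L
  proof -
    obtain \<sigma> h where \<sigma>: "L = \<sigma> h" "\<sigma> \<in> adjoint_group br" "h \<in> H" "\<And>z. det (mat z + \<phi> (\<sigma> h)) = det (mat z + \<phi> h)"
      using L unfolding S_def by blast
    have "mpoly_eval (f_phi \<phi>) (pt z L) = (\<Prod>\<nu>\<in>W. (z + \<nu> h) ^ weight_mult H \<phi> \<nu>)"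
      unfolding f_phi_eval[OF rep] \<sigma>(1,4) by (rule det_on_H[OF \<sigma>(3)])
    also have "\<dots> = (\<Prod>\<mu>\<in>DW. \<Prod>\<nu>\<in>orb \<mu>. (z + \<nu> h) ^ weight_mult H \<phi> \<nu>)"
      unfolding W_eq by (rule prod.UNION_disjoint) (use finDW finorb disj in auto)
    also have "\<dots> = (\<Prod>\<mu>\<in>DW. (\<Prod>\<nu>\<in>orb \<mu>. z + \<nu> h) ^ weight_mult H \<phi> \<mu>)"
    proof (rule prod.cong[OF HOL.refl])
      fix \<mu> assume "\<mu> \<in> DW"
      then have "(\<Prod>\<nu>\<in>orb \<mu>. (z + \<nu> h) ^ weight_mult H \<phi> \<nu>) = (\<Prod>\<nu>\<in>orb \<mu>. (z + \<nu> h) ^ weight_mult H \<phi> \<mu>)"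
        using orbit_weights by (intro prod.cong) (auto simp: DW_def)
      then show "(\<Prod>\<nu>\<in>orb \<mu>. (z + \<nu> h) ^ weight_mult H \<phi> \<nu>) = (\<Prod>\<nu>\<in>orb \<mu>. z + \<nu> h) ^ weight_mult H \<phi> \<mu>"
        by (simp add: prod_power_distrib)
    qed
    also have "\<dots> = mpoly_eval ?R (pt z L)"
      unfolding mpoly_eval_prod mpoly_eval_power \<sigma>(1) by (rule prod.cong) (auto simp: eval \<sigma>)
    finally show ?thesis .
  qed
  show ?thesis
  proof (rule mpoly_eqI_pt)
    fix z L
    let ?F = "\<lambda>L. mpoly_eval (f_phi \<phi>) (pt z L) - mpoly_eval ?R (pt z L)"
    have "?F L = 0"
    proof (rule conjugates_of_H_dense[where S = S and F = ?F and ?h0.0 = hreg])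
      show "H \<subseteq> S" unfolding S_def by (auto intro!: exI[of _ id] adjoint_group.id)
      show "exp_ad br x L \<in> S" if \<beta>: "\<beta> \<in> roots br H" and x: "x \<in> root_space br H \<beta>" and L: "L \<in> S" for \<beta> x L
      proof -
        obtain \<sigma> h where \<sigma>: "L = \<sigma> h" "\<sigma> \<in> adjoint_group br" "h \<in> H" "\<And>z. det (mat z + \<phi> (\<sigma> h)) = det (mat z + \<phi> h)"
          using L unfolding S_def by blast
        obtain h0 where h0: "h0 \<in> H" "\<beta> h0 \<noteq> 0" using root_nonzero[OF \<beta>] by blast
        note nil = root_vector_nil[OF \<beta> x]
        have "det (mat z + \<phi> ((exp_ad br x \<circ> \<sigma>) h)) = det (mat z + \<phi> h)" for z
          using det_exp_ad[OF nil root_vector_nilpotent[OF x h0], of z "\<sigma> h"] \<sigma>(4) by simp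
        moreover have "exp_ad br x \<circ> \<sigma> \<in> adjoint_group br" by (rule adjoint_group.step[OF \<sigma>(2) nil])
        moreover have "exp_ad br x L = (exp_ad br x \<circ> \<sigma>) h" by (simp add: \<sigma>(1))
        ultimately show ?thesis unfolding S_def using \<sigma>(3) by blast
      qed
    qed (auto intro: line_poly_diff line_poly_eval hreg_H simp: on_S root_hreg)
    then show "mpoly_eval (f_phi \<phi>) (pt z L) = mpoly_eval ?R (pt z L)" by simp
  qed
qed

end

theorem theorem4p11:
  fixes br :: "complex^'n \<Rightarrow> complex^'n \<Rightarrow> complex^'n"
    and H :: "(complex^'n) set"
    and \<alpha>1 \<alpha>2 :: "complex^'n \<Rightarrow> complex"
    and \<phi> :: "complex^'n \<Rightarrow> complex^'d^'d"
  assumes "simple_lie_algebra br"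
    and "cartan_subalgebra br H"
    and "g2_base br H \<alpha>1 \<alpha>2"
    and "lie_rep br \<phi>"
    and "irreducible_rep \<phi>"
  defines "DW \<equiv> {\<mu> \<in> rep_weights H \<phi>. dominant br H \<alpha>1 \<alpha>2 \<mu>}"
  shows "f_phi \<phi> = (\<Prod>\<mu>\<in>DW. (orbital_factor br H \<mu>) ^ weight_mult H \<phi> \<mu>)
    \<and> (\<forall>\<mu>\<in>DW. irreducible (orbital_factor br H \<mu>)
              \<and> mpoly_total_degree (orbital_factor br H \<mu>) = card (weyl_orbit br H \<mu>))"
proof -
  interpret g2 br H \<alpha>1 \<alpha>2 by unfold_locales (fact assms)+
  have wr: "weight_rep br H \<phi>" by (rule irreducible_weight_rep[OF assms(4,5)])
  have "irreducible (orbital_factor br H \<mu>) \<and> mpoly_total_degree (orbital_factor br H \<mu>) = card (weyl_orbit br H \<mu>)"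
    if "\<mu> \<in> DW" for \<mu>
  proof -
    have \<mu>: "\<mu> \<in> rep_weights H \<phi>" "dominant br H \<alpha>1 \<alpha>2 \<mu>" using that by (simp_all add: DW_def)
    obtain p where p: "\<mu> = lamZ p" using weight_lamZ[OF wr \<mu>(1)] by blast
    obtain s t where st: "\<mu> = lamZ (s, t)" using p by (metis surj_pair)
    have "2 * s - 3*t \<ge> 0" "2*t - s \<ge> 0" using \<mu>(2) unfolding st dominant_lamZ by blast+
    then interpret g2_orbital br H \<alpha>1 \<alpha>2 s t by unfold_locales
    show ?thesis using f_irreducible f_total_degree unfolding f_def Orb_def st by blast
  qed
  then show ?thesis using f_phi_factorization[OF assms(4) wr] unfolding DW_def by blast
qed

end
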